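(* Let $\Omega\subset\mathbb{R}^n$ be open, $T>0$, $0<\alpha<1$, and suppose $f\in L^\infty(0,T;L^2(\Omega))$ satisfies $D_t^\alpha f\in L^2(0,T;L^2(\Omega))$. Then $D_t^\alpha\|f\|_{L^2(\Omega)}^2\in L^1(0,T)$ and $$D_t^\alpha\|f(t)\|_{L^2(\Omega)}^2\le 2\big(D_t^\alpha f(t),f(t)\big)_{L^2(\Omega)}$$ for almost every $t\in(0,T)$.
   Context: For $g:[0,T]\to X$ ($X$ a Banach space, or $X=\mathbb{R}$), $J_t^{1-\alpha}g(t)=\frac{1}{\Gamma(1-\alpha)}\int_0^t(t-s)^{-\alpha}g(s)\,ds$ and the Riemann–Liouville derivative is $D_t^\alpha g=\frac{d}{dt}\big(J_t^{1-\alpha}g\big)$, the derivative being the weak derivative; $D_t^\alpha\|f\|_{L^2(\Omega)}^2$ denotes this derivative applied to the scalar function $t\mapsto\|f(t)\|_{L^2(\Omega)}^2$. *)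

theory Defs
  imports "HOL-Analysis.Analysis"
begin

definition test_fun :: "real \<Rightarrow> real \<Rightarrow> (real \<Rightarrow> real) \<Rightarrow> bool" where
  "test_fun a b \<phi> \<longleftrightarrow>
     (\<forall>k::nat. \<forall>t. ((deriv ^^ k) \<phi>) differentiable (at t)) \<and>
     (\<exists>c d. a < c \<and> d < b \<and> (\<forall>t. t \<notin> {c..d} \<longrightarrow> \<phi> t = 0))"

definition loc_integrable_on :: "real \<Rightarrow> real \<Rightarrow> (real \<Rightarrow> real) \<Rightarrow> bool" where
  "loc_integrable_on a b u \<longleftrightarrow>
     (\<forall>K. compact K \<and> K \<subseteq> {a<..<b} \<longrightarrow> set_integrable lborel K u)"

definition weak_deriv_on :: "real \<Rightarrow> real \<Rightarrow> (real \<Rightarrow> real) \<Rightarrow> (real \<Rightarrow> real) \<Rightarrow> bool" where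
  "weak_deriv_on a b u v \<longleftrightarrow>
     loc_integrable_on a b u \<and> loc_integrable_on a b v \<and>
     (\<forall>\<phi>. test_fun a b \<phi> \<longrightarrow>
        (LINT t:{a<..<b}|lborel. u t * deriv \<phi> t) = - (LINT t:{a<..<b}|lborel. v t * \<phi> t))"

text \<open>Weak derivative on (0,T) of an L^2(\<Omega>)-valued function, represented as a function
  u t x; the Bochner-integral identity in L^2(\<Omega>) is expressed pointwise a.e. in x.\<close>
definition weak_deriv_L2 ::
  "real \<Rightarrow> 'a::euclidean_space set \<Rightarrow> (real \<Rightarrow> 'a \<Rightarrow> real) \<Rightarrow> (real \<Rightarrow> 'a \<Rightarrow> real) \<Rightarrow> bool" where
  "weak_deriv_L2 T \<Omega> u v \<longleftrightarrow>
     (\<forall>K. compact K \<and> K \<subseteq> {0<..<T} \<longrightarrow>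
        (\<integral>\<^sup>+t\<in>K. ennreal (sqrt (enn2real (\<integral>\<^sup>+x\<in>\<Omega>. ennreal ((u t x)\<^sup>2) \<partial>lborel))) \<partial>lborel) < \<infinity>
      \<and> (\<integral>\<^sup>+t\<in>K. ennreal (sqrt (enn2real (\<integral>\<^sup>+x\<in>\<Omega>. ennreal ((v t x)\<^sup>2) \<partial>lborel))) \<partial>lborel) < \<infinity>
) \<and>
     (AE t in lborel. t \<in> {0<..<T} \<longrightarrow>
        (\<integral>\<^sup>+x\<in>\<Omega>. ennreal ((u t x)\<^sup>2) \<partial>lborel) < \<infinity> \<and>
        (\<integral>\<^sup>+x\<in>\<Omega>. ennreal ((v t x)\<^sup>2) \<partial>lborel) < \<infinity>) \<and>
     (\<forall>\<phi>. test_fun 0 T \<phi> \<longrightarrow>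
        (AE x in lborel. x \<in> \<Omega> \<longrightarrow>
           (LINT t:{0<..<T}|lborel. u t x * deriv \<phi> t) = - (LINT t:{0<..<T}|lborel. v t x * \<phi> t)))"

definition RL_int :: "real \<Rightarrow> (real \<Rightarrow> real) \<Rightarrow> real \<Rightarrow> real" where
  "RL_int \<alpha> h t = (1 / Gamma (1 - \<alpha>)) * (LINT s:{0<..<t}|lborel. (t - s) powr (- \<alpha>) * h s)"

definition RL_int_vec :: "real \<Rightarrow> (real \<Rightarrow> 'a \<Rightarrow> real) \<Rightarrow> real \<Rightarrow> 'a \<Rightarrow> real" where
  "RL_int_vec \<alpha> u t x = RL_int \<alpha> (\<lambda>s. u s x) t"

end

theory Submission
  imports Defs
begin

text \<open>Write \<open>k\<close> for the kernel of \<open>J\<^sup>1\<^sup>-\<^sup>\<alpha>\<close> and \<open>g = D\<^sup>\<alpha> f\<close>. Since \<open>k\<close> decreases, \<open>f\<close> formally satisfies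
    \<open>D\<^sup>\<alpha> f\<^sup>2 (t) + \<integral>\<^bsub>s < t\<^esub> - k'(t - s) (f t - f s)\<^sup>2 ds = 2 f g (t)\<close>
  when extended by \<open>0\<close> to negative times, and the second summand is nonnegative.
  For the shifted kernels \<open>k\<^sub>\<epsilon>(t) = k(t + \<epsilon>)\<close> this is plain algebra, with \<open>g\<close> replaced by the derivative of
  \<open>k\<^sub>\<epsilon> * f\<close>. The latter is \<open>h\<^sub>\<epsilon> * g\<close> for an explicit approximate identity \<open>h\<^sub>\<epsilon>\<close>,
  because \<open>f = l * g\<close> with \<open>l\<close> the kernel of \<open>J\<^sup>\<alpha>\<close>. As \<open>\<epsilon>\<close> decreases to \<open>0\<close>, both terms on the left
  increase, so monotone convergence yields the time-integrated identity with the exact dissipation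
  rather than just an inequality; this is what makes \<open>D\<^sup>\<alpha> \<parallel>f\<parallel>\<^sup>2\<close> an integrable function and not only a measure.
  The argument is run at almost every point of \<open>\<Omega>\<close> and integrated over \<open>\<Omega>\<close> afterwards.\<close>

section \<open>Integrability, translations and iterated convolutions\<close>

text \<open>Two obstacles shape the work around the energy identity. The weak derivative is tested
  pointwise in x, and its exceptional null set in \<Omega> depends on the test function. Hence only
  countably many test functions are used: primitives of differences of normalised bumps, one bump
  having rational endpoints relative to T and the other fixed. They still suffice for a du
  Bois-Reymond argument. That argument gives J^(1-\<alpha>) f = J^1 g only up to a constant c(x),
  that is f = l * g + c l, and the L^\<infinity> bound in time is what forces c = 0. The approximate
  identity comes from differentiating k_\<epsilon> * l, which gives h(x / \<epsilon>) / \<epsilon>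
  with h(r) = r^(\<alpha>-1) / ((1 + r) Gamma(\<alpha>) Gamma(1-\<alpha>)), a probability density on
  the half-line. As the convolution with g is only paired with f, its limit follows from continuity
  of translations in L^2.\<close>

lemma AE_zero_if_initial_integrals_zero:
  fixes w :: "real \<Rightarrow> real"
  assumes w: "integrable lborel w"
    and zero: "\<And>t. (\<integral>s. indicator {..t} s * w s \<partial>lborel) = 0"
  shows "AE s in lborel. w s = 0"
proof -
  have [measurable]: "w \<in> borel_measurable borel"
    using w by auto
  \<comment> \<open>Half-lines generate the Borel sets, but the complement step of the induction
    below also needs the integral over the whole line, which is reached only as a limit of
    half-lines.\<close>
  have "(\<lambda>n. \<integral>s. indicator {..real n} s * w s \<partial>lborel) \<longlonglongrightarrow> (\<integral>s. w s \<partial>lborel)"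
  proof (rule integral_dominated_convergence[where w="\<lambda>s. \<bar>w s\<bar>"])
    show "AE s in lborel. (\<lambda>n. indicator {..real n} s * w s) \<longlonglongrightarrow> w s"
    proof (intro AE_I2 tendsto_eventually)
      fix s :: real
      show "\<forall>\<^sub>F n in sequentially. indicator {..real n} s * w s = w s"
        using eventually_ge_at_top[of "nat \<lceil>s\<rceil>"]
        by eventually_elim (auto simp: indicator_def nat_le_iff ceiling_le_iff)
    qed
  qed (use w in \<open>auto simp: indicator_def\<close>)
  then have total: "(\<integral>s. w s \<partial>lborel) = 0"
    by (simp add: zero LIMSEQ_const_iff)
  have "set_lebesgue_integral lborel B w = 0" if "B \<in> sets borel" for B
  proof -
    have "Int_stable (range (\<lambda>a::real. {..a}))"
      by (auto simp: Int_stable_def)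
    moreover have "range (\<lambda>a::real. {..a}) \<subseteq> Pow UNIV" by simp
    moreover have "B \<in> sigma_sets UNIV (range (\<lambda>a::real. {..a}))"
      using that by (subst (asm) borel_eq_atMost) simp
    ultimately show ?thesis
    proof (induction rule: sigma_sets_induct_disjoint)
      case (basic A)
      then show ?case using zero by (auto simp: set_lebesgue_integral_def)
    next
      case empty
      then show ?case by (simp add: set_lebesgue_integral_def)
    next
      case (compl A)
      then have [measurable]: "A \<in> sets borel"
        by (simp add: borel_eq_atMost)
      have "set_lebesgue_integral lborel (UNIV - A) w
          = (\<integral>s. w s - indicator A s *\<^sub>R w s \<partial>lborel)"
        unfolding set_lebesgue_integral_def
        by (intro Bochner_Integration.integral_cong) (auto simp: indicator_def)
      also have "\<dots> = (\<integral>s. w s \<partial>lborel) - set_lebesgue_integral lborel A w"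
        unfolding set_lebesgue_integral_def
        by (intro Bochner_Integration.integral_diff w integrable_mult_indicator) auto
      finally show ?case using compl total by simp
    next
      case (union A)
      then have A: "\<And>i. A i \<in> sets lborel"
        by (auto simp: borel_eq_atMost)
      have "set_integrable lborel (\<Union>i. A i) w"
        unfolding set_integrable_def using w A by (intro integrable_mult_indicator) auto
      then have "set_lebesgue_integral lborel (\<Union>i. A i) w = (\<Sum>i. set_lebesgue_integral lborel (A i) w)"
        using union(1) A by (intro lebesgue_integral_countable_add) (auto simp: disjoint_family_on_def)
      then show ?case using union by simp
    qed
  qed
  then show ?thesis
    using w by (intro sigma_finite_measure.density_zero[OF sigma_finite_lborel]) auto
qed

text \<open>U and its translate have the same measure, so the L^1 distance of their indicators is
  twice the measure that U loses on intersection with the translate. Openness makes the product of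
  the two indicators converge pointwise, which can fail for a general Borel set.\<close>

lemma L1_translation_open:
  fixes U :: "real set"
  assumes U: "open U" "emeasure lborel U < \<infinity>" and e: "e \<longlonglongrightarrow> (0::real)"
  shows "(\<lambda>n. \<integral>x. \<bar>indicator U (x - e n) - indicator U x\<bar> \<partial>lborel) \<longlonglongrightarrow> (0::real)"
proof -
  have [measurable]: "U \<in> sets borel" using U by simp
  have int: "integrable lborel (indicator U :: real \<Rightarrow> real)"
    using U by (intro integrable_real_indicator) auto
  have ints: "integrable lborel (\<lambda>x. indicator U (x - a) :: real)" for a
    using lborel_integrable_real_affine[OF int, of 1 "-a"] by (simp add: algebra_simps)
  have eqs: "(\<integral>x. indicator U (x - a) \<partial>lborel) = (\<integral>x. indicator U x \<partial>lborel :: real)" for a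
    using lborel_integral_real_affine[of 1 "indicator U :: real \<Rightarrow> real" "-a"]
    by (simp add: algebra_simps)
  have intp: "integrable lborel (\<lambda>x. indicator U (x - a) * indicator U x :: real)" for a
    by (rule Bochner_Integration.integrable_bound[OF int]) (auto simp: indicator_def)
  have "(\<lambda>n. \<integral>x. indicator U (x - e n) * indicator U x \<partial>lborel) \<longlonglongrightarrow> (\<integral>x. indicator U x \<partial>lborel :: real)"
  proof (rule integral_dominated_convergence[where w="indicator U"])
    show "AE x in lborel. (\<lambda>n. indicator U (x - e n) * indicator U x :: real) \<longlonglongrightarrow> indicator U x"
    proof (intro AE_I2 tendsto_eventually)
      fix x :: real
      have "(\<lambda>n. x - e n) \<longlonglongrightarrow> x" using e by (auto intro!: tendsto_eq_intros)
      then have "x \<in> U \<Longrightarrow> \<forall>\<^sub>F n in sequentially. x - e n \<in> U"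
        using U(1) by (rule topological_tendstoD)
      then show "\<forall>\<^sub>F n in sequentially. indicator U (x - e n) * indicator U x = (indicator U x :: real)"
        by (cases "x \<in> U") (auto elim: eventually_mono)
    qed
  qed (use int in \<open>auto simp: indicator_def\<close>)
  then have "(\<lambda>n. 2 * ((\<integral>x. indicator U x \<partial>lborel) - (\<integral>x. indicator U (x - e n) * indicator U x \<partial>lborel))) \<longlonglongrightarrow> (0::real)"
    by (auto intro!: tendsto_eq_intros)
  moreover have "(\<integral>x. \<bar>indicator U (x - a) - indicator U x\<bar> \<partial>lborel) =
     2 * ((\<integral>x. indicator U x \<partial>lborel) - (\<integral>x. indicator U (x - a) * indicator U x \<partial>lborel) :: real)" for a
  proof -
    have "(\<integral>x. \<bar>indicator U (x - a) - indicator U x\<bar> \<partial>lborel) =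
      (\<integral>x. (indicator U (x - a) + indicator U x - 2 * (indicator U (x - a) * indicator U x)) \<partial>lborel :: real)"
      by (intro Bochner_Integration.integral_cong) (auto simp: indicator_def)
    also have "\<dots> = 2 * ((\<integral>x. indicator U x \<partial>lborel) - (\<integral>x. indicator U (x - a) * indicator U x \<partial>lborel))"
      using int ints intp eqs by simp
    finally show ?thesis .
  qed
  ultimately show ?thesis by simp
qed

lemma translation_diff_integrable:
  fixes w :: "real \<Rightarrow> real"
  assumes "integrable lborel w"
  shows "integrable lborel (\<lambda>x. w (x - a))" "integrable lborel (\<lambda>x. \<bar>w (x - a) - w x\<bar>)"
proof -
  show "integrable lborel (\<lambda>x. w (x - a))"
    using lborel_integrable_real_affine[OF assms, of 1 "-a"] by (simp add: algebra_simps)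
  with assms show "integrable lborel (\<lambda>x. \<bar>w (x - a) - w x\<bar>)" by auto
qed

text \<open>Translation is an isometry of L^1, so the functions with continuous translation form a
  closed set: two copies of the approximation error plus the modulus of w' bound the modulus of w.
  With each of the three at most r/4 the sum stays below r.\<close>

lemma L1_translation_approx:
  fixes w :: "real \<Rightarrow> real"
  assumes w: "integrable lborel w"
    and approx: "\<And>d. d > 0 \<Longrightarrow> \<exists>w'. integrable lborel w' \<and> (\<integral>x. \<bar>w x - w' x\<bar> \<partial>lborel) \<le> d \<and>
      (\<lambda>n. \<integral>x. \<bar>w' (x - e n) - w' x\<bar> \<partial>lborel) \<longlonglongrightarrow> 0"
  shows "(\<lambda>n. \<integral>x. \<bar>w (x - e n) - w x\<bar> \<partial>lborel) \<longlonglongrightarrow> 0"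
proof (rule LIMSEQ_I)
  fix r :: real assume "r > 0"
  then obtain w' where w': "integrable lborel w'" and d: "(\<integral>x. \<bar>w x - w' x\<bar> \<partial>lborel) \<le> r/4"
    and lim: "(\<lambda>n. \<integral>x. \<bar>w' (x - e n) - w' x\<bar> \<partial>lborel) \<longlonglongrightarrow> 0"
    using approx[of "r/4"] by auto
  from LIMSEQ_D[OF lim, of "r/4"] \<open>r > 0\<close> obtain N where
    N: "\<And>n. n \<ge> N \<Longrightarrow> \<bar>\<integral>x. \<bar>w' (x - e n) - w' x\<bar> \<partial>lborel\<bar> < r/4" by auto
  have "(\<integral>x. \<bar>w (x - e n) - w x\<bar> \<partial>lborel) < r" if "n \<ge> N" for n
  proof -
    have i1: "integrable lborel (\<lambda>x. \<bar>w x - w' x\<bar>)" using w w' by auto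
    note i2 = translation_diff_integrable(1)[OF i1, of "e n"]
    note i3 = translation_diff_integrable(2)[OF w', of "e n"]
    have "(\<integral>x. \<bar>w (x - e n) - w x\<bar> \<partial>lborel) \<le>
      (\<integral>x. (\<bar>w (x - e n) - w' (x - e n)\<bar> + \<bar>w' (x - e n) - w' x\<bar>) + \<bar>w x - w' x\<bar> \<partial>lborel)"
      using i1 i2 i3 translation_diff_integrable(2)[OF w, of "e n"]
      by (intro integral_mono) auto
    also have "\<dots> = (\<integral>x. \<bar>w (x - e n) - w' (x - e n)\<bar> \<partial>lborel) + (\<integral>x. \<bar>w' (x - e n) - w' x\<bar> \<partial>lborel)
      + (\<integral>x. \<bar>w x - w' x\<bar> \<partial>lborel)"
      using i1 i2 i3 by simp
    also have "(\<integral>x. \<bar>w (x - e n) - w' (x - e n)\<bar> \<partial>lborel) = (\<integral>x. \<bar>w x - w' x\<bar> \<partial>lborel)"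
      using lborel_integral_real_affine[of 1 "\<lambda>x. \<bar>w x - w' x\<bar>" "-e n"] by (simp add: algebra_simps)
    finally show ?thesis using d N[OF that] \<open>r > 0\<close> by linarith
  qed
  then show "\<exists>no. \<forall>n\<ge>no. norm ((\<integral>x. \<bar>w (x - e n) - w x\<bar> \<partial>lborel) - 0) < r"
    by (intro exI[of _ N]) auto
qed

text \<open>Induction over integrable functions: outer regularity replaces a Borel set of finite
  measure by an open one, sums follow from the triangle inequality, limits from closedness in
  L^1.\<close>

lemma L1_translation:
  fixes w :: "real \<Rightarrow> real"
  assumes w: "integrable lborel w" and e: "e \<longlonglongrightarrow> 0"
  shows "(\<lambda>n. \<integral>x. \<bar>w (x - e n) - w x\<bar> \<partial>lborel) \<longlonglongrightarrow> 0"
  using w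
proof (induction rule: integrable_induct)
  case (base A c)
  have A[measurable]: "A \<in> sets borel" using base by simp
  have iA: "integrable lborel (indicator A :: real \<Rightarrow> real)"
    using base by (intro integrable_real_indicator) auto
  have lim: "(\<lambda>n. \<integral>x. \<bar>indicator A (x - e n) - indicator A x\<bar> \<partial>lborel) \<longlonglongrightarrow> (0::real)"
  proof (rule L1_translation_approx[OF iA])
    fix d :: real assume "d > 0"
    from outer_regular_lborel[OF A this] obtain U where U: "open U" "A \<subseteq> U" "emeasure lborel (U - A) < d"
      by auto
    have [measurable]: "U \<in> sets borel" using U by simp
    have "emeasure lborel U = emeasure lborel A + emeasure lborel (U - A)"
      using U(2) by (subst plus_emeasure) (auto intro: arg_cong[where f="emeasure lborel"])
    also have "\<dots> < \<infinity>" using base U(3) by (auto simp: top_unique less_top[symmetric])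
    finally have fin: "emeasure lborel U < \<infinity>" .
    have "(\<integral>x. \<bar>indicator A x - indicator U x\<bar> \<partial>lborel) = (\<integral>x. indicator (U - A) x \<partial>lborel :: real)"
      using U(2) by (intro Bochner_Integration.integral_cong) (auto simp: indicator_def)
    also have "\<dots> = measure lborel (U - A)" by simp
    also have "\<dots> \<le> d"
      using U(3) \<open>d > 0\<close> by (simp add: measure_def enn2real_leI)
    finally show "\<exists>w'. integrable lborel w' \<and> (\<integral>x. \<bar>indicator A x - w' x\<bar> \<partial>lborel) \<le> d \<and>
      (\<lambda>n. \<integral>x. \<bar>w' (x - e n) - w' x\<bar> \<partial>lborel) \<longlonglongrightarrow> (0::real)"
      using L1_translation_open[OF U(1) fin e] fin
      by (intro exI[of _ "indicator U"]) (auto intro!: integrable_real_indicator)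
  qed
  have "(\<integral>x. \<bar>indicator A (x - e n) *\<^sub>R c - indicator A x *\<^sub>R c\<bar> \<partial>lborel) =
    (\<integral>x. \<bar>indicator A (x - e n) - indicator A x\<bar> \<partial>lborel) * \<bar>c\<bar>" for n
    by (subst integral_mult_left_zero[symmetric])
      (auto intro!: Bochner_Integration.integral_cong simp: abs_mult[symmetric] left_diff_distrib)
  then show ?case using tendsto_mult[OF lim tendsto_const[of "\<bar>c\<bar>"]] by simp
next
  case (add f g)
  show ?case
  proof (rule tendsto_sandwich[OF _ _ tendsto_const])
    show "\<forall>\<^sub>F n in sequentially. (\<integral>x. \<bar>f (x - e n) + g (x - e n) - (f x + g x)\<bar> \<partial>lborel) \<le>
      (\<integral>x. \<bar>f (x - e n) - f x\<bar> \<partial>lborel) + (\<integral>x. \<bar>g (x - e n) - g x\<bar> \<partial>lborel)"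
    proof (intro always_eventually allI)
      fix n
      note i = translation_diff_integrable(2)[OF add.hyps(1), of "e n"]
        translation_diff_integrable(2)[OF add.hyps(2), of "e n"]
      show "(\<integral>x. \<bar>f (x - e n) + g (x - e n) - (f x + g x)\<bar> \<partial>lborel) \<le>
      (\<integral>x. \<bar>f (x - e n) - f x\<bar> \<partial>lborel) + (\<integral>x. \<bar>g (x - e n) - g x\<bar> \<partial>lborel)"
        unfolding Bochner_Integration.integral_add[OF i, symmetric]
        using i translation_diff_integrable(2)[of "\<lambda>x. f x + g x" "e n"] add.hyps
        by (intro integral_mono) auto
    qed
    show "(\<lambda>n. (\<integral>x. \<bar>f (x - e n) - f x\<bar> \<partial>lborel) + (\<integral>x. \<bar>g (x - e n) - g x\<bar> \<partial>lborel)) \<longlonglongrightarrow> 0"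
      using tendsto_add[OF add.IH] by simp
  qed auto
next
  case (lim f s)
  show ?case
  proof (rule L1_translation_approx[OF lim.hyps(4)])
    fix d :: real assume "d > 0"
    \<comment> \<open>The factor 3 comes from the bound of \<open>s i x\<close> by twice
      \<open>norm (f x)\<close>, which \<open>integrable_induct\<close> supplies for the
      approximants.\<close>
    have "(\<lambda>i. \<integral>x. \<bar>f x - s i x\<bar> \<partial>lborel) \<longlonglongrightarrow> integral\<^sup>L lborel (\<lambda>_::real. 0::real)"
    proof (rule integral_dominated_convergence[where w="\<lambda>x. 3 * norm (f x)"])
      show "AE x in lborel. (\<lambda>i. \<bar>f x - s i x\<bar>) \<longlonglongrightarrow> 0"
      proof (intro AE_I2)
        fix x
        show "(\<lambda>i. \<bar>f x - s i x\<bar>) \<longlonglongrightarrow> 0"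
          using tendsto_rabs[OF tendsto_diff[OF tendsto_const[of "f x"] lim.hyps(2)[of x]]] by simp
      qed
      show "AE x in lborel. norm \<bar>f x - s i x\<bar> \<le> 3 * norm (f x)" for i
      proof (intro AE_I2)
        fix x
        show "norm \<bar>f x - s i x\<bar> \<le> 3 * norm (f x)"
          using lim.hyps(3)[of x i] by auto
      qed
    qed (use lim.hyps in auto)
    then have "\<forall>\<^sub>F i in sequentially. (\<integral>x. \<bar>f x - s i x\<bar> \<partial>lborel) < d"
      using \<open>d > 0\<close> by (intro order_tendstoD) auto
    then obtain i where "(\<integral>x. \<bar>f x - s i x\<bar> \<partial>lborel) < d"
      using eventually_happens'[OF sequentially_bot] by blast
    then show "\<exists>w'. integrable lborel w' \<and> (\<integral>x. \<bar>f x - w' x\<bar> \<partial>lborel) \<le> d \<and>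
      (\<lambda>n. \<integral>x. \<bar>w' (x - e n) - w' x\<bar> \<partial>lborel) \<longlonglongrightarrow> 0"
      using lim.hyps(1) lim.IH by (intro exI[of _ "s i"]) auto
  qed
qed

section \<open>Cauchy-Schwarz and continuity of translations in L^2\<close>

lemma Cauchy_Schwarz_integral:
  fixes p q :: "'b \<Rightarrow> real"
  assumes p: "p \<in> borel_measurable M" "integrable M (\<lambda>x. (p x)\<^sup>2)"
    and q: "q \<in> borel_measurable M" "integrable M (\<lambda>x. (q x)\<^sup>2)"
  shows "integrable M (\<lambda>x. p x * q x)"
    and "(\<integral>x. \<bar>p x * q x\<bar> \<partial>M)\<^sup>2 \<le> (\<integral>x. (p x)\<^sup>2 \<partial>M) * (\<integral>x. (q x)\<^sup>2 \<partial>M)"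
proof -
  note [measurable] = p(1) q(1)
  show i: "integrable M (\<lambda>x. p x * q x)"
  proof (rule Bochner_Integration.integrable_bound)
    show "integrable M (\<lambda>x. (p x)\<^sup>2 + (q x)\<^sup>2)" using p q by simp
    show "AE x in M. norm (p x * q x) \<le> norm ((p x)\<^sup>2 + (q x)\<^sup>2)"
    proof (intro AE_I2)
      fix x
      have "0 \<le> (\<bar>p x\<bar> - \<bar>q x\<bar>)\<^sup>2" by simp
      then have "2 * (\<bar>p x\<bar> * \<bar>q x\<bar>) \<le> (p x)\<^sup>2 + (q x)\<^sup>2" by (simp add: power2_diff)
      moreover have "0 \<le> \<bar>p x\<bar> * \<bar>q x\<bar>" by simp
      ultimately have "\<bar>p x\<bar> * \<bar>q x\<bar> \<le> (p x)\<^sup>2 + (q x)\<^sup>2" by linarith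
      then show "norm (p x * q x) \<le> norm ((p x)\<^sup>2 + (q x)\<^sup>2)" by (simp add: abs_mult)
    qed
  qed measurable
  have "(\<integral>\<^sup>+x. ennreal \<bar>p x\<bar> * ennreal \<bar>q x\<bar> \<partial>M)\<^sup>2 \<le> (\<integral>\<^sup>+x. (ennreal \<bar>p x\<bar>)\<^sup>2 \<partial>M) * (\<integral>\<^sup>+x. (ennreal \<bar>q x\<bar>)\<^sup>2 \<partial>M)"
    by (rule Cauchy_Schwarz_nn_integral) measurable
  also have "(\<integral>\<^sup>+x. (ennreal \<bar>p x\<bar>)\<^sup>2 \<partial>M) = ennreal (\<integral>x. (p x)\<^sup>2 \<partial>M)"
    using p by (simp add: ennreal_power nn_integral_eq_integral)
  also have "(\<integral>\<^sup>+x. (ennreal \<bar>q x\<bar>)\<^sup>2 \<partial>M) = ennreal (\<integral>x. (q x)\<^sup>2 \<partial>M)"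
    using q by (simp add: ennreal_power nn_integral_eq_integral)
  also have "(\<integral>\<^sup>+x. ennreal \<bar>p x\<bar> * ennreal \<bar>q x\<bar> \<partial>M) = ennreal (\<integral>x. \<bar>p x * q x\<bar> \<partial>M)"
    using i by (subst nn_integral_eq_integral[symmetric]) (auto simp: ennreal_mult[symmetric] abs_mult[symmetric])
  finally show "(\<integral>x. \<bar>p x * q x\<bar> \<partial>M)\<^sup>2 \<le> (\<integral>x. (p x)\<^sup>2 \<partial>M) * (\<integral>x. (q x)\<^sup>2 \<partial>M)"
    by (simp add: ennreal_power ennreal_mult[symmetric])
qed

text \<open>For nonnegative a and b one has (a - b)^2 \<le> |a^2 - b^2|, so continuity in L^1 of the
  translates of v^2 already gives continuity in L^2 of those of v, without a density argument in
  L^2.\<close>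

lemma L2_translation_nonneg:
  fixes v :: "real \<Rightarrow> real"
  assumes [measurable]: "v \<in> borel_measurable borel" and v: "integrable lborel (\<lambda>x. (v x)\<^sup>2)"
    and nn: "\<And>x. 0 \<le> v x" and e: "e \<longlonglongrightarrow> 0"
  shows "(\<lambda>n. \<integral>x. (v (x - e n) - v x)\<^sup>2 \<partial>lborel) \<longlonglongrightarrow> 0"
proof (rule tendsto_sandwich[OF _ _ tendsto_const L1_translation[OF v e]])
  show "\<forall>\<^sub>F n in sequentially. (\<integral>x. (v (x - e n) - v x)\<^sup>2 \<partial>lborel) \<le> (\<integral>x. \<bar>(v (x - e n))\<^sup>2 - (v x)\<^sup>2\<bar> \<partial>lborel)"
  proof (intro always_eventually allI)
    fix n
    have le: "(a - b)\<^sup>2 \<le> \<bar>a\<^sup>2 - b\<^sup>2\<bar>" if "0 \<le> a" "0 \<le> b" for a b :: real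
    proof -
      have "(a - b)\<^sup>2 = \<bar>a - b\<bar> * \<bar>a - b\<bar>" by (simp add: power2_eq_square)
      also have "\<dots> \<le> \<bar>a - b\<bar> * \<bar>a + b\<bar>" using that by (intro mult_left_mono) auto
      also have "\<dots> = \<bar>a\<^sup>2 - b\<^sup>2\<bar>" by (simp add: abs_mult[symmetric] power2_eq_square algebra_simps)
      finally show ?thesis .
    qed
    note i = translation_diff_integrable(2)[OF v, of "e n"]
    show "(\<integral>x. (v (x - e n) - v x)\<^sup>2 \<partial>lborel) \<le> (\<integral>x. \<bar>(v (x - e n))\<^sup>2 - (v x)\<^sup>2\<bar> \<partial>lborel)"
    proof (rule integral_mono[OF _ i])
      show "integrable lborel (\<lambda>x. (v (x - e n) - v x)\<^sup>2)"
        by (rule Bochner_Integration.integrable_bound[OF i]) (use le nn in auto)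
    qed (use le nn in auto)
  qed
qed auto

text \<open>The sign restriction is removed by splitting v into its positive and negative parts, at
  the price of the factor 2 in (a - b)^2 \<le> 2 a^2 + 2 b^2.\<close>

lemma L2_translation:
  fixes v :: "real \<Rightarrow> real"
  assumes [measurable]: "v \<in> borel_measurable borel" and v: "integrable lborel (\<lambda>x. (v x)\<^sup>2)"
    and e: "e \<longlonglongrightarrow> 0"
  shows "(\<lambda>n. \<integral>x. (v (x - e n) - v x)\<^sup>2 \<partial>lborel) \<longlonglongrightarrow> 0"
proof -
  define p q where "p = (\<lambda>x. max 0 (v x))" and "q = (\<lambda>x. max 0 (- v x))"
  have [measurable]: "p \<in> borel_measurable borel" "q \<in> borel_measurable borel"
    by (simp_all add: p_def q_def)
  have v_eq: "v x = p x - q x" for x by (auto simp: p_def q_def max_def)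
  have ip: "integrable lborel (\<lambda>x. (p x)\<^sup>2)" and iq: "integrable lborel (\<lambda>x. (q x)\<^sup>2)"
    by (rule Bochner_Integration.integrable_bound[OF v]; auto simp: p_def q_def max_def)+
  have lim: "(\<lambda>n. 2 * (\<integral>x. (p (x - e n) - p x)\<^sup>2 \<partial>lborel) + 2 * (\<integral>x. (q (x - e n) - q x)\<^sup>2 \<partial>lborel)) \<longlonglongrightarrow> 0"
    using L2_translation_nonneg[OF _ ip _ e] L2_translation_nonneg[OF _ iq _ e]
    by (auto intro!: tendsto_eq_intros simp: p_def q_def)
  have sq: "(a - b)\<^sup>2 \<le> 2 * a\<^sup>2 + 2 * b\<^sup>2" for a b :: real
    using sum_squares_bound[of a "-b"] by (simp add: power2_diff)
  have diff: "integrable lborel (\<lambda>x. (w (x - a) - w x)\<^sup>2)"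
    if [measurable]: "w \<in> borel_measurable borel" and "integrable lborel (\<lambda>x. (w x)\<^sup>2)" for w :: "real \<Rightarrow> real" and a
  proof (rule Bochner_Integration.integrable_bound)
    show "integrable lborel (\<lambda>x. 2 * (w (x - a))\<^sup>2 + 2 * (w x)\<^sup>2)"
      using that(2) translation_diff_integrable(1)[OF that(2)] by simp
  qed (use sq in \<open>auto simp: abs_of_nonneg\<close>)
  show ?thesis
  proof (rule tendsto_sandwich[OF _ _ tendsto_const lim])
    show "\<forall>\<^sub>F n in sequentially. (\<integral>x. (v (x - e n) - v x)\<^sup>2 \<partial>lborel) \<le>
      2 * (\<integral>x. (p (x - e n) - p x)\<^sup>2 \<partial>lborel) + 2 * (\<integral>x. (q (x - e n) - q x)\<^sup>2 \<partial>lborel)"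
    proof (intro always_eventually allI)
      fix n
      have "(\<integral>x. (v (x - e n) - v x)\<^sup>2 \<partial>lborel) \<le>
        (\<integral>x. 2 * (p (x - e n) - p x)\<^sup>2 + 2 * (q (x - e n) - q x)\<^sup>2 \<partial>lborel)"
      proof (rule integral_mono)
        fix x
        show "(v (x - e n) - v x)\<^sup>2 \<le> 2 * (p (x - e n) - p x)\<^sup>2 + 2 * (q (x - e n) - q x)\<^sup>2"
          using sq[of "p (x - e n) - p x" "q (x - e n) - q x"] by (simp add: v_eq algebra_simps)
      qed (use diff v ip iq in auto)
      then show "(\<integral>x. (v (x - e n) - v x)\<^sup>2 \<partial>lborel) \<le>
      2 * (\<integral>x. (p (x - e n) - p x)\<^sup>2 \<partial>lborel) + 2 * (\<integral>x. (q (x - e n) - q x)\<^sup>2 \<partial>lborel)"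
        using diff ip iq by simp
    qed
  qed auto
qed

section \<open>Associativity of convolution\<close>

lemma nn_integral_shift:
  fixes f :: "real \<Rightarrow> ennreal"
  assumes "f \<in> borel_measurable borel"
  shows "(\<integral>\<^sup>+x. f (x - a) \<partial>lborel) = (\<integral>\<^sup>+x. f x \<partial>lborel)"
  using nn_integral_real_affine[OF assms, of 1 "-a"] by (simp add: algebra_simps)

text \<open>Because a and b are nonnegative, Tonelli evaluates the absolute double integral exactly
  as that of |K (t - r) w r|. Absolute convergence of the single convolution with K = a * b is
  therefore all that Fubini asks for. The second claim is restricted to a (t - s) \<noteq> 0, since
  elsewhere the double integrand carries no information on the inner one.\<close>

lemma conv_conv_eq:
  fixes a b w K :: "real \<Rightarrow> real"
  assumes [measurable]: "a \<in> borel_measurable borel" "b \<in> borel_measurable borel" "w \<in> borel_measurable borel"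
    and nn: "\<And>s. 0 \<le> a s" "\<And>s. 0 \<le> b s" "\<And>x. 0 \<le> K x"
    and K: "\<And>x. (\<integral>\<^sup>+s. ennreal (a (x - s) * b s) \<partial>lborel) = ennreal (K x)"
    and i: "integrable lborel (\<lambda>r. K (t - r) * w r)"
  shows "(\<integral>s. a (t - s) * (\<integral>r. b (s - r) * w r \<partial>lborel) \<partial>lborel) = (\<integral>r. K (t - r) * w r \<partial>lborel)"
    and "AE s in lborel. a (t - s) \<noteq> 0 \<longrightarrow> integrable lborel (\<lambda>r. b (s - r) * w r)"
    and "integrable lborel (\<lambda>s. a (t - s) * (\<integral>r. b (s - r) * w r \<partial>lborel))"
proof -
  have K': "(\<integral>\<^sup>+s. ennreal (a (t - s) * b (s - r)) \<partial>lborel) = ennreal (K (t - r))" for r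
    using nn_integral_shift[of "\<lambda>s. ennreal (a (t - r - s) * b s)" r] K[of "t - r"] by simp
  have "(\<integral>\<^sup>+r. \<integral>\<^sup>+s. ennreal (norm (a (t - s) * (b (s - r) * w r))) \<partial>lborel \<partial>lborel)
    = (\<integral>\<^sup>+r. ennreal \<bar>K (t - r) * w r\<bar> \<partial>lborel)"
  proof (intro nn_integral_cong)
    fix r
    have "(\<integral>\<^sup>+s. ennreal (norm (a (t - s) * (b (s - r) * w r))) \<partial>lborel)
      = (\<integral>\<^sup>+s. ennreal (a (t - s) * b (s - r)) * ennreal \<bar>w r\<bar> \<partial>lborel)"
      using nn by (intro nn_integral_cong) (simp add: ennreal_mult[symmetric] abs_mult mult.assoc)
    also have "\<dots> = ennreal \<bar>K (t - r) * w r\<bar>"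
      using nn by (subst nn_integral_multc) (auto simp: K' ennreal_mult[symmetric] abs_mult)
    finally show "(\<integral>\<^sup>+s. ennreal (norm (a (t - s) * (b (s - r) * w r))) \<partial>lborel) = ennreal \<bar>K (t - r) * w r\<bar>" .
  qed
  also have "\<dots> < \<infinity>"
    using i by (simp add: integrable_iff_bounded)
  finally have fin: "(\<integral>\<^sup>+r. \<integral>\<^sup>+s. ennreal (norm (a (t - s) * (b (s - r) * w r))) \<partial>lborel \<partial>lborel) < \<infinity>" .
  have int: "integrable (lborel \<Otimes>\<^sub>M lborel) (\<lambda>(r, s). a (t - s) * (b (s - r) * w r))"
    using fin by (subst integrable_iff_bounded, subst lborel.nn_integral_fst[symmetric]) (auto simp: split_beta')
  have "(\<integral>s. a (t - s) * (\<integral>r. b (s - r) * w r \<partial>lborel) \<partial>lborel)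
    = (\<integral>s. \<integral>r. a (t - s) * (b (s - r) * w r) \<partial>lborel \<partial>lborel)"
    by simp
  also have "\<dots> = (\<integral>r. \<integral>s. a (t - s) * (b (s - r) * w r) \<partial>lborel \<partial>lborel)"
    using lborel_pair.Fubini_integral[OF int] by simp
  also have "\<dots> = (\<integral>r. K (t - r) * w r \<partial>lborel)"
  proof (intro Bochner_Integration.integral_cong refl)
    fix r
    have "(\<integral>s. a (t - s) * b (s - r) \<partial>lborel) = K (t - r)"
      by (subst integral_eq_nn_integral) (auto simp: nn K')
    then show "(\<integral>s. a (t - s) * (b (s - r) * w r) \<partial>lborel) = K (t - r) * w r"
      by (simp add: mult.assoc[symmetric])
  qed
  finally show "(\<integral>s. a (t - s) * (\<integral>r. b (s - r) * w r \<partial>lborel) \<partial>lborel) = (\<integral>r. K (t - r) * w r \<partial>lborel)" .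
  show "AE s in lborel. a (t - s) \<noteq> 0 \<longrightarrow> integrable lborel (\<lambda>r. b (s - r) * w r)"
    using lborel_pair.AE_integrable_snd[OF int] by eventually_elim auto
  show "integrable lborel (\<lambda>s. a (t - s) * (\<integral>r. b (s - r) * w r \<partial>lborel))"
    using lborel_pair.integrable_snd[OF int] by simp
qed

section \<open>Riemann--Liouville kernels\<close>

text \<open>Kernel of the fractional integral J^a; a = 1 - \<alpha> and a = \<alpha> give the
  kernels k and l. Extension by 0 makes it causal: a convolution over the whole line sees only s <
  t, and a = 1 is the Heaviside function.\<close>

definition rl_kernel :: "real \<Rightarrow> real \<Rightarrow> real" where
  "rl_kernel a s = (if 0 < s then s powr (a - 1) / Gamma a else 0)"

lemma Gamma_real_nonzero: "0 < x \<Longrightarrow> Gamma x \<noteq> (0::real)"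
  by (metis Gamma_real_pos less_irrefl)

lemma rl_kernel_measurable [measurable]: "rl_kernel a \<in> borel_measurable borel"
  unfolding rl_kernel_def by measurable

lemma rl_kernel_nonneg: "0 < a \<Longrightarrow> 0 \<le> rl_kernel a s"
  by (simp add: rl_kernel_def Gamma_real_pos less_imp_le)

lemma rl_kernel_1: "rl_kernel 1 = indicator {0<..}"
  by (auto simp: rl_kernel_def indicator_def)

text \<open>The substitution s = x y turns the convolution into the Beta integral, and Beta(b, a) =
  Gamma(b) Gamma(a) / Gamma(a + b) cancels the normalisations. The nonnegative integral is the form
  in which \<open>conv_conv_eq\<close> takes its kernel.\<close>

lemma rl_kernel_semigroup:
  assumes a: "0 < a" and b: "0 < b"
  shows "(\<integral>\<^sup>+s. ennreal (rl_kernel a (x - s) * rl_kernel b s) \<partial>lborel) = ennreal (rl_kernel (a + b) x)"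
proof (cases "0 < x")
  case False
  then have z: "rl_kernel a (x - s) * rl_kernel b s = 0" for s
    by (auto simp: rl_kernel_def)
  from False show ?thesis unfolding z by (simp add: rl_kernel_def)
next
  case True
  define C where "C = x powr (a + b - 2) / (Gamma a * Gamma b)"
  have C: "0 \<le> C" using a b by (simp add: C_def Gamma_real_pos less_imp_le)
  have "(\<integral>\<^sup>+s. ennreal (rl_kernel a (x - s) * rl_kernel b s) \<partial>lborel)
    = ennreal x * (\<integral>\<^sup>+y. ennreal (rl_kernel a (x - x * y) * rl_kernel b (x * y)) \<partial>lborel)"
    using True by (subst nn_integral_real_affine[where c=x and t=0]) auto
  also have "(\<integral>\<^sup>+y. ennreal (rl_kernel a (x - x * y) * rl_kernel b (x * y)) \<partial>lborel)
    = (\<integral>\<^sup>+y. ennreal C * (ennreal (y powr (b - 1) * (1 - y) powr (a - 1)) * indicator {0..1} y) \<partial>lborel)"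
  proof (intro nn_integral_cong)
    fix y :: real
    show "ennreal (rl_kernel a (x - x * y) * rl_kernel b (x * y))
      = ennreal C * (ennreal (y powr (b - 1) * (1 - y) powr (a - 1)) * indicator {0..1} y)"
    proof (cases "0 < y \<and> y < 1")
      case y: True
      have "x - x * y = x * (1 - y)" by (simp add: algebra_simps)
      moreover have "x powr (a + b - 2) = x powr (a - 1) * x powr (b - 1)"
        by (subst powr_add[symmetric]) (simp add: algebra_simps)
      ultimately show ?thesis
        using y True C by (simp add: rl_kernel_def C_def ennreal_mult[symmetric] powr_mult mult_ac)
    next
      case False
      then have "rl_kernel a (x - x * y) * rl_kernel b (x * y) = 0"
        using True by (auto simp: rl_kernel_def zero_less_mult_iff)
      \<comment> \<open>At the endpoints the convention that 0 powr anything is 0 applies, so both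
        sides vanish there even for negative exponents.\<close>
      moreover from False have "y powr (b - 1) * (1 - y) powr (a - 1) = 0 \<or> y \<notin> {0..1}"
        by force
      ultimately show ?thesis by auto
    qed
  qed
  also have "\<dots> = ennreal C * ennreal (Beta b a)"
    using nn_integral_has_integral_lebesgue'[OF _ has_integral_Beta_real[OF b a]]
    by (subst nn_integral_cmult) auto
  also have "ennreal x * (ennreal C * ennreal (Beta b a)) = ennreal (x * (C * Beta b a))"
    using True C a b by (simp add: ennreal_mult[symmetric] Beta_def Gamma_real_pos less_imp_le)
  also have "x * (C * Beta b a) = rl_kernel (a + b) x"
  proof -
    have "x powr (a + b - 1) = x * x powr (a + b - 2)"
      using True by (simp add: powr_mult_base)
    then show ?thesis
      using True a b
      by (simp add: rl_kernel_def C_def Beta_def Gamma_real_nonzero add.commute field_simps)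
  qed
  finally show ?thesis .
qed

definition shifted_kernel_deriv :: "real \<Rightarrow> real \<Rightarrow> real \<Rightarrow> real" where
  "shifted_kernel_deriv \<alpha> \<epsilon> s =
     (if 0 < s then \<alpha> * (s + \<epsilon>) powr (-\<alpha> - 1) / Gamma (1 - \<alpha>) else 0)"

lemma shifted_kernel_deriv_measurable [measurable]:
  "shifted_kernel_deriv \<alpha> \<epsilon> \<in> borel_measurable borel"
  unfolding shifted_kernel_deriv_def by measurable

lemma shifted_kernel_deriv_nonneg:
  "0 < \<alpha> \<Longrightarrow> \<alpha> < 1 \<Longrightarrow> 0 \<le> shifted_kernel_deriv \<alpha> \<epsilon> s"
  by (simp add: shifted_kernel_deriv_def Gamma_real_pos less_imp_le)

text \<open>Profile h of the approximate identity h(x / \<epsilon>) / \<epsilon> that turns v into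
  the derivative of k_\<epsilon> * u. The Gamma factors normalise its total mass to one.\<close>

definition resolvent_kernel :: "real \<Rightarrow> real \<Rightarrow> real" where
  "resolvent_kernel \<alpha> r =
     (if 0 < r then r powr (\<alpha> - 1) / ((1 + r) * (Gamma \<alpha> * Gamma (1 - \<alpha>))) else 0)"

lemma resolvent_kernel_measurable [measurable]: "resolvent_kernel \<alpha> \<in> borel_measurable borel"
  unfolding resolvent_kernel_def by measurable

lemma resolvent_kernel_nonneg:
  "0 < \<alpha> \<Longrightarrow> \<alpha> < 1 \<Longrightarrow> 0 \<le> resolvent_kernel \<alpha> r"
  by (simp add: resolvent_kernel_def Gamma_real_pos less_imp_le)

text \<open>The integrand has the explicit antiderivative c / (x + \<epsilon>) times (s / (x - s +
  \<epsilon>))^\<alpha>. The two terms of the product rule share a factor and add up to it times s +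
  (x - s + \<epsilon>) = x + \<epsilon>, which cancels the prefactor.\<close>

lemma nn_integral_shifted_deriv_conv_rl_kernel:
  assumes \<alpha>: "0 < \<alpha>" "\<alpha> < 1" and \<epsilon>: "0 < \<epsilon>"
  shows "(\<integral>\<^sup>+s. ennreal (shifted_kernel_deriv \<alpha> \<epsilon> (x - s) * rl_kernel \<alpha> s) \<partial>lborel)
    = ennreal (if 0 < x then (x / \<epsilon>) powr \<alpha> / ((x + \<epsilon>) * (Gamma \<alpha> * Gamma (1 - \<alpha>))) else 0)"
proof (cases "0 < x")
  case False
  then have z: "shifted_kernel_deriv \<alpha> \<epsilon> (x - s) * rl_kernel \<alpha> s = 0" for s
    by (auto simp: rl_kernel_def shifted_kernel_deriv_def)
  from False show ?thesis unfolding z by simp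
next
  case True
  define c where "c = 1 / (Gamma \<alpha> * Gamma (1 - \<alpha>))"
  have c: "0 \<le> c" using \<alpha> by (simp add: c_def Gamma_real_pos less_imp_le)
  define F where "F s = c / (x + \<epsilon>) * (s powr \<alpha> * (x - s + \<epsilon>) powr (-\<alpha>))" for s
  define f where "f s = c * \<alpha> * (s powr (\<alpha> - 1) * (x - s + \<epsilon>) powr (-\<alpha> - 1))" for s
  have "(f has_integral (F x - F 0)) {0..x}"
  proof (rule fundamental_theorem_of_calculus_interior)
    show "continuous_on {0..x} F"
      unfolding F_def using \<epsilon> \<alpha> by (intro continuous_intros continuous_on_powr') auto
    fix s assume s: "s \<in> {0<..<x}"
    have 1: "s powr \<alpha> = s * s powr (\<alpha> - 1)"
      using s by (simp add: powr_mult_base)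
    have 2: "(x - s + \<epsilon>) powr (-\<alpha>) = (x - s + \<epsilon>) * (x - s + \<epsilon>) powr (-\<alpha> - 1)"
      using s \<epsilon> by (simp add: powr_mult_base)
    have "(F has_real_derivative c / (x + \<epsilon>) * (\<alpha> * s powr (\<alpha> - 1) * (x - s + \<epsilon>) powr (-\<alpha>)
        + s powr \<alpha> * (\<alpha> * (x - s + \<epsilon>) powr (-\<alpha> - 1)))) (at s)"
      unfolding F_def using s \<epsilon> by (auto intro!: derivative_eq_intros)
    also have "c / (x + \<epsilon>) * (\<alpha> * s powr (\<alpha> - 1) * (x - s + \<epsilon>) powr (-\<alpha>)
        + s powr \<alpha> * (\<alpha> * (x - s + \<epsilon>) powr (-\<alpha> - 1))) =
        c / (x + \<epsilon>) * (\<alpha> * (s powr (\<alpha> - 1) * (x - s + \<epsilon>) powr (-\<alpha> - 1)) * (x + \<epsilon>))"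
      unfolding 1 2 by (simp add: algebra_simps)
    also have "\<dots> = f s" using True \<epsilon> by (simp add: f_def)
    finally show "(F has_vector_derivative f s) (at s)"
      by (simp add: has_real_derivative_iff_has_vector_derivative)
  qed (use True in auto)
  from nn_integral_has_integral_lebesgue'[OF _ this]
  have "(\<integral>\<^sup>+s. ennreal (f s) * indicator {0..x} s \<partial>lborel) = ennreal (F x - F 0)"
    using c \<alpha> by (auto simp: f_def)
  moreover have "(\<integral>\<^sup>+s. ennreal (f s) * indicator {0..x} s \<partial>lborel)
    = (\<integral>\<^sup>+s. ennreal (shifted_kernel_deriv \<alpha> \<epsilon> (x - s) * rl_kernel \<alpha> s) \<partial>lborel)"
  proof (intro nn_integral_cong_AE)
    show "AE s in lborel. ennreal (f s) * indicator {0..x} s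
        = ennreal (shifted_kernel_deriv \<alpha> \<epsilon> (x - s) * rl_kernel \<alpha> s)"
      using AE_lborel_singleton[of x]
    proof eventually_elim
      case (elim s)
      then show ?case
        by (cases "0 < s \<and> s < x")
          (auto simp: f_def shifted_kernel_deriv_def rl_kernel_def c_def indicator_def mult_ac)
    qed
  qed
  moreover have "F x - F 0 = (x / \<epsilon>) powr \<alpha> / ((x + \<epsilon>) * (Gamma \<alpha> * Gamma (1 - \<alpha>)))"
    using True \<epsilon> by (simp add: F_def c_def powr_minus powr_divide field_simps)
  ultimately show ?thesis using True by simp
qed

text \<open>In the time-integrated identity -k_\<epsilon>' is convolved with the Heaviside function.
  The fundamental theorem gives k(\<epsilon>) - k(x + \<epsilon>), whose second term brings back the
  shifted kernel itself.\<close>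

lemma nn_integral_shifted_kernel_deriv_initial:
  assumes \<alpha>: "0 < \<alpha>" "\<alpha> < 1" and \<epsilon>: "0 < \<epsilon>"
  shows "(\<integral>\<^sup>+s. ennreal (indicator {..<x} s * shifted_kernel_deriv \<alpha> \<epsilon> s) \<partial>lborel)
    = ennreal (if 0 < x then rl_kernel (1 - \<alpha>) \<epsilon> - rl_kernel (1 - \<alpha>) (x + \<epsilon>) else 0)"
proof (cases "0 < x")
  case False
  then have z: "indicator {..<x} s * shifted_kernel_deriv \<alpha> \<epsilon> s = 0" for s
    by (auto simp: shifted_kernel_deriv_def indicator_def)
  from False show ?thesis unfolding z by simp
next
  case True
  define f where "f s = \<alpha> * (s + \<epsilon>) powr (-\<alpha> - 1) / Gamma (1 - \<alpha>)" for s
  define F where "F s = - ((s + \<epsilon>) powr (-\<alpha>) / Gamma (1 - \<alpha>))" for s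
  have "(f has_integral (F x - F 0)) {0..x}"
  proof (rule fundamental_theorem_of_calculus_interior)
    show "continuous_on {0..x} F"
      unfolding F_def using \<epsilon> \<alpha> by (intro continuous_intros) (auto simp: Gamma_real_nonzero)
    fix s assume s: "s \<in> {0<..<x}"
    show "(F has_vector_derivative f s) (at s)"
      unfolding F_def f_def has_real_derivative_iff_has_vector_derivative[symmetric]
      using s \<epsilon> \<alpha> by (auto intro!: derivative_eq_intros simp: Gamma_real_nonzero)
  qed (use True in auto)
  from nn_integral_has_integral_lebesgue'[OF _ this]
  have "(\<integral>\<^sup>+s. ennreal (f s) * indicator {0..x} s \<partial>lborel) = ennreal (F x - F 0)"
    using \<alpha> by (auto simp: f_def Gamma_real_pos less_imp_le)
  moreover have "(\<integral>\<^sup>+s. ennreal (f s) * indicator {0..x} s \<partial>lborel)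
    = (\<integral>\<^sup>+s. ennreal (indicator {..<x} s * shifted_kernel_deriv \<alpha> \<epsilon> s) \<partial>lborel)"
  proof (intro nn_integral_cong_AE)
    show "AE s in lborel. ennreal (f s) * indicator {0..x} s
        = ennreal (indicator {..<x} s * shifted_kernel_deriv \<alpha> \<epsilon> s)"
      using AE_lborel_singleton[of x] AE_lborel_singleton[of 0]
      by eventually_elim (auto simp: f_def shifted_kernel_deriv_def indicator_def)
  qed
  moreover have "F x - F 0 = rl_kernel (1 - \<alpha>) \<epsilon> - rl_kernel (1 - \<alpha>) (x + \<epsilon>)"
    using True \<epsilon> by (simp add: F_def rl_kernel_def)
  ultimately show ?thesis using True by simp
qed

lemma rl_kernel_antimono:
  assumes "0 < \<alpha>" "\<alpha> < 1" "0 < x" "x \<le> y"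
  shows "rl_kernel (1 - \<alpha>) y \<le> rl_kernel (1 - \<alpha>) x"
  using assms by (auto simp: rl_kernel_def Gamma_real_pos intro!: divide_right_mono powr_mono2')

text \<open>When the square in the energy is expanded, this mass is the coefficient of u(\<tau>)^2.
  It is taken over the whole half-line because the zero values of u at negative times take part in
  the energy.\<close>

lemma nn_integral_shifted_kernel_deriv:
  assumes \<alpha>: "0 < \<alpha>" "\<alpha> < 1" and \<epsilon>: "0 < \<epsilon>"
  shows "(\<integral>\<^sup>+s. ennreal (shifted_kernel_deriv \<alpha> \<epsilon> s) \<partial>lborel) = ennreal (rl_kernel (1 - \<alpha>) \<epsilon>)"
proof -
  define F where "F s = - ((s + \<epsilon>) powr (-\<alpha>) / Gamma (1 - \<alpha>))" for s
  define f where "f s = \<alpha> * (s + \<epsilon>) powr (-\<alpha> - 1) / Gamma (1 - \<alpha>)" for s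
  have lim: "(F \<longlongrightarrow> 0) at_top"
  proof -
    have "filterlim (\<lambda>s. s + \<epsilon>) at_top at_top"
      by (rule filterlim_at_top_mono[OF filterlim_ident]) (use \<epsilon> in auto)
    then have "((\<lambda>s. (s + \<epsilon>) powr (-\<alpha>)) \<longlongrightarrow> 0) at_top"
      using \<alpha> by (intro tendsto_neg_powr) auto
    from tendsto_minus[OF tendsto_mult[OF this tendsto_const[of "1 / Gamma (1 - \<alpha>)"]]]
    show ?thesis unfolding F_def by simp
  qed
  have "(\<integral>\<^sup>+s. ennreal (f s) * indicator {0..} s \<partial>lborel) = ennreal (0 - F 0)"
  proof (rule nn_integral_FTC_atLeast[OF _ _ _ lim])
    show "f \<in> borel_measurable borel" unfolding f_def by measurable
    show "DERIV F s :> f s" if "0 \<le> s" for s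
      unfolding F_def f_def using that \<epsilon> \<alpha> by (auto intro!: derivative_eq_intros simp: Gamma_real_nonzero)
    show "0 \<le> f s" for s
      using \<alpha> by (auto simp: f_def Gamma_real_pos less_imp_le)
  qed
  moreover have "(\<integral>\<^sup>+s. ennreal (f s) * indicator {0..} s \<partial>lborel) = (\<integral>\<^sup>+s. ennreal (shifted_kernel_deriv \<alpha> \<epsilon> s) \<partial>lborel)"
  proof (intro nn_integral_cong_AE)
    show "AE s in lborel. ennreal (f s) * indicator {0..} s = ennreal (shifted_kernel_deriv \<alpha> \<epsilon> s)"
      using AE_lborel_singleton[of 0]
      by eventually_elim (auto simp: f_def shifted_kernel_deriv_def indicator_def)
  qed
  ultimately show ?thesis using \<epsilon> by (simp add: F_def rl_kernel_def)
qed

text \<open>Scaling of the Gamma integral. With a = 1 and y = 1 + r it represents 1 / (1 + r) as an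
  integral of exponentials.\<close>

lemma nn_integral_powr_exp:
  assumes "0 < a" "0 < y"
  shows "(\<integral>\<^sup>+t. ennreal (indicator {0..} t * t powr (a - 1) * exp (- (y * t))) \<partial>lborel) = ennreal (Gamma a * y powr (-a))"
proof -
  have "ennreal (Gamma a) = ennreal y * (\<integral>\<^sup>+t. ennreal (indicator {0..} (y * t) * (y * t) powr (a - 1) / exp (y * t)) \<partial>lborel)"
    using assms(2) by (simp only: Gamma_conv_nn_integral_real[OF assms(1)], subst nn_integral_real_affine[where c=y and t=0]) auto
  also have "(\<integral>\<^sup>+t. ennreal (indicator {0..} (y * t) * (y * t) powr (a - 1) / exp (y * t)) \<partial>lborel)
    = (\<integral>\<^sup>+t. ennreal (y powr (a - 1)) * ennreal (indicator {0..} t * t powr (a - 1) * exp (- (y * t))) \<partial>lborel)"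
    using assms by (intro nn_integral_cong)
      (auto simp: ennreal_mult[symmetric] indicator_def powr_mult exp_minus zero_le_mult_iff field_simps)
  also have "\<dots> = ennreal (y powr (a - 1)) * (\<integral>\<^sup>+t. ennreal (indicator {0..} t * t powr (a - 1) * exp (- (y * t))) \<partial>lborel)"
    by (rule nn_integral_cmult) measurable
  finally have "ennreal (y powr (-a)) * ennreal (Gamma a) = (ennreal (y powr (-a)) * ennreal y * ennreal (y powr (a - 1))) *
    (\<integral>\<^sup>+t. ennreal (indicator {0..} t * t powr (a - 1) * exp (- (y * t))) \<partial>lborel)"
    by (simp add: mult.assoc)
  moreover have "ennreal (y powr (-a)) * ennreal y * ennreal (y powr (a - 1)) = 1"
  proof -
    have "y powr (-a) * y * y powr (a - 1) = y powr (-a) * y powr a"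
      using assms by (simp add: powr_mult_base)
    also have "\<dots> = 1" using assms by (simp add: powr_add[symmetric])
    finally show ?thesis using assms by (simp add: ennreal_mult[symmetric])
  qed
  ultimately show ?thesis
    using assms by (simp add: ennreal_mult[symmetric] Gamma_real_pos less_imp_le mult.commute)
qed

text \<open>Once 1 / (1 + r) is an integral of exp (-(1 + r) y) over y, Tonelli separates the
  variables: the integral in r gives Gamma(\<alpha>) y^(-\<alpha>), and the one in y gives Gamma(1 -
  \<alpha>). The factor \<open>y powr (1 - 1)\<close> only puts the exponential in the shape of the
  Gamma integral with a = 1.\<close>

lemma nn_integral_resolvent_kernel:
  assumes \<alpha>: "0 < \<alpha>" "\<alpha> < 1"
  shows "(\<integral>\<^sup>+r. ennreal (resolvent_kernel \<alpha> r) \<partial>lborel) = 1"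
proof -
  define c where "c = 1 / (Gamma \<alpha> * Gamma (1 - \<alpha>))"
  have c: "0 \<le> c" using \<alpha> by (simp add: c_def Gamma_real_pos less_imp_le)
  have "(\<integral>\<^sup>+r. ennreal (resolvent_kernel \<alpha> r) \<partial>lborel) =
    (\<integral>\<^sup>+r. \<integral>\<^sup>+y. ennreal (c * indicator {0..} r * r powr (\<alpha> - 1)) *
       ennreal (indicator {0..} y * y powr (1 - 1) * exp (- ((1 + r) * y))) \<partial>lborel \<partial>lborel)"
  proof (intro nn_integral_cong)
    fix r :: real
    show "ennreal (resolvent_kernel \<alpha> r) =
      (\<integral>\<^sup>+y. ennreal (c * indicator {0..} r * r powr (\<alpha> - 1)) *
       ennreal (indicator {0..} y * y powr (1 - 1) * exp (- ((1 + r) * y))) \<partial>lborel)"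
    proof (cases "0 < r")
      case True
      then show ?thesis
        using c by (subst nn_integral_cmult, measurable, subst nn_integral_powr_exp)
          (auto simp: resolvent_kernel_def c_def ennreal_mult[symmetric] powr_minus field_simps)
    next
      case False
      then have "c * indicator {0..} r * r powr (\<alpha> - 1) = 0" by (auto simp: indicator_def)
      with False show ?thesis by (simp only:) (simp add: resolvent_kernel_def)
    qed
  qed
  also have "\<dots> = (\<integral>\<^sup>+y. \<integral>\<^sup>+r. ennreal (c * indicator {0..} r * r powr (\<alpha> - 1)) *
       ennreal (indicator {0..} y * y powr (1 - 1) * exp (- ((1 + r) * y))) \<partial>lborel \<partial>lborel)"
    by (rule lborel_pair.Fubini') measurable
  also have "\<dots> = (\<integral>\<^sup>+y. ennreal (c * Gamma \<alpha>) * ennreal (indicator {0..} y * y powr ((1 - \<alpha>) - 1) * exp (- (1 * y))) \<partial>lborel)"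
  proof (intro nn_integral_cong)
    fix y :: real
    show "(\<integral>\<^sup>+r. ennreal (c * indicator {0..} r * r powr (\<alpha> - 1)) *
       ennreal (indicator {0..} y * y powr (1 - 1) * exp (- ((1 + r) * y))) \<partial>lborel)
       = ennreal (c * Gamma \<alpha>) * ennreal (indicator {0..} y * y powr ((1 - \<alpha>) - 1) * exp (- (1 * y)))"
    proof (cases "0 < y")
      case True
      have "(\<integral>\<^sup>+r. ennreal (c * indicator {0..} r * r powr (\<alpha> - 1)) *
        ennreal (indicator {0..} y * y powr (1 - 1) * exp (- ((1 + r) * y))) \<partial>lborel)
        = (\<integral>\<^sup>+r. ennreal (c * exp (-y)) * ennreal (indicator {0..} r * r powr (\<alpha> - 1) * exp (- (y * r))) \<partial>lborel)"
        using True c by (intro nn_integral_cong)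
          (auto simp: ennreal_mult[symmetric] indicator_def exp_add[symmetric] algebra_simps)
      also have "\<dots> = ennreal (c * exp (-y)) * ennreal (Gamma \<alpha> * y powr (-\<alpha>))"
        using True \<alpha> by (subst nn_integral_cmult, measurable, subst nn_integral_powr_exp) auto
      finally show ?thesis
        using True c \<alpha> by (simp add: ennreal_mult[symmetric] Gamma_real_pos less_imp_le mult_ac)
    next
      case False
      then show ?thesis by (auto simp: indicator_def)
    qed
  qed
  also have "\<dots> = ennreal (c * Gamma \<alpha>) * ennreal (Gamma (1 - \<alpha>))"
    using \<alpha> by (subst nn_integral_cmult, measurable, subst nn_integral_powr_exp) auto
  also have "\<dots> = 1"
    using c \<alpha> by (simp add: ennreal_mult[symmetric] c_def Gamma_real_nonzero)
  finally show ?thesis .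
qed

text \<open>The left side is k(\<epsilon>) l - (-k_\<epsilon>') * l by the preceding computation of
  the convolution. Factoring out \<epsilon>^(-\<alpha>) x^(\<alpha>-1) leaves 1 - x / (x +
  \<epsilon>) = \<epsilon> / (x + \<epsilon>). This gain makes the difference integrable on the
  half-line although neither term is.\<close>

lemma resolvent_kernel_scaled:
  assumes \<alpha>: "0 < \<alpha>" "\<alpha> < 1" and \<epsilon>: "0 < \<epsilon>"
  shows "rl_kernel (1 - \<alpha>) \<epsilon> * rl_kernel \<alpha> x
      - (if 0 < x then (x / \<epsilon>) powr \<alpha> / ((x + \<epsilon>) * (Gamma \<alpha> * Gamma (1 - \<alpha>))) else 0)
    = resolvent_kernel \<alpha> (x / \<epsilon>) / \<epsilon>"
proof (cases "0 < x")
  case True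
  have 1: "x powr \<alpha> = x * x powr (\<alpha> - 1)" using True by (simp add: powr_mult_base)
  have 2: "\<epsilon> powr (\<alpha> - 1) = \<epsilon> powr \<alpha> / \<epsilon>" using \<epsilon> by (simp add: powr_diff)
  have "\<epsilon> powr \<alpha> > 0" "Gamma \<alpha> > 0" "Gamma (1 - \<alpha>) > 0" "x powr (\<alpha> - 1) > 0"
    using \<epsilon> \<alpha> True by (auto simp: Gamma_real_pos)
  then show ?thesis
    using True \<epsilon> by (simp add: rl_kernel_def resolvent_kernel_def powr_divide 1 2 powr_minus divide_simps)
      (simp add: algebra_simps)
qed (use \<epsilon> in \<open>auto simp: rl_kernel_def resolvent_kernel_def zero_less_divide_iff\<close>)

section \<open>The energy identity for scalar functions\<close>

text \<open>Values in \<open>ennreal\<close> allow the singular case \<epsilon> = 0 to be handled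
  before finiteness is known. The integral runs over all s, so for u vanishing at negative times and
  \<tau> > 0 it contains k(\<tau> + \<epsilon>) u(\<tau>)^2 from s < 0.\<close>

definition energy :: "real \<Rightarrow> real \<Rightarrow> (real \<Rightarrow> real) \<Rightarrow> real \<Rightarrow> ennreal" where
  "energy \<alpha> \<epsilon> u \<tau> = (\<integral>\<^sup>+s. ennreal (shifted_kernel_deriv \<alpha> \<epsilon> (\<tau> - s) * (u \<tau> - u s)\<^sup>2) \<partial>lborel)"

lemma energy_measurable [measurable (raw)]:
  assumes [measurable]: "u \<in> borel_measurable borel"
  shows "energy \<alpha> \<epsilon> u \<in> borel_measurable borel"
  unfolding energy_def by measurable

text \<open>What Tonelli gives at almost every point of \<Omega>, before u and v are known to be
  related; the constant of integration is studied at this level. Both functions are extended by 0,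
  so that convolutions run over the whole line.\<close>

locale L2_pair =
  fixes \<alpha> T :: real and u v :: "real \<Rightarrow> real"
  assumes \<alpha>: "0 < \<alpha>" "\<alpha> < 1" and T: "0 < T"
    and u_meas [measurable]: "u \<in> borel_measurable borel"
    and v_meas [measurable]: "v \<in> borel_measurable borel"
    and u_sq: "integrable lborel (\<lambda>t. (u t)\<^sup>2)"
    and v_sq: "integrable lborel (\<lambda>t. (v t)\<^sup>2)"
    and u_supp: "\<And>t. t \<notin> {0<..<T} \<Longrightarrow> u t = 0"
    and v_supp: "\<And>t. t \<notin> {0<..<T} \<Longrightarrow> v t = 0"
begin

lemma integrable_of_square:
  assumes [measurable]: "w \<in> borel_measurable borel" and "integrable lborel (\<lambda>t. (w t)\<^sup>2)"
    and supp: "\<And>t. t \<notin> {0<..<T} \<Longrightarrow> w t = (0::real)"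
  shows "integrable lborel w"
proof -
  have sq: "(indicator {0<..<T} t)\<^sup>2 = (indicator {0<..<T} t :: real)" for t
    by (simp add: indicator_def)
  have "integrable lborel (\<lambda>t. (indicator {0<..<T} t)\<^sup>2 :: real)"
    unfolding sq using T by (intro integrable_real_indicator) auto
  then have "integrable lborel (\<lambda>t. indicator {0<..<T} t * w t)"
    using assms by (intro Cauchy_Schwarz_integral) auto
  moreover have "indicator {0<..<T} t * w t = w t" for t
    using supp[of t] by (auto simp: indicator_def)
  ultimately show ?thesis by simp
qed

lemma u_int: "integrable lborel u" and v_int: "integrable lborel v"
  by (rule integrable_of_square[OF u_meas u_sq u_supp] integrable_of_square[OF v_meas v_sq v_supp], assumption)+

lemma bounded_kernel_integrable:
  assumes [measurable]: "K \<in> borel_measurable borel" and w: "integrable lborel w"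
    and supp: "\<And>t. t \<notin> {0<..<T} \<Longrightarrow> w t = (0::real)"
    and K: "\<And>x. x \<le> T \<Longrightarrow> \<bar>K x\<bar> \<le> (B::real)" and t: "t \<le> T"
  shows "integrable lborel (\<lambda>r. K (t - r) * w r)"
proof (rule Bochner_Integration.integrable_bound[where f="\<lambda>r. B * w r"])
  show "AE r in lborel. norm (K (t - r) * w r) \<le> norm (B * w r)"
  proof (intro AE_I2)
    fix r
    show "norm (K (t - r) * w r) \<le> norm (B * w r)"
    proof (cases "r \<in> {0<..<T}")
      case True
      then have "\<bar>K (t - r)\<bar> \<le> \<bar>B\<bar>" using K[of "t - r"] t by auto
      then show ?thesis by (simp add: abs_mult mult_right_mono)
    qed (simp add: supp)
  qed
qed (use w in auto)

lemma rl_kernel_bound: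
  assumes "1 \<le> b" "x \<le> T"
  shows "\<bar>rl_kernel b x\<bar> \<le> T powr (b - 1) / Gamma b"
  using assms T by (auto simp: rl_kernel_def Gamma_real_pos less_imp_le intro!: divide_right_mono powr_mono2)

lemma integrable_rl_kernel_conv:
  assumes "1 \<le> b" "t \<le> T"
  shows "integrable lborel (\<lambda>r. rl_kernel b (t - r) * u r)" "integrable lborel (\<lambda>r. rl_kernel b (t - r) * v r)"
  using rl_kernel_bound[OF assms(1)] assms(2)
  by (auto intro!: bounded_kernel_integrable u_int v_int u_supp v_supp)

text \<open>For b < 1 the function J^b u need not be bounded, but J^1 J^b = J^(1+b) has a kernel
  bounded up to time T. This makes J^b u integrable up to T.\<close>

lemma integrable_iterated_rl_kernel:
  assumes b: "0 < b"
  shows "integrable lborel (\<lambda>s. rl_kernel 1 (T - s) * (\<integral>r. rl_kernel b (s - r) * u r \<partial>lborel))"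
    and "integrable lborel (\<lambda>s. rl_kernel 1 (T - s) * (\<integral>r. rl_kernel b (s - r) * v r \<partial>lborel))"
  by (rule conv_conv_eq(3)[OF _ _ _ _ _ _ rl_kernel_semigroup];
      use b in \<open>auto intro!: rl_kernel_nonneg integrable_rl_kernel_conv\<close>)+

end

text \<open>The equation D^\<alpha> u = v in the integrated form J^(1-\<alpha>) u = J^1 v, which
  includes the initial condition that no constant is added.\<close>

locale scalar_fractional = L2_pair +
  assumes deriv: "AE t in lborel. t < T \<longrightarrow>
      (\<integral>s. rl_kernel (1 - \<alpha>) (t - s) * u s \<partial>lborel) = (\<integral>s. rl_kernel 1 (t - s) * v s \<partial>lborel)"
begin

section \<open>Inversion: u as the fractional integral of v\<close>

definition frac_int :: "real \<Rightarrow> real" where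
  "frac_int s = (\<integral>r. rl_kernel \<alpha> (s - r) * v r \<partial>lborel)"

lemma frac_int_measurable [measurable]: "frac_int \<in> borel_measurable borel"
  unfolding frac_int_def by measurable

lemma conv_frac_int:
  assumes "t \<le> T"
  shows "(\<integral>s. rl_kernel 1 (t - s) * frac_int s \<partial>lborel) = (\<integral>r. rl_kernel (1 + \<alpha>) (t - r) * v r \<partial>lborel)"
    and "AE s in lborel. s < t \<longrightarrow> integrable lborel (\<lambda>r. rl_kernel \<alpha> (s - r) * v r)"
    and "integrable lborel (\<lambda>s. rl_kernel 1 (t - s) * frac_int s)"
proof -
  note * = conv_conv_eq[of "rl_kernel 1" "rl_kernel \<alpha>" v "rl_kernel (1 + \<alpha>)" t,
      OF _ _ _ _ _ _ rl_kernel_semigroup]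
  show "(\<integral>s. rl_kernel 1 (t - s) * frac_int s \<partial>lborel) = (\<integral>r. rl_kernel (1 + \<alpha>) (t - r) * v r \<partial>lborel)"
    unfolding frac_int_def
    using assms \<alpha> by (intro *(1)) (auto intro!: rl_kernel_nonneg integrable_rl_kernel_conv)
  have "AE s in lborel. rl_kernel 1 (t - s) \<noteq> 0 \<longrightarrow> integrable lborel (\<lambda>r. rl_kernel \<alpha> (s - r) * v r)"
    using assms \<alpha> by (intro *(2)) (auto intro!: rl_kernel_nonneg integrable_rl_kernel_conv)
  then show "AE s in lborel. s < t \<longrightarrow> integrable lborel (\<lambda>r. rl_kernel \<alpha> (s - r) * v r)"
    by eventually_elim (auto simp: rl_kernel_1)
  show "integrable lborel (\<lambda>s. rl_kernel 1 (t - s) * frac_int s)"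
    unfolding frac_int_def
    using assms \<alpha> by (intro *(3)) (auto intro!: rl_kernel_nonneg integrable_rl_kernel_conv)
qed

text \<open>Apply J^\<alpha> to the hypothesis: J^1 u = J^\<alpha> J^(1-\<alpha>) u = J^\<alpha> J^1
  v = J^(1+\<alpha>) v = J^1 J^\<alpha> v. Comparing primitives avoids differentiating a fractional
  integral.\<close>

lemma primitive_u_eq:
  assumes "t \<le> T"
  shows "(\<integral>s. rl_kernel 1 (t - s) * u s \<partial>lborel) = (\<integral>s. rl_kernel 1 (t - s) * frac_int s \<partial>lborel)"
proof -
  have "(\<integral>s. rl_kernel 1 (t - s) * u s \<partial>lborel)
    = (\<integral>s. rl_kernel \<alpha> (t - s) * (\<integral>r. rl_kernel (1 - \<alpha>) (s - r) * u r \<partial>lborel) \<partial>lborel)"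
    using assms \<alpha> rl_kernel_semigroup[of \<alpha> "1 - \<alpha>"]
    by (intro conv_conv_eq(1)[symmetric]) (auto intro!: rl_kernel_nonneg integrable_rl_kernel_conv)
  also have "\<dots> = (\<integral>s. rl_kernel \<alpha> (t - s) * (\<integral>r. rl_kernel 1 (s - r) * v r \<partial>lborel) \<partial>lborel)"
  proof (rule integral_cong_AE)
    show "AE s in lborel. rl_kernel \<alpha> (t - s) * (\<integral>r. rl_kernel (1 - \<alpha>) (s - r) * u r \<partial>lborel)
      = rl_kernel \<alpha> (t - s) * (\<integral>r. rl_kernel 1 (s - r) * v r \<partial>lborel)"
      using deriv by eventually_elim (use assms in \<open>auto simp: rl_kernel_def[of \<alpha>]\<close>)
  qed measurable
  also have "\<dots> = (\<integral>r. rl_kernel (1 + \<alpha>) (t - r) * v r \<partial>lborel)"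
    using assms \<alpha> rl_kernel_semigroup[of \<alpha> 1]
    by (intro conv_conv_eq(1)) (auto intro!: rl_kernel_nonneg integrable_rl_kernel_conv simp: add.commute)
  also have "\<dots> = (\<integral>s. rl_kernel 1 (t - s) * frac_int s \<partial>lborel)"
    using assms by (rule conv_frac_int(1)[symmetric])
  finally show ?thesis .
qed

lemma u_eq_frac_int: "AE s in lborel. s < T \<longrightarrow> u s = frac_int s"
proof -
  let ?w = "\<lambda>s. rl_kernel 1 (T - s) * u s - rl_kernel 1 (T - s) * frac_int s"
  have iu: "integrable lborel (\<lambda>s. rl_kernel 1 (t - s) * u s)" if "t \<le> T" for t
    using that by (intro integrable_rl_kernel_conv) auto
  have "AE s in lborel. ?w s = 0"
  proof (rule AE_zero_if_initial_integrals_zero)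
    show "integrable lborel ?w"
      by (intro Bochner_Integration.integrable_diff iu conv_frac_int(3)) auto
    fix t
    \<comment> \<open>The primitives are compared only up to T, where both terms of
      \<open>?w\<close> are cut off; beyond T the initial integral no longer depends on t.\<close>
    define t' where "t' = min t T"
    have t': "t' \<le> T" by (simp add: t'_def)
    have "(\<integral>s. indicator {..t} s * ?w s \<partial>lborel)
      = (\<integral>s. rl_kernel 1 (t' - s) * u s - rl_kernel 1 (t' - s) * frac_int s \<partial>lborel)"
    proof (rule integral_cong_AE)
      show "AE s in lborel. indicator {..t} s * ?w s
        = rl_kernel 1 (t' - s) * u s - rl_kernel 1 (t' - s) * frac_int s"
        using AE_lborel_singleton[of t]
        by eventually_elim (auto simp: rl_kernel_1 t'_def indicator_def)
    qed measurable
    also have "\<dots> = 0"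
      using iu[OF t'] conv_frac_int(3)[OF t'] primitive_u_eq[OF t'] by simp
    finally show "(\<integral>s. indicator {..t} s * ?w s \<partial>lborel) = 0" .
  qed
  then show ?thesis
    by eventually_elim (auto simp: rl_kernel_1)
qed

text \<open>The derivative of k_\<epsilon> * u, written out as k_\<epsilon>(0) u - (-k_\<epsilon>')
  * u so that no differentiation has to be performed.\<close>

definition reg_deriv :: "real \<Rightarrow> real \<Rightarrow> real" where
  "reg_deriv \<epsilon> \<tau> = rl_kernel (1 - \<alpha>) \<epsilon> * u \<tau> - (\<integral>s. shifted_kernel_deriv \<alpha> \<epsilon> (\<tau> - s) * u s \<partial>lborel)"

lemma reg_deriv_measurable [measurable]: "reg_deriv \<epsilon> \<in> borel_measurable borel"
  unfolding reg_deriv_def by measurable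

text \<open>Inserting u = l * v into both terms leaves the convolution of v with k(\<epsilon>) l -
  (-k_\<epsilon>') * l, the rescaled resolvent kernel. The substitution r = \<tau> - \<epsilon> y
  moves \<epsilon> from the kernel into the argument of v, its Jacobian cancelling the factor 1 /
  \<epsilon>.\<close>

lemma reg_deriv_eq:
  assumes \<epsilon>: "0 < \<epsilon>"
  shows "AE \<tau> in lborel. \<tau> < T \<longrightarrow> reg_deriv \<epsilon> \<tau> = (\<integral>y. resolvent_kernel \<alpha> y * v (\<tau> - \<epsilon> * y) \<partial>lborel)"
  using u_eq_frac_int conv_frac_int(2)[OF order_refl]
proof eventually_elim
  case (elim \<tau>)
  let ?G = "\<lambda>x. if 0 < x then (x / \<epsilon>) powr \<alpha> / ((x + \<epsilon>) * (Gamma \<alpha> * Gamma (1 - \<alpha>))) else 0"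
  show ?case
  proof
    assume \<tau>: "\<tau> < T"
    have G_nn: "0 \<le> ?G x" for x
      using \<alpha> \<epsilon> by (auto simp: Gamma_real_pos less_imp_le)
    have [measurable]: "?G \<in> borel_measurable borel" by measurable
    have G_bound: "\<bar>?G x\<bar> \<le> (T / \<epsilon>) powr \<alpha> / (\<epsilon> * (Gamma \<alpha> * Gamma (1 - \<alpha>)))" if "x \<le> T" for x
    proof (cases "0 < x")
      case True
      then show ?thesis
        using that \<alpha> \<epsilon> T
        by (auto simp: Gamma_real_pos less_imp_le intro!: frac_le powr_mono2 divide_right_mono mult_right_mono mult_nonneg_nonneg)
    next
      case False
      then show ?thesis using \<alpha> \<epsilon> by (auto simp: Gamma_real_pos less_imp_le)
    qed
    have iG: "integrable lborel (\<lambda>r. ?G (\<tau> - r) * v r)"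
      using \<tau> by (intro bounded_kernel_integrable[OF _ v_int v_supp G_bound]) auto
    have "(\<integral>s. shifted_kernel_deriv \<alpha> \<epsilon> (\<tau> - s) * u s \<partial>lborel)
      = (\<integral>s. shifted_kernel_deriv \<alpha> \<epsilon> (\<tau> - s) * frac_int s \<partial>lborel)"
    proof (rule integral_cong_AE)
      show "AE s in lborel. shifted_kernel_deriv \<alpha> \<epsilon> (\<tau> - s) * u s = shifted_kernel_deriv \<alpha> \<epsilon> (\<tau> - s) * frac_int s"
        using u_eq_frac_int by eventually_elim (use \<tau> in \<open>auto simp: shifted_kernel_deriv_def\<close>)
    qed measurable
    also have "\<dots> = (\<integral>r. ?G (\<tau> - r) * v r \<partial>lborel)"
      unfolding frac_int_def
    proof (rule conv_conv_eq(1)[OF _ _ _ _ _ _ _ iG])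
      show "0 \<le> ?G x" for x by (rule G_nn)
      show "(\<integral>\<^sup>+s. ennreal (shifted_kernel_deriv \<alpha> \<epsilon> (x - s) * rl_kernel \<alpha> s) \<partial>lborel) = ennreal (?G x)" for x
        by (rule nn_integral_shifted_deriv_conv_rl_kernel[OF \<alpha> \<epsilon>])
    qed (use \<alpha> in \<open>auto intro: rl_kernel_nonneg shifted_kernel_deriv_nonneg\<close>)
    finally have "reg_deriv \<epsilon> \<tau> = rl_kernel (1 - \<alpha>) \<epsilon> * (\<integral>r. rl_kernel \<alpha> (\<tau> - r) * v r \<partial>lborel) - (\<integral>r. ?G (\<tau> - r) * v r \<partial>lborel)"
      using elim \<tau> by (simp add: reg_deriv_def frac_int_def)
    also have "\<dots> = (\<integral>r. rl_kernel (1 - \<alpha>) \<epsilon> * (rl_kernel \<alpha> (\<tau> - r) * v r) - ?G (\<tau> - r) * v r \<partial>lborel)"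
      using elim \<tau> iG by (subst Bochner_Integration.integral_diff) auto
    also have "\<dots> = (\<integral>r. resolvent_kernel \<alpha> ((\<tau> - r) / \<epsilon>) / \<epsilon> * v r \<partial>lborel)"
      unfolding resolvent_kernel_scaled[OF \<alpha> \<epsilon>, symmetric]
      by (intro Bochner_Integration.integral_cong refl) (simp only: left_diff_distrib mult.assoc)
    also have "\<dots> = \<epsilon> * (\<integral>y. (1 / \<epsilon>) * (resolvent_kernel \<alpha> y * v (\<tau> - \<epsilon> * y)) \<partial>lborel)"
      using \<epsilon> by (subst lborel_integral_real_affine[where c="-\<epsilon>" and t=\<tau>]) simp_all
    also have "\<dots> = (\<integral>y. resolvent_kernel \<alpha> y * v (\<tau> - \<epsilon> * y) \<partial>lborel)"
      using \<epsilon> by (subst integral_mult_right_zero) simp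
    finally show "reg_deriv \<epsilon> \<tau> = (\<integral>y. resolvent_kernel \<alpha> y * v (\<tau> - \<epsilon> * y) \<partial>lborel)" .
  qed
qed

lemma resolvent_kernel_integrable:
  "integrable lborel (resolvent_kernel \<alpha>)" "(\<integral>y. resolvent_kernel \<alpha> y \<partial>lborel) = 1"
proof -
  note nn = resolvent_kernel_nonneg[OF \<alpha>]
  show "integrable lborel (resolvent_kernel \<alpha>)"
    using nn_integral_resolvent_kernel[OF \<alpha>] nn by (intro integrableI_nonneg) auto
  show "(\<integral>y. resolvent_kernel \<alpha> y \<partial>lborel) = 1"
    using nn_integral_resolvent_kernel[OF \<alpha>] nn by (subst integral_eq_nn_integral) auto
qed

text \<open>Pairing of u, cut off at t, with v delayed by s. The pairing of u with the regularised
  derivative is the average of \<open>corr t (\<epsilon> * y)\<close> over the probability density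
  \<open>resolvent_kernel\<close>, so a uniform bound and continuity at s = 0 settle its
  limit.\<close>

definition corr :: "real \<Rightarrow> real \<Rightarrow> real" where
  "corr t s = (\<integral>\<tau>. indicator {..<t} \<tau> * u \<tau> * v (\<tau> - s) \<partial>lborel)"

lemma corr_measurable [measurable]: "corr t \<in> borel_measurable borel"
  unfolding corr_def by measurable

lemma cut_sq:
  shows "integrable lborel (\<lambda>\<tau>. (indicator {..<t} \<tau> * u \<tau>)\<^sup>2)"
    and "(\<integral>\<tau>. (indicator {..<t} \<tau> * u \<tau>)\<^sup>2 \<partial>lborel) \<le> (\<integral>\<tau>. (u \<tau>)\<^sup>2 \<partial>lborel)"
proof -
  show i: "integrable lborel (\<lambda>\<tau>. (indicator {..<t} \<tau> * u \<tau>)\<^sup>2)"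
    by (rule Bochner_Integration.integrable_bound[OF u_sq]) (auto simp: indicator_def)
  show "(\<integral>\<tau>. (indicator {..<t} \<tau> * u \<tau>)\<^sup>2 \<partial>lborel) \<le> (\<integral>\<tau>. (u \<tau>)\<^sup>2 \<partial>lborel)"
    by (rule integral_mono[OF i u_sq]) (auto simp: indicator_def)
qed

lemma abs_corr_integrand:
  shows "integrable lborel (\<lambda>\<tau>. indicator {..<t} \<tau> * u \<tau> * v (\<tau> - s))"
    and "(\<integral>\<tau>. \<bar>indicator {..<t} \<tau> * u \<tau> * v (\<tau> - s)\<bar> \<partial>lborel)
      \<le> sqrt ((\<integral>\<tau>. (u \<tau>)\<^sup>2 \<partial>lborel) * (\<integral>\<tau>. (v \<tau>)\<^sup>2 \<partial>lborel))"
proof -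
  note vs = translation_diff_integrable(1)[OF v_sq, of s]
  note CS = Cauchy_Schwarz_integral[OF _ cut_sq(1)[of t] _ vs]
  show "integrable lborel (\<lambda>\<tau>. indicator {..<t} \<tau> * u \<tau> * v (\<tau> - s))"
    by (rule CS) measurable
  have "(\<integral>\<tau>. \<bar>indicator {..<t} \<tau> * u \<tau> * v (\<tau> - s)\<bar> \<partial>lborel)\<^sup>2
    \<le> (\<integral>\<tau>. (indicator {..<t} \<tau> * u \<tau>)\<^sup>2 \<partial>lborel) * (\<integral>\<tau>. (v (\<tau> - s))\<^sup>2 \<partial>lborel)"
    by (rule CS) measurable
  also have "(\<integral>\<tau>. (v (\<tau> - s))\<^sup>2 \<partial>lborel) = (\<integral>\<tau>. (v \<tau>)\<^sup>2 \<partial>lborel)"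
    using lborel_integral_real_affine[of 1 "\<lambda>\<tau>. (v \<tau>)\<^sup>2" "-s"] by (simp add: algebra_simps)
  also have "(\<integral>\<tau>. (indicator {..<t} \<tau> * u \<tau>)\<^sup>2 \<partial>lborel) * (\<integral>\<tau>. (v \<tau>)\<^sup>2 \<partial>lborel)
    \<le> (\<integral>\<tau>. (u \<tau>)\<^sup>2 \<partial>lborel) * (\<integral>\<tau>. (v \<tau>)\<^sup>2 \<partial>lborel)"
    by (intro mult_right_mono cut_sq) auto
  finally show "(\<integral>\<tau>. \<bar>indicator {..<t} \<tau> * u \<tau> * v (\<tau> - s)\<bar> \<partial>lborel)
      \<le> sqrt ((\<integral>\<tau>. (u \<tau>)\<^sup>2 \<partial>lborel) * (\<integral>\<tau>. (v \<tau>)\<^sup>2 \<partial>lborel))"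
    by (rule real_le_rsqrt)
qed

lemma corr_bound: "\<bar>corr t s\<bar> \<le> sqrt ((\<integral>\<tau>. (u \<tau>)\<^sup>2 \<partial>lborel) * (\<integral>\<tau>. (v \<tau>)\<^sup>2 \<partial>lborel))"
  unfolding corr_def by (rule order_trans[OF integral_abs_bound abs_corr_integrand(2)])

text \<open>Cauchy-Schwarz reduces the difference to the L^2 distance between v and its translate;
  the cut-off at t only decreases the norm of u.\<close>

lemma corr_tendsto:
  assumes e: "e \<longlonglongrightarrow> 0"
  shows "(\<lambda>n. corr t (e n)) \<longlonglongrightarrow> corr t 0"
proof -
  define d where "d n = (\<integral>\<tau>. (v (\<tau> - e n) - v \<tau>)\<^sup>2 \<partial>lborel)" for n
  have d: "d \<longlonglongrightarrow> 0"
    unfolding d_def by (rule L2_translation[OF v_meas v_sq e])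
  have "\<bar>corr t (e n) - corr t 0\<bar> \<le> sqrt ((\<integral>\<tau>. (u \<tau>)\<^sup>2 \<partial>lborel) * d n)" for n
  proof -
    have sq: "(a - b)\<^sup>2 \<le> 2 * a\<^sup>2 + 2 * b\<^sup>2" for a b :: real
      using sum_squares_bound[of a "-b"] by (simp add: power2_diff)
    have vd: "integrable lborel (\<lambda>\<tau>. (v (\<tau> - e n) - v \<tau>)\<^sup>2)"
    proof (rule Bochner_Integration.integrable_bound)
      show "integrable lborel (\<lambda>\<tau>. 2 * (v (\<tau> - e n))\<^sup>2 + 2 * (v \<tau>)\<^sup>2)"
        using v_sq translation_diff_integrable(1)[OF v_sq] by simp
    qed (use sq in \<open>auto simp: abs_of_nonneg\<close>)
    note CS = Cauchy_Schwarz_integral[OF _ cut_sq(1)[of t] _ vd]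
    have "corr t (e n) - corr t 0 = (\<integral>\<tau>. indicator {..<t} \<tau> * u \<tau> * (v (\<tau> - e n) - v \<tau>) \<partial>lborel)"
      unfolding corr_def using abs_corr_integrand(1)[of t "e n"] abs_corr_integrand(1)[of t 0]
      by (subst Bochner_Integration.integral_diff[symmetric]) (auto simp: right_diff_distrib)
    also have "\<bar>\<dots>\<bar> \<le> (\<integral>\<tau>. \<bar>indicator {..<t} \<tau> * u \<tau> * (v (\<tau> - e n) - v \<tau>)\<bar> \<partial>lborel)"
      by (rule integral_abs_bound)
    also have "\<dots> \<le> sqrt ((\<integral>\<tau>. (indicator {..<t} \<tau> * u \<tau>)\<^sup>2 \<partial>lborel) * d n)"
      unfolding d_def by (intro real_le_rsqrt CS) measurable
    also have "\<dots> \<le> sqrt ((\<integral>\<tau>. (u \<tau>)\<^sup>2 \<partial>lborel) * d n)"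
      by (intro real_sqrt_le_mono mult_right_mono cut_sq) (simp add: d_def)
    finally show ?thesis .
  qed
  moreover have lim: "(\<lambda>n. sqrt ((\<integral>\<tau>. (u \<tau>)\<^sup>2 \<partial>lborel) * d n)) \<longlonglongrightarrow> 0"
    using tendsto_real_sqrt[OF tendsto_mult[OF tendsto_const d]] by simp
  ultimately have "(\<lambda>n. corr t (e n) - corr t 0) \<longlonglongrightarrow> 0"
    by (intro Lim_null_comparison[OF _ lim] always_eventually) auto
  then show ?thesis by (rule LIM_zero_cancel)
qed

text \<open>Fubini applies because for fixed y the absolute integral over \<tau> is at most the
  product of the L^2 norms of u and v, uniformly in y, and the kernel has mass one.\<close>

lemma integral_u_reg_deriv:
  assumes \<epsilon>: "0 < \<epsilon>" and t: "t \<le> T"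
  shows "(\<integral>\<tau>. indicator {..<t} \<tau> * u \<tau> * reg_deriv \<epsilon> \<tau> \<partial>lborel)
    = (\<integral>y. resolvent_kernel \<alpha> y * corr t (\<epsilon> * y) \<partial>lborel)"
proof -
  define N where "N = sqrt ((\<integral>\<tau>. (u \<tau>)\<^sup>2 \<partial>lborel) * (\<integral>\<tau>. (v \<tau>)\<^sup>2 \<partial>lborel))"
  have N: "0 \<le> N" by (simp add: N_def)
  note nn = resolvent_kernel_nonneg[OF \<alpha>]
  have "(\<integral>\<tau>. indicator {..<t} \<tau> * u \<tau> * reg_deriv \<epsilon> \<tau> \<partial>lborel)
    = (\<integral>\<tau>. indicator {..<t} \<tau> * u \<tau> * (\<integral>y. resolvent_kernel \<alpha> y * v (\<tau> - \<epsilon> * y) \<partial>lborel) \<partial>lborel)"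
  proof (rule integral_cong_AE)
    show "AE \<tau> in lborel. indicator {..<t} \<tau> * u \<tau> * reg_deriv \<epsilon> \<tau>
      = indicator {..<t} \<tau> * u \<tau> * (\<integral>y. resolvent_kernel \<alpha> y * v (\<tau> - \<epsilon> * y) \<partial>lborel)"
      using reg_deriv_eq[OF \<epsilon>] by eventually_elim (use t in \<open>auto simp: indicator_def\<close>)
  qed measurable
  also have "\<dots> = (\<integral>\<tau>. \<integral>y. indicator {..<t} \<tau> * u \<tau> * (resolvent_kernel \<alpha> y * v (\<tau> - \<epsilon> * y)) \<partial>lborel \<partial>lborel)"
    by simp
  also have "\<dots> = (\<integral>y. \<integral>\<tau>. indicator {..<t} \<tau> * u \<tau> * (resolvent_kernel \<alpha> y * v (\<tau> - \<epsilon> * y)) \<partial>lborel \<partial>lborel)"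
  proof (rule lborel_pair.Fubini_integral)
    have "(\<integral>\<^sup>+y. \<integral>\<^sup>+\<tau>. ennreal (norm (indicator {..<t} \<tau> * u \<tau> * (resolvent_kernel \<alpha> y * v (\<tau> - \<epsilon> * y)))) \<partial>lborel \<partial>lborel)
      \<le> (\<integral>\<^sup>+y. ennreal (resolvent_kernel \<alpha> y) * ennreal N \<partial>lborel)"
    proof (rule nn_integral_mono)
      fix y
      have "(\<integral>\<^sup>+\<tau>. ennreal (norm (indicator {..<t} \<tau> * u \<tau> * (resolvent_kernel \<alpha> y * v (\<tau> - \<epsilon> * y)))) \<partial>lborel)
        = ennreal (resolvent_kernel \<alpha> y) * (\<integral>\<^sup>+\<tau>. ennreal \<bar>indicator {..<t} \<tau> * u \<tau> * v (\<tau> - \<epsilon> * y)\<bar> \<partial>lborel)"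
        using nn by (subst nn_integral_cmult[symmetric])
          (auto intro!: nn_integral_cong simp: ennreal_mult[symmetric] abs_mult mult_ac)
      also have "(\<integral>\<^sup>+\<tau>. ennreal \<bar>indicator {..<t} \<tau> * u \<tau> * v (\<tau> - \<epsilon> * y)\<bar> \<partial>lborel)
        = ennreal (\<integral>\<tau>. \<bar>indicator {..<t} \<tau> * u \<tau> * v (\<tau> - \<epsilon> * y)\<bar> \<partial>lborel)"
        using abs_corr_integrand(1)[of t "\<epsilon> * y"] by (intro nn_integral_eq_integral) auto
      also have "\<dots> \<le> ennreal N"
        unfolding N_def by (intro ennreal_leI abs_corr_integrand)
      finally show "(\<integral>\<^sup>+\<tau>. ennreal (norm (indicator {..<t} \<tau> * u \<tau> * (resolvent_kernel \<alpha> y * v (\<tau> - \<epsilon> * y)))) \<partial>lborel)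
        \<le> ennreal (resolvent_kernel \<alpha> y) * ennreal N"
        by (simp add: mult_left_mono)
    qed
    also have "\<dots> < \<infinity>"
      by (subst nn_integral_multc) (auto simp: nn_integral_resolvent_kernel[OF \<alpha>])
    finally show "integrable (lborel \<Otimes>\<^sub>M lborel)
      (\<lambda>(y, \<tau>). indicator {..<t} \<tau> * u \<tau> * (resolvent_kernel \<alpha> y * v (\<tau> - \<epsilon> * y)))"
      by (subst integrable_iff_bounded, subst lborel.nn_integral_fst[symmetric]) (auto simp: split_beta')
  qed
  also have "\<dots> = (\<integral>y. resolvent_kernel \<alpha> y * corr t (\<epsilon> * y) \<partial>lborel)"
    unfolding corr_def
    by (intro Bochner_Integration.integral_cong refl, subst integral_mult_right_zero[symmetric])
      (simp add: mult_ac)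
  finally show ?thesis .
qed

text \<open>Dominated convergence in y; since the kernel has mass one, the limit is
  \<open>corr t 0\<close>, the pairing with v itself.\<close>

lemma integral_u_reg_deriv_tendsto:
  assumes e: "e \<longlonglongrightarrow> 0" "\<And>n. 0 < e n" and t: "t \<le> T"
  shows "(\<lambda>n. \<integral>\<tau>. indicator {..<t} \<tau> * u \<tau> * reg_deriv (e n) \<tau> \<partial>lborel)
    \<longlonglongrightarrow> (\<integral>\<tau>. indicator {..<t} \<tau> * u \<tau> * v \<tau> \<partial>lborel)"
proof -
  define N where "N = sqrt ((\<integral>\<tau>. (u \<tau>)\<^sup>2 \<partial>lborel) * (\<integral>\<tau>. (v \<tau>)\<^sup>2 \<partial>lborel))"
  have "(\<lambda>n. \<integral>y. resolvent_kernel \<alpha> y * corr t (e n * y) \<partial>lborel)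
    \<longlonglongrightarrow> (\<integral>y. resolvent_kernel \<alpha> y * corr t 0 \<partial>lborel)"
  proof (rule integral_dominated_convergence[where w="\<lambda>y. resolvent_kernel \<alpha> y * N"])
    show "AE y in lborel. (\<lambda>n. resolvent_kernel \<alpha> y * corr t (e n * y)) \<longlonglongrightarrow> resolvent_kernel \<alpha> y * corr t 0"
    proof (intro AE_I2 tendsto_mult tendsto_const corr_tendsto)
      fix y show "(\<lambda>n. e n * y) \<longlonglongrightarrow> 0"
        using tendsto_mult[OF e(1) tendsto_const[of y]] by simp
    qed
    show "AE y in lborel. norm (resolvent_kernel \<alpha> y * corr t (e n * y)) \<le> resolvent_kernel \<alpha> y * N" for n
      using resolvent_kernel_nonneg[OF \<alpha>] corr_bound[of t]
      by (auto simp: abs_mult N_def intro!: mult_left_mono)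
  qed (use resolvent_kernel_integrable in auto)
  moreover have "(\<integral>y. resolvent_kernel \<alpha> y * corr t 0 \<partial>lborel) = (\<integral>\<tau>. indicator {..<t} \<tau> * u \<tau> * v \<tau> \<partial>lborel)"
    by (simp add: resolvent_kernel_integrable corr_def)
  ultimately show ?thesis
    using e t by (simp add: integral_u_reg_deriv)
qed

section \<open>Energy identity for the shifted kernels and its limit\<close>

lemma shifted_kernel_conv_integrable:
  assumes \<epsilon>: "0 < \<epsilon>"
  shows "integrable lborel (\<lambda>s. shifted_kernel_deriv \<alpha> \<epsilon> (\<tau> - s))"
    and "(\<integral>s. shifted_kernel_deriv \<alpha> \<epsilon> (\<tau> - s) \<partial>lborel) = rl_kernel (1 - \<alpha>) \<epsilon>"
proof -
  note nn = shifted_kernel_deriv_nonneg[OF \<alpha>]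
  have *: "(\<integral>\<^sup>+s. ennreal (shifted_kernel_deriv \<alpha> \<epsilon> (\<tau> - s)) \<partial>lborel) = ennreal (rl_kernel (1 - \<alpha>) \<epsilon>)"
    using nn_integral_shifted_kernel_deriv[OF \<alpha> \<epsilon>]
      nn_integral_real_affine[of "\<lambda>s. ennreal (shifted_kernel_deriv \<alpha> \<epsilon> s)" "-1" \<tau>] by simp
  show "integrable lborel (\<lambda>s. shifted_kernel_deriv \<alpha> \<epsilon> (\<tau> - s))"
    using nn * by (intro integrableI_nonneg) auto
  show "(\<integral>s. shifted_kernel_deriv \<alpha> \<epsilon> (\<tau> - s) \<partial>lborel) = rl_kernel (1 - \<alpha>) \<epsilon>"
    using nn * \<alpha> by (subst integral_eq_nn_integral) (auto simp: rl_kernel_nonneg)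
qed

lemma shifted_kernel_deriv_bound:
  assumes \<epsilon>: "0 < \<epsilon>"
  shows "\<bar>shifted_kernel_deriv \<alpha> \<epsilon> s\<bar> \<le> \<alpha> * \<epsilon> powr (-\<alpha> - 1) / Gamma (1 - \<alpha>)"
proof (cases "0 < s")
  case True
  then have "(s + \<epsilon>) powr (-\<alpha> - 1) \<le> \<epsilon> powr (-\<alpha> - 1)"
    using \<epsilon> \<alpha> by (intro powr_mono2') auto
  then show ?thesis
    using \<alpha> by (simp add: shifted_kernel_deriv_def Gamma_real_pos less_imp_le abs_mult divide_right_mono)
next
  case False
  then show ?thesis
    using \<alpha> by (simp add: shifted_kernel_deriv_def Gamma_real_pos less_imp_le)
qed

lemma shifted_kernel_conv_integrable':
  assumes \<epsilon>: "0 < \<epsilon>" and w: "integrable lborel w"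
  shows "integrable lborel (\<lambda>s. shifted_kernel_deriv \<alpha> \<epsilon> (\<tau> - s) * w s)"
proof (rule Bochner_Integration.integrable_bound[where f="\<lambda>r. \<alpha> * \<epsilon> powr (-\<alpha> - 1) / Gamma (1 - \<alpha>) * \<bar>w r\<bar>"])
  show "AE s in lborel. norm (shifted_kernel_deriv \<alpha> \<epsilon> (\<tau> - s) * w s)
      \<le> norm (\<alpha> * \<epsilon> powr (-\<alpha> - 1) / Gamma (1 - \<alpha>) * \<bar>w s\<bar>)"
  proof (intro AE_I2)
    fix s
    show "norm (shifted_kernel_deriv \<alpha> \<epsilon> (\<tau> - s) * w s)
      \<le> norm (\<alpha> * \<epsilon> powr (-\<alpha> - 1) / Gamma (1 - \<alpha>) * \<bar>w s\<bar>)"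
      using mult_right_mono[OF shifted_kernel_deriv_bound[OF \<epsilon>, of "\<tau> - s"], of "\<bar>w s\<bar>"] \<alpha>
      by (simp add: abs_mult Gamma_real_pos less_imp_le)
  qed
qed (use w in auto)

text \<open>Expanding the square turns the energy density into the difference between
  \<open>2 u D\<close> and the derivative of \<open>k\<^sub>\<epsilon> * u\<^sup>2\<close>, where \<open>D\<close> is the derivative of \<open>k\<^sub>\<epsilon> * u\<close>.\<close>

lemma energy_eq:
  assumes \<epsilon>: "0 < \<epsilon>"
  shows "energy \<alpha> \<epsilon> u \<tau> = ennreal (2 * (u \<tau> * reg_deriv \<epsilon> \<tau>) -
      (rl_kernel (1 - \<alpha>) \<epsilon> * (u \<tau>)\<^sup>2 - (\<integral>s. shifted_kernel_deriv \<alpha> \<epsilon> (\<tau> - s) * (u s)\<^sup>2 \<partial>lborel)))"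
    and "0 \<le> 2 * (u \<tau> * reg_deriv \<epsilon> \<tau>) -
      (rl_kernel (1 - \<alpha>) \<epsilon> * (u \<tau>)\<^sup>2 - (\<integral>s. shifted_kernel_deriv \<alpha> \<epsilon> (\<tau> - s) * (u s)\<^sup>2 \<partial>lborel))"
proof -
  let ?k = "\<lambda>s. shifted_kernel_deriv \<alpha> \<epsilon> (\<tau> - s)"
  note nn = shifted_kernel_deriv_nonneg[OF \<alpha>]
  note i = shifted_kernel_conv_integrable[OF \<epsilon>, of \<tau>]
    shifted_kernel_conv_integrable'[OF \<epsilon> u_int, of \<tau>]
    shifted_kernel_conv_integrable'[OF \<epsilon> u_sq, of \<tau>]
  have eq: "?k s * (u \<tau> - u s)\<^sup>2 = (u \<tau>)\<^sup>2 * ?k s - 2 * u \<tau> * (?k s * u s) + ?k s * (u s)\<^sup>2" for s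
    by (simp add: power2_diff algebra_simps)
  have int: "integrable lborel (\<lambda>s. ?k s * (u \<tau> - u s)\<^sup>2)"
    unfolding eq using i by auto
  have val: "(\<integral>s. ?k s * (u \<tau> - u s)\<^sup>2 \<partial>lborel) = 2 * (u \<tau> * reg_deriv \<epsilon> \<tau>) -
      (rl_kernel (1 - \<alpha>) \<epsilon> * (u \<tau>)\<^sup>2 - (\<integral>s. ?k s * (u s)\<^sup>2 \<partial>lborel))"
    unfolding eq using i
    by (simp add: reg_deriv_def) (simp add: algebra_simps power2_eq_square)
  show "energy \<alpha> \<epsilon> u \<tau> = ennreal (2 * (u \<tau> * reg_deriv \<epsilon> \<tau>) -
      (rl_kernel (1 - \<alpha>) \<epsilon> * (u \<tau>)\<^sup>2 - (\<integral>s. ?k s * (u s)\<^sup>2 \<partial>lborel)))"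
    unfolding energy_def val[symmetric] using int nn by (intro nn_integral_eq_integral) auto
  show "0 \<le> 2 * (u \<tau> * reg_deriv \<epsilon> \<tau>) -
      (rl_kernel (1 - \<alpha>) \<epsilon> * (u \<tau>)\<^sup>2 - (\<integral>s. ?k s * (u s)\<^sup>2 \<partial>lborel))"
    unfolding val[symmetric] using nn by (intro integral_nonneg_AE) auto
qed

text \<open>For \<epsilon> > 0 the kernel is bounded, so its convolution with the integrable u is
  bounded and may be multiplied by u; the remaining term is a multiple of u^2.\<close>

lemma u_reg_deriv_integrable:
  assumes \<epsilon>: "0 < \<epsilon>"
  shows "integrable lborel (\<lambda>\<tau>. u \<tau> * reg_deriv \<epsilon> \<tau>)"
proof -
  define B where "B = \<alpha> * \<epsilon> powr (-\<alpha> - 1) / Gamma (1 - \<alpha>) * (\<integral>s. \<bar>u s\<bar> \<partial>lborel)"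
  have B: "\<bar>\<integral>s. shifted_kernel_deriv \<alpha> \<epsilon> (\<tau> - s) * u s \<partial>lborel\<bar> \<le> B" for \<tau>
  proof -
    have "\<bar>\<integral>s. shifted_kernel_deriv \<alpha> \<epsilon> (\<tau> - s) * u s \<partial>lborel\<bar>
      \<le> (\<integral>s. \<bar>shifted_kernel_deriv \<alpha> \<epsilon> (\<tau> - s) * u s\<bar> \<partial>lborel)"
      by (rule integral_abs_bound)
    also have "\<dots> \<le> (\<integral>s. \<alpha> * \<epsilon> powr (-\<alpha> - 1) / Gamma (1 - \<alpha>) * \<bar>u s\<bar> \<partial>lborel)"
    proof (rule integral_mono)
      show "integrable lborel (\<lambda>s. \<bar>shifted_kernel_deriv \<alpha> \<epsilon> (\<tau> - s) * u s\<bar>)"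
        by (intro integrable_abs shifted_kernel_conv_integrable' \<epsilon> u_int)
      show "\<bar>shifted_kernel_deriv \<alpha> \<epsilon> (\<tau> - s) * u s\<bar> \<le> \<alpha> * \<epsilon> powr (-\<alpha> - 1) / Gamma (1 - \<alpha>) * \<bar>u s\<bar>" for s
        unfolding abs_mult by (intro mult_right_mono shifted_kernel_deriv_bound \<epsilon>) simp
    qed (use u_int in auto)
    finally show ?thesis by (simp add: B_def)
  qed
  have "integrable lborel (\<lambda>\<tau>. u \<tau> * (\<integral>s. shifted_kernel_deriv \<alpha> \<epsilon> (\<tau> - s) * u s \<partial>lborel))"
  proof (rule Bochner_Integration.integrable_bound[where f="\<lambda>\<tau>. B * u \<tau>"])
    show "AE \<tau> in lborel. norm (u \<tau> * (\<integral>s. shifted_kernel_deriv \<alpha> \<epsilon> (\<tau> - s) * u s \<partial>lborel)) \<le> norm (B * u \<tau>)"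
    proof (intro AE_I2)
      fix \<tau>
      have "\<bar>\<integral>s. shifted_kernel_deriv \<alpha> \<epsilon> (\<tau> - s) * u s \<partial>lborel\<bar> \<le> \<bar>B\<bar>"
        using B[of \<tau>] by linarith
      then show "norm (u \<tau> * (\<integral>s. shifted_kernel_deriv \<alpha> \<epsilon> (\<tau> - s) * u s \<partial>lborel)) \<le> norm (B * u \<tau>)"
        unfolding real_norm_def abs_mult mult.commute[of "\<bar>B\<bar>"] by (rule mult_left_mono) simp
    qed
  qed (use u_int in auto)
  then have "integrable lborel (\<lambda>\<tau>. rl_kernel (1 - \<alpha>) \<epsilon> * (u \<tau>)\<^sup>2 - u \<tau> * (\<integral>s. shifted_kernel_deriv \<alpha> \<epsilon> (\<tau> - s) * u s \<partial>lborel))"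
    using u_sq by (intro Bochner_Integration.integrable_diff) auto
  then show ?thesis
    by (simp add: reg_deriv_def right_diff_distrib power2_eq_square mult_ac)
qed

text \<open>The pointwise expansion is integrated in \<tau> up to t. Fubini takes the place of
  integrating a derivative: the Heaviside function convolved with -k_\<epsilon>' is
  \<open>K\<close>, so the two terms in u^2 combine to k_\<epsilon> * u^2 at time t. The second
  claim ensures that \<open>ennreal\<close> on the right does not truncate a negative
  number.\<close>

lemma regularized_energy_identity:
  assumes \<epsilon>: "0 < \<epsilon>"
  shows "(\<integral>\<^sup>+s. ennreal (indicator {..<t} s * (rl_kernel (1 - \<alpha>) (t - s + \<epsilon>) * (u s)\<^sup>2)) \<partial>lborel)
      + (\<integral>\<^sup>+\<tau>. indicator {..<t} \<tau> * energy \<alpha> \<epsilon> u \<tau> \<partial>lborel)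
    = ennreal (2 * (\<integral>\<tau>. indicator {..<t} \<tau> * u \<tau> * reg_deriv \<epsilon> \<tau> \<partial>lborel))"
    and "0 \<le> (\<integral>\<tau>. indicator {..<t} \<tau> * u \<tau> * reg_deriv \<epsilon> \<tau> \<partial>lborel)"
proof -
  let ?k = "rl_kernel (1 - \<alpha>)"
  let ?q = "\<lambda>\<tau>. \<integral>s. shifted_kernel_deriv \<alpha> \<epsilon> (\<tau> - s) * (u s)\<^sup>2 \<partial>lborel"
  let ?E = "\<lambda>\<tau>. 2 * (u \<tau> * reg_deriv \<epsilon> \<tau>) - (?k \<epsilon> * (u \<tau>)\<^sup>2 - ?q \<tau>)"
  define K where "K x = (if 0 < x then ?k \<epsilon> - ?k (x + \<epsilon>) else 0)" for x
  have [measurable]: "K \<in> borel_measurable borel" unfolding K_def by measurable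
  have k_nn: "0 \<le> ?k x" for x using \<alpha> by (simp add: rl_kernel_nonneg)
  have K_nn: "0 \<le> K x" for x
    using rl_kernel_antimono[OF \<alpha> \<epsilon>, of "x + \<epsilon>"] by (auto simp: K_def)
  have K_le: "\<bar>K x\<bar> \<le> ?k \<epsilon>" for x
    using K_nn[of x] k_nn by (auto simp: K_def)
  have iK: "integrable lborel (\<lambda>r. K (t - r) * (u r)\<^sup>2)"
    by (rule Bochner_Integration.integrable_bound[where f="\<lambda>r. ?k \<epsilon> * (u r)\<^sup>2"])
      (use u_sq K_le k_nn in \<open>auto simp: abs_mult intro!: mult_right_mono\<close>)
  have ind: "rl_kernel 1 (t - s) = indicator {..<t} s" for t s :: real
    by (auto simp: rl_kernel_1 indicator_def)
  have KK: "(\<integral>\<^sup>+s. ennreal (rl_kernel 1 (x - s) * shifted_kernel_deriv \<alpha> \<epsilon> s) \<partial>lborel) = ennreal (K x)" for x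
    unfolding ind K_def by (rule nn_integral_shifted_kernel_deriv_initial[OF \<alpha> \<epsilon>])
  note conv = conv_conv_eq[OF _ _ _ _ _ _ KK iK, unfolded ind]
  have q1: "(\<integral>\<tau>. indicator {..<t} \<tau> * ?q \<tau> \<partial>lborel) = (\<integral>r. K (t - r) * (u r)\<^sup>2 \<partial>lborel)"
    by (rule conv(1)) (use K_nn \<alpha> in \<open>auto simp: rl_kernel_nonneg shifted_kernel_deriv_nonneg\<close>)
  have q2: "integrable lborel (\<lambda>\<tau>. indicator {..<t} \<tau> * ?q \<tau>)"
    by (rule conv(3)) (use K_nn \<alpha> in \<open>auto simp: rl_kernel_nonneg shifted_kernel_deriv_nonneg\<close>)
  have i1: "integrable lborel (\<lambda>\<tau>. indicator {..<t} \<tau> * (u \<tau>)\<^sup>2)"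
    using integrable_real_mult_indicator[OF _ u_sq, of "{..<t}"] by (simp add: mult.commute)
  have i2: "integrable lborel (\<lambda>\<tau>. indicator {..<t} \<tau> * (u \<tau> * reg_deriv \<epsilon> \<tau>))"
    using integrable_real_mult_indicator[OF _ u_reg_deriv_integrable[OF \<epsilon>], of "{..<t}"] by (simp add: mult.commute)
  have Eeq: "indicator {..<t} \<tau> * ?E \<tau> = 2 * (indicator {..<t} \<tau> * (u \<tau> * reg_deriv \<epsilon> \<tau>))
      - ?k \<epsilon> * (indicator {..<t} \<tau> * (u \<tau>)\<^sup>2) + indicator {..<t} \<tau> * ?q \<tau>" for \<tau>
    by (simp add: algebra_simps)
  have iE: "integrable lborel (\<lambda>\<tau>. indicator {..<t} \<tau> * ?E \<tau>)"
    unfolding Eeq using i1 i2 q2 by auto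
  have EI: "(\<integral>\<tau>. indicator {..<t} \<tau> * ?E \<tau> \<partial>lborel) =
      2 * (\<integral>\<tau>. indicator {..<t} \<tau> * (u \<tau> * reg_deriv \<epsilon> \<tau>) \<partial>lborel)
      - ?k \<epsilon> * (\<integral>\<tau>. indicator {..<t} \<tau> * (u \<tau>)\<^sup>2 \<partial>lborel) + (\<integral>r. K (t - r) * (u r)\<^sup>2 \<partial>lborel)"
    unfolding Eeq using i1 i2 q2 by (simp add: q1)
  have E_nn: "0 \<le> ?E \<tau>" for \<tau> by (rule energy_eq(2)[OF \<epsilon>])
  have first_eq: "indicator {..<t} s * (?k (t - s + \<epsilon>) * (u s)\<^sup>2)
      = ?k \<epsilon> * (indicator {..<t} s * (u s)\<^sup>2) - K (t - s) * (u s)\<^sup>2" for s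
    by (auto simp: K_def indicator_def algebra_simps)
  have i3: "integrable lborel (\<lambda>s. indicator {..<t} s * (?k (t - s + \<epsilon>) * (u s)\<^sup>2))"
    unfolding first_eq using i1 iK by auto
  have FI: "(\<integral>s. indicator {..<t} s * (?k (t - s + \<epsilon>) * (u s)\<^sup>2) \<partial>lborel)
    = ?k \<epsilon> * (\<integral>\<tau>. indicator {..<t} \<tau> * (u \<tau>)\<^sup>2 \<partial>lborel) - (\<integral>r. K (t - r) * (u r)\<^sup>2 \<partial>lborel)"
    unfolding first_eq using i1 iK by simp
  have "(\<integral>\<^sup>+\<tau>. indicator {..<t} \<tau> * energy \<alpha> \<epsilon> u \<tau> \<partial>lborel) = (\<integral>\<^sup>+\<tau>. ennreal (indicator {..<t} \<tau> * ?E \<tau>) \<partial>lborel)"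
    by (intro nn_integral_cong) (auto simp: energy_eq(1)[OF \<epsilon>] indicator_def)
  also have "\<dots> = ennreal (\<integral>\<tau>. indicator {..<t} \<tau> * ?E \<tau> \<partial>lborel)"
    using iE E_nn by (intro nn_integral_eq_integral) auto
  finally have 1: "(\<integral>\<^sup>+\<tau>. indicator {..<t} \<tau> * energy \<alpha> \<epsilon> u \<tau> \<partial>lborel) = ennreal (\<integral>\<tau>. indicator {..<t} \<tau> * ?E \<tau> \<partial>lborel)" .
  have 2: "(\<integral>\<^sup>+s. ennreal (indicator {..<t} s * (?k (t - s + \<epsilon>) * (u s)\<^sup>2)) \<partial>lborel)
    = ennreal (\<integral>s. indicator {..<t} s * (?k (t - s + \<epsilon>) * (u s)\<^sup>2) \<partial>lborel)"
    using i3 k_nn by (intro nn_integral_eq_integral) auto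
  have nn1: "0 \<le> (\<integral>\<tau>. indicator {..<t} \<tau> * ?E \<tau> \<partial>lborel)"
    using E_nn by (intro integral_nonneg_AE) auto
  have nn2: "0 \<le> (\<integral>s. indicator {..<t} s * (?k (t - s + \<epsilon>) * (u s)\<^sup>2) \<partial>lborel)"
    using k_nn by (intro integral_nonneg_AE) auto
  show "(\<integral>\<^sup>+s. ennreal (indicator {..<t} s * (?k (t - s + \<epsilon>) * (u s)\<^sup>2)) \<partial>lborel)
      + (\<integral>\<^sup>+\<tau>. indicator {..<t} \<tau> * energy \<alpha> \<epsilon> u \<tau> \<partial>lborel)
    = ennreal (2 * (\<integral>\<tau>. indicator {..<t} \<tau> * u \<tau> * reg_deriv \<epsilon> \<tau> \<partial>lborel))"
    by (simp only: 1 2, subst ennreal_plus[OF nn2 nn1, symmetric], simp add: EI FI mult.assoc)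
  show "0 \<le> (\<integral>\<tau>. indicator {..<t} \<tau> * u \<tau> * reg_deriv \<epsilon> \<tau> \<partial>lborel)"
    using add_nonneg_nonneg[OF nn1 nn2] unfolding EI FI by (simp add: mult.assoc)
qed

text \<open>The right side converges to a finite limit, and both terms on the left inherit
  finiteness: neither the fractional integral of u^2 nor the dissipation is assumed finite.
  Monotonicity in \<epsilon> holds because both k and -k' decrease.\<close>

lemma energy_identity:
  assumes t: "t \<le> T"
  shows "(\<integral>\<^sup>+s. ennreal (rl_kernel (1 - \<alpha>) (t - s) * (u s)\<^sup>2) \<partial>lborel)
      + (\<integral>\<^sup>+\<tau>. indicator {..<t} \<tau> * energy \<alpha> 0 u \<tau> \<partial>lborel)
    = ennreal (2 * (\<integral>\<tau>. indicator {..<t} \<tau> * u \<tau> * v \<tau> \<partial>lborel))"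
proof -
  define e where "e n = inverse (real (Suc n))" for n
  have e: "e \<longlonglongrightarrow> 0" unfolding e_def by (rule LIMSEQ_inverse_real_of_nat)
  have e_pos: "0 < e n" for n by (simp add: e_def)
  have e_dec: "e n \<le> e m" if "m \<le> n" for m n using that by (simp add: e_def)
  have e_lim: "(\<lambda>n. x + e n) \<longlonglongrightarrow> x" for x using tendsto_add[OF tendsto_const e, of x] by simp
  let ?k = "rl_kernel (1 - \<alpha>)"
  have "(\<lambda>n. \<integral>\<^sup>+s. ennreal (indicator {..<t} s * (?k (t - s + e n) * (u s)\<^sup>2)) \<partial>lborel)
    \<longlonglongrightarrow> (\<integral>\<^sup>+s. ennreal (?k (t - s) * (u s)\<^sup>2) \<partial>lborel)"
  proof (rule nn_integral_LIMSEQ)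
    show "incseq (\<lambda>n s. ennreal (indicator {..<t} s * (?k (t - s + e n) * (u s)\<^sup>2)))"
    proof (intro incseq_SucI le_funI ennreal_leI)
      fix n s
      show "indicator {..<t} s * (?k (t - s + e n) * (u s)\<^sup>2)
        \<le> indicator {..<t} s * (?k (t - s + e (Suc n)) * (u s)\<^sup>2)"
      proof (cases "s < t")
        case True
        have "?k (t - s + e n) \<le> ?k (t - s + e (Suc n))"
          using True e_pos[of "Suc n"] e_dec[of n "Suc n"] by (intro rl_kernel_antimono \<alpha>) auto
        then show ?thesis by (auto intro!: mult_left_mono mult_right_mono)
      qed simp
    qed
    fix s
    have "(\<lambda>n. indicator {..<t} s * (?k (t - s + e n) * (u s)\<^sup>2)) \<longlonglongrightarrow> ?k (t - s) * (u s)\<^sup>2"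
    proof (cases "s < t")
      case True
      have "(\<lambda>n. (t - s + e n) powr (1 - \<alpha> - 1) / Gamma (1 - \<alpha>)) \<longlonglongrightarrow> (t - s) powr (1 - \<alpha> - 1) / Gamma (1 - \<alpha>)"
        using True \<alpha> by (intro tendsto_divide tendsto_powr e_lim tendsto_const) (auto simp: Gamma_real_nonzero)
      moreover have "0 < t - s + e n" for n using True e_pos[of n] by simp
      ultimately have "(\<lambda>n. ?k (t - s + e n)) \<longlonglongrightarrow> ?k (t - s)"
        using True by (simp add: rl_kernel_def)
      with True show ?thesis by (auto intro!: tendsto_mult)
    qed (simp add: rl_kernel_def)
    then show "(\<lambda>n. ennreal (indicator {..<t} s * (?k (t - s + e n) * (u s)\<^sup>2))) \<longlonglongrightarrow> ennreal (?k (t - s) * (u s)\<^sup>2)"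
      by (rule tendsto_ennrealI)
  qed measurable
  moreover have energy_mono: "energy \<alpha> (e n) u \<tau> \<le> energy \<alpha> (e (Suc n)) u \<tau>" for n \<tau>
    unfolding energy_def
  proof (intro nn_integral_mono ennreal_leI mult_right_mono)
    fix s
    show "shifted_kernel_deriv \<alpha> (e n) (\<tau> - s) \<le> shifted_kernel_deriv \<alpha> (e (Suc n)) (\<tau> - s)"
      using \<alpha> e_pos[of "Suc n"] e_dec[of n "Suc n"]
      by (auto simp: shifted_kernel_deriv_def Gamma_real_pos intro!: divide_right_mono mult_left_mono powr_mono2')
  qed simp
  \<comment> \<open>Monotone convergence is used twice for the energy: here in s for fixed \<tau>,
    afterwards in \<tau>.\<close>
  have energy_lim: "(\<lambda>n. energy \<alpha> (e n) u \<tau>) \<longlonglongrightarrow> energy \<alpha> 0 u \<tau>" for \<tau>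
    unfolding energy_def
  proof (rule nn_integral_LIMSEQ)
    show "incseq (\<lambda>n s. ennreal (shifted_kernel_deriv \<alpha> (e n) (\<tau> - s) * (u \<tau> - u s)\<^sup>2))"
    proof (intro incseq_SucI le_funI ennreal_leI mult_right_mono)
      fix n s
      show "shifted_kernel_deriv \<alpha> (e n) (\<tau> - s) \<le> shifted_kernel_deriv \<alpha> (e (Suc n)) (\<tau> - s)"
        using \<alpha> e_pos[of "Suc n"] e_dec[of n "Suc n"]
        by (auto simp: shifted_kernel_deriv_def Gamma_real_pos intro!: divide_right_mono mult_left_mono powr_mono2')
    qed simp
    fix s
    have "(\<lambda>n. shifted_kernel_deriv \<alpha> (e n) (\<tau> - s)) \<longlonglongrightarrow> shifted_kernel_deriv \<alpha> 0 (\<tau> - s)"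
    proof (cases "s < \<tau>")
      case True
      have "(\<lambda>n. \<alpha> * (\<tau> - s + e n) powr (- \<alpha> - 1) / Gamma (1 - \<alpha>)) \<longlonglongrightarrow> \<alpha> * (\<tau> - s) powr (- \<alpha> - 1) / Gamma (1 - \<alpha>)"
        using True \<alpha> by (intro tendsto_divide tendsto_mult tendsto_powr e_lim tendsto_const) (auto simp: Gamma_real_nonzero)
      then show ?thesis using True by (simp add: shifted_kernel_deriv_def)
    qed (simp add: shifted_kernel_deriv_def)
    then show "(\<lambda>n. ennreal (shifted_kernel_deriv \<alpha> (e n) (\<tau> - s) * (u \<tau> - u s)\<^sup>2))
      \<longlonglongrightarrow> ennreal (shifted_kernel_deriv \<alpha> 0 (\<tau> - s) * (u \<tau> - u s)\<^sup>2)"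
      by (intro tendsto_ennrealI tendsto_mult tendsto_const)
  qed measurable
  have "(\<lambda>n. \<integral>\<^sup>+\<tau>. indicator {..<t} \<tau> * energy \<alpha> (e n) u \<tau> \<partial>lborel) \<longlonglongrightarrow> (\<integral>\<^sup>+\<tau>. indicator {..<t} \<tau> * energy \<alpha> 0 u \<tau> \<partial>lborel)"
  proof (rule nn_integral_LIMSEQ)
    show "incseq (\<lambda>n \<tau>. indicator {..<t} \<tau> * energy \<alpha> (e n) u \<tau>)"
      by (intro incseq_SucI le_funI mult_left_mono energy_mono) simp
    show "(\<lambda>n. indicator {..<t} \<tau> * energy \<alpha> (e n) u \<tau>) \<longlonglongrightarrow> indicator {..<t} \<tau> * energy \<alpha> 0 u \<tau>" for \<tau>
      using energy_lim[of \<tau>] by (cases "\<tau> < t") auto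
  qed measurable
  ultimately have "(\<lambda>n. (\<integral>\<^sup>+s. ennreal (indicator {..<t} s * (?k (t - s + e n) * (u s)\<^sup>2)) \<partial>lborel)
      + (\<integral>\<^sup>+\<tau>. indicator {..<t} \<tau> * energy \<alpha> (e n) u \<tau> \<partial>lborel))
    \<longlonglongrightarrow> (\<integral>\<^sup>+s. ennreal (?k (t - s) * (u s)\<^sup>2) \<partial>lborel) + (\<integral>\<^sup>+\<tau>. indicator {..<t} \<tau> * energy \<alpha> 0 u \<tau> \<partial>lborel)"
    by (rule tendsto_add)
  moreover have "(\<lambda>n. ennreal (2 * (\<integral>\<tau>. indicator {..<t} \<tau> * u \<tau> * reg_deriv (e n) \<tau> \<partial>lborel)))
    \<longlonglongrightarrow> ennreal (2 * (\<integral>\<tau>. indicator {..<t} \<tau> * u \<tau> * v \<tau> \<partial>lborel))"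
    by (intro tendsto_ennrealI tendsto_mult tendsto_const integral_u_reg_deriv_tendsto e e_pos t)
  ultimately show ?thesis
    unfolding regularized_energy_identity(1)[OF e_pos] by (rule LIMSEQ_unique)
qed

text \<open>The energy identity is stated in \<open>ennreal\<close>, where a negative right-hand
  side would be sent to 0. Nonnegativity, inherited from the regularised integrals, allows it to be
  read in the reals.\<close>

lemma integral_u_v_nonneg:
  assumes t: "t \<le> T"
  shows "0 \<le> (\<integral>\<tau>. indicator {..<t} \<tau> * u \<tau> * v \<tau> \<partial>lborel)"
proof (rule LIMSEQ_le_const)
  show "(\<lambda>n. \<integral>\<tau>. indicator {..<t} \<tau> * u \<tau> * reg_deriv (inverse (real (Suc n))) \<tau> \<partial>lborel)
    \<longlonglongrightarrow> (\<integral>\<tau>. indicator {..<t} \<tau> * u \<tau> * v \<tau> \<partial>lborel)"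
    by (rule integral_u_reg_deriv_tendsto[OF LIMSEQ_inverse_real_of_nat _ t]) simp
  show "\<exists>N. \<forall>n\<ge>N. 0 \<le> (\<integral>\<tau>. indicator {..<t} \<tau> * u \<tau> * reg_deriv (inverse (real (Suc n))) \<tau> \<partial>lborel)"
    by (intro exI allI impI regularized_energy_identity(2)) simp
qed

end

section \<open>Test functions and the du Bois-Reymond lemma\<close>

text \<open>The power of 1 / x makes the family closed under differentiation up to linear
  combinations, so smoothness at 0 reduces to one differentiation step.\<close>

definition flat_exp :: "nat \<Rightarrow> real \<Rightarrow> real" where
  "flat_exp n x = (if 0 < x then (1 / x) ^ n * exp (- (1 / x)) else 0)"

lemma flat_exp_tendsto_0: "((\<lambda>x. flat_exp n x) \<longlongrightarrow> 0) (at_right 0)"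
proof -
  have "((\<lambda>x::real. inverse x ^ n / exp (inverse x)) \<longlongrightarrow> 0) (at_right 0)"
    by (rule filterlim_compose[OF tendsto_power_div_exp_0 filterlim_inverse_at_top_right])
  then show ?thesis
    by (rule Lim_transform_eventually)
      (auto simp: eventually_at_right_field flat_exp_def exp_minus field_simps intro!: exI[of _ 1])
qed

lemma DERIV_flat_exp:
  "(flat_exp n has_real_derivative (flat_exp (n + 2) x - real n * flat_exp (n + 1) x)) (at x)"
proof -
  consider "x < 0" | "0 < x" | "x = 0" by linarith
  then show ?thesis
  proof cases
    case 1
    have "((\<lambda>_. 0) has_real_derivative 0) (at x)" by simp
    then have "(flat_exp n has_real_derivative 0) (at x)"
      by (rule DERIV_cong_ev[THEN iffD1, rotated -1])
        (use 1 in \<open>auto simp: flat_exp_def intro!: eventually_mono[OF eventually_nhds_in_open[of "{..<0}"]]\<close>)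
    with 1 show ?thesis by (simp add: flat_exp_def)
  next
    case 2
    have h: "((\<lambda>x. 1 / x) has_real_derivative - (1 / x\<^sup>2)) (at x)"
      using 2 by (auto intro!: derivative_eq_intros simp: power2_eq_square)
    have "((\<lambda>x. (1 / x) ^ n * exp (- (1 / x))) has_real_derivative
      (1 / x) ^ n * (exp (- (1 / x)) * (- (- (1 / x\<^sup>2)))) + (real n * (- (1 / x\<^sup>2) * (1 / x) ^ (n - Suc 0))) * exp (- (1 / x))) (at x)"
      by (rule DERIV_mult'[OF DERIV_power[OF h] DERIV_fun_exp[OF DERIV_minus[OF h]]])
    also have "real n * (- (1 / x\<^sup>2) * (1 / x) ^ (n - Suc 0)) = - (real n * (1 / x) ^ (n + 1))"
      by (cases n) (simp_all add: power2_eq_square)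
    also have "(1 / x) ^ n * (exp (- (1 / x)) * (- (- (1 / x\<^sup>2)))) + - (real n * (1 / x) ^ (n + 1)) * exp (- (1 / x))
      = flat_exp (n + 2) x - real n * flat_exp (n + 1) x"
      using 2 by (simp add: flat_exp_def power2_eq_square)
    finally have "((\<lambda>x. (1 / x) ^ n * exp (- (1 / x))) has_real_derivative
        (flat_exp (n + 2) x - real n * flat_exp (n + 1) x)) (at x)" .
    then show ?thesis
      by (rule DERIV_cong_ev[THEN iffD1, rotated -1])
        (use 2 in \<open>auto simp: flat_exp_def intro!: eventually_mono[OF eventually_nhds_in_open[of "{0<..}"]]\<close>)
  next
    case 3
    have "((\<lambda>h. (flat_exp n (0 + h) - flat_exp n 0) / h) \<longlongrightarrow> 0) (at 0)"
    proof (rule filterlim_split_at)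
      show "((\<lambda>h. (flat_exp n (0 + h) - flat_exp n 0) / h) \<longlongrightarrow> 0) (at_left 0)"
        by (rule tendsto_eventually) (auto simp: eventually_at_left_field flat_exp_def intro!: exI[of _ "-1"])
      \<comment> \<open>To the right of 0 the difference quotient of \<open>flat_exp n\<close> is
        exactly \<open>flat_exp (n + 1)\<close>.\<close>
      show "((\<lambda>h. (flat_exp n (0 + h) - flat_exp n 0) / h) \<longlongrightarrow> 0) (at_right 0)"
        by (rule Lim_transform_eventually[OF flat_exp_tendsto_0[of "n + 1"]])
          (auto simp: eventually_at_right_field flat_exp_def intro!: exI[of _ 1])
    qed
    then have "(flat_exp n has_real_derivative 0) (at 0)"
      unfolding DERIV_def by simp
    with 3 show ?thesis by (simp add: flat_exp_def)
  qed
qed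

text \<open>\<open>test_fun\<close> asks for all iterated derivatives. A class closed under sums,
  products and multiples contains the derivative of each of its members once it does so for its
  generators, and induction on the order then needs no formula for higher derivatives.\<close>

inductive flat_algebra :: "(real \<Rightarrow> real) \<Rightarrow> bool" where
  base: "flat_algebra (\<lambda>t. flat_exp n (c * t + d))"
| scale: "flat_algebra f \<Longrightarrow> flat_algebra (\<lambda>t. c * f t)"
| add: "flat_algebra f \<Longrightarrow> flat_algebra g \<Longrightarrow> flat_algebra (\<lambda>t. f t + g t)"
| mult: "flat_algebra f \<Longrightarrow> flat_algebra g \<Longrightarrow> flat_algebra (\<lambda>t. f t * g t)"

lemma flat_algebra_has_derivative:
  "flat_algebra f \<Longrightarrow> \<exists>f'. flat_algebra f' \<and> (\<forall>t. (f has_real_derivative f' t) (at t))"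
proof (induction rule: flat_algebra.induct)
  case (base n c d)
  let ?f' = "\<lambda>t. c * (flat_exp (n + 2) (c * t + d) + (- real n) * flat_exp (n + 1) (c * t + d))"
  have "flat_algebra ?f'"
    by (intro flat_algebra.intros)
  moreover have "((\<lambda>t. flat_exp n (c * t + d)) has_real_derivative ?f' t) (at t)" for t
  proof -
    have "((\<lambda>t. c * t + d) has_real_derivative c) (at t)"
      by (auto intro!: derivative_eq_intros)
    from DERIV_chain2[OF DERIV_flat_exp this] show ?thesis
      by (simp add: algebra_simps)
  qed
  ultimately show ?case by blast
next
  case (scale f c)
  then obtain f' where "flat_algebra f'" "\<forall>t. (f has_real_derivative f' t) (at t)" by auto
  then show ?case
    by (intro exI[of _ "\<lambda>t. c * f' t"]) (auto intro: flat_algebra.intros DERIV_cmult)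
next
  case (add f g)
  then obtain f' g' where "flat_algebra f'" "\<forall>t. (f has_real_derivative f' t) (at t)"
    "flat_algebra g'" "\<forall>t. (g has_real_derivative g' t) (at t)" by auto
  then show ?case
    by (intro exI[of _ "\<lambda>t. f' t + g' t"]) (auto intro: flat_algebra.intros DERIV_add)
next
  case (mult f g)
  then obtain f' g' where "flat_algebra f'" "\<forall>t. (f has_real_derivative f' t) (at t)"
    "flat_algebra g'" "\<forall>t. (g has_real_derivative g' t) (at t)" by auto
  with mult.hyps show ?case
    by (intro exI[of _ "\<lambda>t. f' t * g t + g' t * f t"]) (auto intro!: flat_algebra.intros DERIV_mult)
qed

lemma flat_algebra_deriv:
  assumes "flat_algebra f"
  shows "flat_algebra (deriv f)" "(f has_real_derivative deriv f t) (at t)"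
proof -
  obtain f' where f': "flat_algebra f'" "\<And>t. (f has_real_derivative f' t) (at t)"
    using flat_algebra_has_derivative[OF assms] by auto
  then have "deriv f = f'" by (auto intro!: ext DERIV_imp_deriv)
  with f' show "flat_algebra (deriv f)" "(f has_real_derivative deriv f t) (at t)" by auto
qed

lemma flat_algebra_smooth:
  "flat_algebra f \<Longrightarrow> ((deriv ^^ k) f) differentiable (at t)"
proof (induction k arbitrary: f)
  case 0
  then show ?case using flat_algebra_deriv(2) real_differentiable_def by auto
next
  case (Suc k)
  then show ?case using flat_algebra_deriv(1) by (simp add: funpow_Suc_right del: funpow.simps)
qed

lemma flat_algebra_continuous: "flat_algebra f \<Longrightarrow> isCont f t"
  using flat_algebra_deriv(2) DERIV_isCont by blast

lemma flat_algebra_measurable: "flat_algebra f \<Longrightarrow> f \<in> borel_measurable borel"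
  by (intro borel_measurable_continuous_onI continuous_at_imp_continuous_on) (auto intro: flat_algebra_continuous)

text \<open>The exponents are -1 / ((n + 1) (t - a)) and -1 / ((n + 1) (b - t)); as n grows they
  tend to 0, so the bumps approach the indicator of (a, b) while remaining below it.\<close>

definition bump :: "real \<Rightarrow> real \<Rightarrow> nat \<Rightarrow> real \<Rightarrow> real" where
  "bump a b n t = flat_exp 0 (real (Suc n) * (t - a)) * flat_exp 0 (real (Suc n) * (b - t))"

lemma bump_flat_algebra: "flat_algebra (bump a b n)"
proof -
  have "flat_algebra (\<lambda>t. flat_exp 0 (real (Suc n) * t + (- real (Suc n) * a)) *
      flat_exp 0 ((- real (Suc n)) * t + real (Suc n) * b))"
    by (intro flat_algebra.intros)
  moreover have "(\<lambda>t. flat_exp 0 (real (Suc n) * t + (- real (Suc n) * a)) *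
      flat_exp 0 ((- real (Suc n)) * t + real (Suc n) * b)) = bump a b n"
    by (auto simp: bump_def algebra_simps)
  ultimately show ?thesis by simp
qed

lemma bump_measurable [measurable]: "bump a b n \<in> borel_measurable borel"
  by (rule flat_algebra_measurable[OF bump_flat_algebra])

lemma bump_bounds:
  shows "0 \<le> bump a b n t" "bump a b n t \<le> indicator {a<..<b} t"
proof -
  have 1: "0 \<le> flat_exp 0 x" "flat_exp 0 x \<le> 1" for x
    by (auto simp: flat_exp_def)
  show "0 \<le> bump a b n t" by (simp add: bump_def 1)
  show "bump a b n t \<le> indicator {a<..<b} t"
  proof (cases "t \<in> {a<..<b}")
    case True
    then show ?thesis by (simp add: bump_def mult_le_one 1)
  next
    case False
    then have "t \<le> a \<or> b \<le> t" by auto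
    then have "bump a b n t = 0"
      by (auto simp: bump_def flat_exp_def zero_less_mult_iff)
    then show ?thesis by simp
  qed
qed

lemma bump_tendsto: "(\<lambda>n. bump a b n t) \<longlonglongrightarrow> indicator {a<..<b} t"
proof (cases "t \<in> {a<..<b}")
  case True
  have 1: "(\<lambda>n. flat_exp 0 (real (Suc n) * x)) \<longlonglongrightarrow> 1" if "0 < x" for x
  proof -
    have "(\<lambda>n. exp (- (inverse (real (Suc n)) * (1 / x)))) \<longlonglongrightarrow> exp (- (0 * (1 / x)))"
      by (intro tendsto_intros LIMSEQ_inverse_real_of_nat)
    moreover have "flat_exp 0 (real (Suc n) * x) = exp (- (inverse (real (Suc n)) * (1 / x)))" for n
      using that by (simp add: flat_exp_def zero_less_mult_iff divide_inverse)
    ultimately show ?thesis by simp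
  qed
  from tendsto_mult[OF 1[of "t - a"] 1[of "b - t"]] True show ?thesis
    by (simp add: bump_def)
next
  case False
  then have "bump a b n t = 0" for n
    using bump_bounds[of a b n t] by simp
  with False show ?thesis by simp
qed

lemma bump_abs_le_1: "\<bar>bump a b n t\<bar> \<le> 1"
  using bump_bounds[of a b n t] by (cases "t \<in> {a<..<b}") auto

lemma indicator_Ioo_integrable: "integrable lborel (indicator {a<..<b} :: real \<Rightarrow> real)"
  by (cases "a \<le> b") (auto intro!: integrable_real_indicator)

lemma bump_integrable: "integrable lborel (bump a b n)"
  by (rule Bochner_Integration.integrable_bound[OF indicator_Ioo_integrable[of a b]])
    (use bump_bounds in auto)

lemma bump_integral_pos:
  assumes "a < b"
  shows "0 < (\<integral>t. bump a b n t \<partial>lborel)"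
proof -
  have "(\<integral>t. bump a b n t \<partial>lborel) \<noteq> 0"
  proof
    assume "(\<integral>t. bump a b n t \<partial>lborel) = 0"
    then have ae: "AE t in lborel. bump a b n t = 0"
      using integral_nonneg_eq_0_iff_AE[OF bump_integrable, of a b n] bump_bounds by auto
    have "bump a b n t \<noteq> 0" if "t \<in> {a<..<b}" for t
      using that by (auto simp: bump_def flat_exp_def zero_less_mult_iff)
    then have "AE t in lborel. t \<notin> {a<..<b}"
      using ae by (auto elim!: eventually_mono)
    then have "emeasure lborel {a<..<b} = 0"
      by (subst (asm) AE_iff_null_sets[symmetric]) auto
    then show False using assms by (simp add: emeasure_lborel_Ioo)
  qed
  moreover have "0 \<le> (\<integral>t. bump a b n t \<partial>lborel)"
    using bump_bounds by (intro integral_nonneg_AE) auto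
  ultimately show ?thesis by linarith
qed

lemma integral_times_bump_tendsto:
  fixes W :: "real \<Rightarrow> real"
  assumes W: "integrable lborel W"
  shows "(\<lambda>n. \<integral>t. W t * bump a b n t \<partial>lborel) \<longlonglongrightarrow> (\<integral>t. W t * indicator {a<..<b} t \<partial>lborel)"
proof (rule integral_dominated_convergence[where w="\<lambda>t. \<bar>W t\<bar>"])
  show "AE t in lborel. (\<lambda>n. W t * bump a b n t) \<longlonglongrightarrow> W t * indicator {a<..<b} t"
    by (intro AE_I2 tendsto_mult tendsto_const bump_tendsto)
  show "AE t in lborel. norm (W t * bump a b n t) \<le> \<bar>W t\<bar>" for n
  proof (intro AE_I2)
    fix t
    show "norm (W t * bump a b n t) \<le> \<bar>W t\<bar>"
      by (simp add: abs_mult mult_left_le bump_abs_le_1)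
  qed
qed (use W in auto)

lemma bump_integral_tendsto:
  assumes "a < b"
  shows "(\<lambda>n. \<integral>t. bump a b n t \<partial>lborel) \<longlonglongrightarrow> b - a"
proof -
  have "(\<lambda>n. \<integral>t. bump a b n t \<partial>lborel) \<longlonglongrightarrow> (\<integral>t. indicator {a<..<b} t \<partial>lborel)"
  proof (rule integral_dominated_convergence[where w="indicator {a<..<b}"])
    show "AE t in lborel. norm (bump a b n t) \<le> indicator {a<..<b} t" for n
      using bump_bounds by (auto simp: abs_of_nonneg)
  qed (use bump_tendsto indicator_Ioo_integrable in auto)
  then show ?thesis using assms by simp
qed

text \<open>Normalised to integral one, so that the difference of two such functions has mean zero
  and is the derivative of a test function.\<close>

definition unit_bump :: "real \<Rightarrow> real \<Rightarrow> nat \<Rightarrow> real \<Rightarrow> real" where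
  "unit_bump a b n t = inverse (\<integral>s. bump a b n s \<partial>lborel) * bump a b n t"

lemma unit_bump_flat_algebra: "flat_algebra (unit_bump a b n)"
  unfolding unit_bump_def by (intro flat_algebra.scale bump_flat_algebra)

lemma unit_bump_measurable [measurable]: "unit_bump a b n \<in> borel_measurable borel"
  by (rule flat_algebra_measurable[OF unit_bump_flat_algebra])

lemma unit_bump_integral:
  assumes "a < b"
  shows "integrable lborel (unit_bump a b n)" "(\<integral>t. unit_bump a b n t \<partial>lborel) = 1"
  unfolding unit_bump_def using bump_integral_pos[OF assms, of n] bump_integrable by auto

lemma unit_bump_support: "t \<notin> {a<..<b} \<Longrightarrow> unit_bump a b n t = 0"
  using bump_bounds[of a b n t] by (simp add: unit_bump_def)

lemma integrable_times_unit_bump: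
  fixes W :: "real \<Rightarrow> real"
  assumes W: "integrable lborel W"
  shows "integrable lborel (\<lambda>t. W t * unit_bump a b n t)"
proof -
  have "integrable lborel (\<lambda>t. W t * bump a b n t)"
  proof (rule Bochner_Integration.integrable_bound[OF W])
    show "AE t in lborel. norm (W t * bump a b n t) \<le> norm (W t)"
    proof (intro AE_I2)
      fix t
      show "norm (W t * bump a b n t) \<le> norm (W t)"
        by (simp add: abs_mult mult_left_le bump_abs_le_1)
    qed
  qed (use W in auto)
  from integrable_mult_right[OF this, of "inverse (\<integral>s. bump a b n s \<partial>lborel)"]
  show ?thesis unfolding unit_bump_def mult.left_commute[of "W _"] .
qed

lemma integral_times_unit_bump_tendsto:
  fixes W :: "real \<Rightarrow> real"
  assumes W: "integrable lborel W" and "a < b"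
  shows "(\<lambda>n. \<integral>t. W t * unit_bump a b n t \<partial>lborel) \<longlonglongrightarrow> (\<integral>t. W t * indicator {a<..<b} t \<partial>lborel) / (b - a)"
proof -
  have "(\<integral>t. W t * unit_bump a b n t \<partial>lborel) = (\<integral>t. W t * bump a b n t \<partial>lborel) / (\<integral>s. bump a b n s \<partial>lborel)" for n
  proof -
    have "W t * unit_bump a b n t = inverse (\<integral>s. bump a b n s \<partial>lborel) * (W t * bump a b n t)" for t
      by (simp add: unit_bump_def)
    then have "(\<integral>t. W t * unit_bump a b n t \<partial>lborel)
      = (\<integral>t. inverse (\<integral>s. bump a b n s \<partial>lborel) * (W t * bump a b n t) \<partial>lborel)"
      by (intro Bochner_Integration.integral_cong) auto
    then show ?thesis by (simp add: divide_inverse)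
  qed
  then show ?thesis
    using assms by (auto intro!: tendsto_divide integral_times_bump_tendsto bump_integral_tendsto)
qed

text \<open>Mean zero makes the primitive that vanishes at c vanish again to the right of the
  support. Its higher derivatives are those of \<psi>.\<close>

lemma antiderivative_test_fun:
  assumes \<psi>: "flat_algebra \<psi>" and supp: "\<And>t. t \<notin> {c..d} \<Longrightarrow> \<psi> t = 0"
    and cd: "a < c" "c \<le> d" "d < b" and zero: "(\<integral>t. \<psi> t \<partial>lborel) = 0"
  shows "\<exists>\<phi>. test_fun a b \<phi> \<and> deriv \<phi> = \<psi>"
proof -
  obtain F where F: "\<And>t. (F has_vector_derivative \<psi> t) (at t)"
    using einterval_antiderivative[of "-\<infinity>" "\<infinity>" \<psi>] flat_algebra_continuous[OF \<psi>] by auto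
  have FTC: "F y - F x = (\<integral>t. indicator {x..y} t *\<^sub>R \<psi> t \<partial>lborel)" if "x \<le> y" for x y
    using that
    by (rule integral_FTC_Icc[symmetric, OF _ has_vector_derivative_at_within[OF F]])
      (intro continuous_at_imp_continuous_on ballI flat_algebra_continuous[OF \<psi>])
  define \<phi> where "\<phi> t = F t - F c" for t
  have D: "(\<phi> has_real_derivative \<psi> t) (at t)" for t
    unfolding \<phi>_def has_real_derivative_iff_has_vector_derivative
    by (auto intro!: derivative_eq_intros F)
  then have deriv: "deriv \<phi> = \<psi>" by (auto intro!: ext DERIV_imp_deriv)
  have "\<phi> t = 0" if "t \<notin> {c..d}" for t
  proof (cases "t < c")
    case True
    have "F c - F t = (\<integral>s. 0 \<partial>(lborel :: real measure))"
      unfolding FTC[OF less_imp_le[OF True]]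
    proof (rule integral_cong_AE)
      show "AE s in lborel. indicator {t..c} s *\<^sub>R \<psi> s = 0"
        using AE_lborel_singleton[of c]
        by eventually_elim (use supp in \<open>auto simp: indicator_def\<close>)
    qed (use flat_algebra_measurable[OF \<psi>] in auto)
    then show ?thesis by (simp add: \<phi>_def)
  next
    case False
    with that have t: "d < t" by auto
    have "F t - F c = (\<integral>s. \<psi> s \<partial>lborel)"
    proof -
      have "indicator {c..t} s *\<^sub>R \<psi> s = \<psi> s" for s
        using supp[of s] t by (cases "s \<in> {c..d}") auto
      then have "(\<integral>s. indicator {c..t} s *\<^sub>R \<psi> s \<partial>lborel) = (\<integral>s. \<psi> s \<partial>lborel)"
        by (simp only:)
      moreover have "c \<le> t" using cd t by simp
      ultimately show ?thesis using FTC by (simp only:)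
    qed
    then show ?thesis by (simp add: \<phi>_def zero)
  qed
  moreover have "((deriv ^^ k) \<phi>) differentiable (at t)" for k t
  proof (cases k)
    case 0
    then show ?thesis using D by (auto simp: real_differentiable_def)
  next
    case (Suc k')
    then show ?thesis using flat_algebra_smooth[OF \<psi>] by (simp add: funpow_Suc_right deriv del: funpow.simps)
  qed
  ultimately have "test_fun a b \<phi>" unfolding test_fun_def using cd by blast
  with deriv show ?thesis by blast
qed

lemma unit_bump_diff_test_fun:
  assumes "0 < a" "a < b" "b < T" "0 < a'" "a' < b'" "b' < T"
  shows "\<exists>\<phi>. test_fun 0 T \<phi> \<and> deriv \<phi> = (\<lambda>t. unit_bump a b n t - unit_bump a' b' n t)"
proof -
  have "flat_algebra (\<lambda>t. unit_bump a b n t + (-1) * unit_bump a' b' n t)"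
    by (intro flat_algebra.add flat_algebra.scale unit_bump_flat_algebra)
  then have "flat_algebra (\<lambda>t. unit_bump a b n t - unit_bump a' b' n t)" by simp
  then show ?thesis
  proof (rule antiderivative_test_fun[where c="min a a'" and d="max b b'"])
    show "unit_bump a b n t - unit_bump a' b' n t = 0" if "t \<notin> {min a a'..max b b'}" for t
    proof -
      have "t \<notin> {a<..<b}" "t \<notin> {a'<..<b'}" using that by auto
      then show ?thesis by (simp add: unit_bump_support)
    qed
  qed (use assms in \<open>auto simp: unit_bump_integral\<close>)
qed

lemma rational_sequence_below:
  fixes x :: real
  assumes "0 < x"
  shows "\<exists>r :: nat \<Rightarrow> rat. (\<forall>n. 0 < r n \<and> of_rat (r n) < x) \<and> (\<lambda>n. of_rat (r n)) \<longlonglongrightarrow> x"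
proof -
  have "\<exists>q. max 0 (x - inverse (real (Suc n))) < of_rat q \<and> of_rat q < x" for n
    using assms by (intro of_rat_dense) auto
  then obtain r where r: "\<And>n. max 0 (x - inverse (real (Suc n))) < of_rat (r n)" "\<And>n. of_rat (r n) < x"
    by metis
  have "(\<lambda>n. of_rat (r n)) \<longlonglongrightarrow> x"
  proof (rule tendsto_sandwich[OF _ _ _ tendsto_const])
    show "(\<lambda>n. x - inverse (real (Suc n))) \<longlonglongrightarrow> x"
      using tendsto_diff[OF tendsto_const LIMSEQ_inverse_real_of_nat, of x] by simp
  qed (use r in \<open>auto intro!: always_eventually less_imp_le\<close>)
  moreover have "0 < r n" for n
    using r(1)[of n] by (simp add: zero_less_of_rat_iff[where 'a=real, symmetric] del: zero_less_of_rat_iff)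
  ultimately show ?thesis using r by blast
qed

text \<open>Only countably many relations are assumed, so that a common null set can be found for
  them later. Letting n grow turns bumps into averages: the mean of W over each interval with
  rational endpoints relative to T equals the mean over a fixed reference interval, the middle third
  of (0, T), whose length T / 3 gives the factor 3 / T. Rational endpoints then exhaust all initial
  intervals.\<close>

lemma du_Bois_Reymond:
  fixes W :: "real \<Rightarrow> real"
  assumes W: "integrable lborel W" and T: "0 < T"
    and eq: "\<And>p q n. 0 < p \<Longrightarrow> p < q \<Longrightarrow> q < 1 \<Longrightarrow>
      (\<integral>t. W t * (unit_bump (T * of_rat p) (T * of_rat q) n t - unit_bump (T / 3) (2 * T / 3) n t) \<partial>lborel) = 0"
  shows "AE t in lborel. t \<in> {0<..<T} \<longrightarrow> W t = 3 / T * (\<integral>t. W t * indicator {T / 3<..<2 * T / 3} t \<partial>lborel)"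
proof -
  define c where "c = 3 / T * (\<integral>t. W t * indicator {T / 3<..<2 * T / 3} t \<partial>lborel)"
  define w where "w t = indicator {0<..<T} t * (W t - c)" for t
  have [measurable]: "W \<in> borel_measurable borel" using W by auto
  note i0 = indicator_Ioo_integrable
  have "integrable lborel (\<lambda>t. W t * indicator {0<..<T} t - c * indicator {0<..<T} t)"
    using W i0 by (intro Bochner_Integration.integrable_diff integrable_real_mult_indicator integrable_mult_right) auto
  then have w: "integrable lborel w"
    by (rule Bochner_Integration.integrable_cong[THEN iffD1, rotated -1]) (auto simp: w_def indicator_def)
  have avg: "(\<integral>t. W t * indicator {T * of_rat p<..<T * of_rat q} t \<partial>lborel) = c * (T * of_rat q - T * of_rat p)"
    if pq: "0 < p" "p < q" "q < 1" for p q :: rat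
  proof -
    have lt: "T * of_rat p < T * (of_rat q :: real)" using pq T by (simp add: of_rat_less)
    have lt': "T / 3 < 2 * T / 3" using T by simp
    have "(\<lambda>n. (\<integral>t. W t * unit_bump (T * of_rat p) (T * of_rat q) n t \<partial>lborel)
        - (\<integral>t. W t * unit_bump (T / 3) (2 * T / 3) n t \<partial>lborel)) \<longlonglongrightarrow>
      (\<integral>t. W t * indicator {T * of_rat p<..<T * of_rat q} t \<partial>lborel) / (T * of_rat q - T * of_rat p)
        - (\<integral>t. W t * indicator {T / 3<..<2 * T / 3} t \<partial>lborel) / (2 * T / 3 - T / 3)"
      by (intro tendsto_diff integral_times_unit_bump_tendsto W lt lt')
    moreover have "(\<integral>t. W t * unit_bump (T * of_rat p) (T * of_rat q) n t \<partial>lborel)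
        - (\<integral>t. W t * unit_bump (T / 3) (2 * T / 3) n t \<partial>lborel) = 0" for n
      using eq[OF pq, of n] integrable_times_unit_bump[OF W] by (simp add: right_diff_distrib)
    ultimately have "(\<integral>t. W t * indicator {T * of_rat p<..<T * of_rat q} t \<partial>lborel) / (T * of_rat q - T * of_rat p) = c"
      using T by (simp add: LIMSEQ_const_iff c_def)
    moreover have "T * of_rat q - T * of_rat p \<noteq> (0 :: real)" using lt by auto
    ultimately show ?thesis by (metis nonzero_divide_eq_eq)
  qed
  have w_zero: "(\<integral>t. w t * indicator {T * of_rat p<..<T * of_rat q} t \<partial>lborel) = 0"
    if pq: "0 < p" "p < q" "q < 1" for p q :: rat
  proof -
    have lt: "T * of_rat p < T * (of_rat q :: real)" using pq T by (simp add: of_rat_less)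
    have "0 < T * of_rat p" "T * of_rat q < T" using pq T by simp_all
    then have "(\<integral>t. w t * indicator {T * of_rat p<..<T * of_rat q} t \<partial>lborel)
      = (\<integral>t. W t * indicator {T * of_rat p<..<T * of_rat q} t - c * indicator {T * of_rat p<..<T * of_rat q} t \<partial>lborel)"
      by (intro Bochner_Integration.integral_cong) (auto simp: w_def indicator_def)
    also have "\<dots> = (\<integral>t. W t * indicator {T * of_rat p<..<T * of_rat q} t \<partial>lborel) - c * (T * of_rat q - T * of_rat p)"
      using lt W i0 by (subst Bochner_Integration.integral_diff) (auto intro!: integrable_real_mult_indicator)
    finally show ?thesis using avg[OF pq] by simp
  qed
  have "AE t in lborel. w t = 0"
  proof (rule AE_zero_if_initial_integrals_zero[OF w])
    fix t
    show "(\<integral>s. indicator {..t} s * w s \<partial>lborel) = 0"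
    proof (cases "0 < t")
      case False
      then have "indicator {..t} s * w s = 0" for s by (auto simp: w_def indicator_def)
      then show ?thesis by (simp only: Bochner_Integration.integral_zero)
    next
      case True
      define x where "x = min t T / T"
      have x: "0 < x" "x \<le> 1" "T * x = min t T" using True T by (auto simp: x_def)
      obtain r where r: "\<And>n. 0 < r n" "\<And>n. of_rat (r n) < x" "(\<lambda>n. of_rat (r n)) \<longlonglongrightarrow> x"
        using rational_sequence_below[OF x(1)] by blast
      \<comment> \<open>Dividing by n + 2 rather than n + 1 keeps p n strictly below r n also for n
        = 0. Both endpoints stay inside (0, 1) while p n tends to 0 and r n to x.\<close>
      define p where "p n = r n / of_nat (n + 2)" for n
      have p_lim: "(\<lambda>n. of_rat (p n)) \<longlonglongrightarrow> (0::real)"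
      proof (rule tendsto_sandwich[OF _ _ tendsto_const LIMSEQ_inverse_real_of_nat])
        show "\<forall>\<^sub>F n in sequentially. (of_rat (p n) :: real) \<le> inverse (real (Suc n))"
        proof (intro always_eventually allI)
          fix n
          have "(of_rat (p n) :: real) = of_rat (r n) / real (n + 2)"
            by (simp only: p_def of_rat_divide of_rat_of_nat_eq)
          also have "\<dots> \<le> 1 / real (Suc n)"
          proof (rule frac_le)
            show "(of_rat (r n) :: real) \<le> 1" using r(2)[of n] x by linarith
          qed auto
          finally show "(of_rat (p n) :: real) \<le> inverse (real (Suc n))" by (simp add: divide_inverse)
        qed
        show "\<forall>\<^sub>F n in sequentially. (0::real) \<le> of_rat (p n)"
          using r(1) by (intro always_eventually allI) (simp add: p_def less_imp_le)
      qed
      have pq: "0 < p n" "p n < r n" "r n < 1" for n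
      proof -
        show "0 < p n" using r(1)[of n] by (simp add: p_def)
        show "p n < r n" using r(1)[of n] by (simp add: p_def divide_less_eq) 
        have "(of_rat (r n) :: real) < 1" using r(2)[of n] x by linarith
        then show "r n < 1" by simp
      qed
      have "(\<lambda>n. \<integral>s. w s * indicator {T * of_rat (p n)<..<T * of_rat (r n)} s \<partial>lborel) \<longlonglongrightarrow> (\<integral>s. indicator {..t} s * w s \<partial>lborel)"
      proof (rule integral_dominated_convergence[where w="\<lambda>s. \<bar>w s\<bar>"])
        show "AE s in lborel. (\<lambda>n. w s * indicator {T * of_rat (p n)<..<T * of_rat (r n)} s) \<longlonglongrightarrow> indicator {..t} s * w s"
          using AE_lborel_singleton[of "min t T"]
        proof eventually_elim
          case (elim s)
          have lim1: "(\<lambda>n. T * of_rat (p n)) \<longlonglongrightarrow> 0" using tendsto_mult[OF tendsto_const p_lim, of T] by simp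
          have lim2: "(\<lambda>n. T * of_rat (r n)) \<longlonglongrightarrow> min t T" using tendsto_mult[OF tendsto_const r(3), of T] x by simp
          show ?case
          proof (cases "0 < s \<and> s < min t T")
            case True
            have "\<forall>\<^sub>F n in sequentially. T * of_rat (p n) < s" "\<forall>\<^sub>F n in sequentially. s < T * of_rat (r n)"
              using True order_tendstoD(2)[OF lim1, of s] order_tendstoD(1)[OF lim2, of s] by auto
            then have "\<forall>\<^sub>F n in sequentially. w s * indicator {T * of_rat (p n)<..<T * of_rat (r n)} s = indicator {..t} s * w s"
              by eventually_elim (use True in auto)
            then show ?thesis by (rule tendsto_eventually)
          next
            case False
            have "w s * indicator {T * of_rat (p n)<..<T * of_rat (r n)} s = 0" for n
            proof -
              have "T * of_rat (r n) < min t T" using r(2)[of n] T x by (metis mult_strict_left_mono)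
              moreover have "0 < T * (of_rat (p n) :: real)" using pq(1) T by simp
              ultimately have "s \<notin> {T * of_rat (p n)<..<T * of_rat (r n)}"
                using False by auto
              then show ?thesis by simp
            qed
            moreover have "indicator {..t} s * w s = 0"
              using False elim by (auto simp: w_def indicator_def)
            ultimately show ?thesis by (simp only: tendsto_const)
          qed
        qed
        show "AE s in lborel. norm (w s * indicator {T * of_rat (p n)<..<T * of_rat (r n)} s) \<le> \<bar>w s\<bar>" for n
          by (auto simp: indicator_def)
      qed (use w in auto)
      then show ?thesis by (simp add: w_zero[OF pq] LIMSEQ_const_iff)
    qed
  qed
  then show ?thesis
    by eventually_elim (auto simp: w_def c_def)
qed

section \<open>Integration by parts against test functions\<close>

lemma test_fun_deriv:
  assumes "test_fun a b \<phi>"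
  shows "(\<phi> has_real_derivative deriv \<phi> t) (at t)" and "isCont (deriv \<phi>) t"
proof -
  have d: "((deriv ^^ k) \<phi>) differentiable (at t)" for k t
    using assms by (auto simp: test_fun_def)
  from d[of 0 t] show "(\<phi> has_real_derivative deriv \<phi> t) (at t)"
    by (simp add: DERIV_deriv_iff_real_differentiable)
  from d[of 1 t] show "isCont (deriv \<phi>) t"
    by (auto intro: differentiable_imp_continuous_within)
qed

lemma test_fun_support:
  assumes \<phi>: "test_fun a b \<phi>" and ab: "a < b"
  obtains c d where "a < c" "c \<le> d" "d < b" "\<And>t. t \<notin> {c..d} \<Longrightarrow> \<phi> t = 0" "\<And>t. t \<notin> {c..d} \<Longrightarrow> deriv \<phi> t = 0"
proof -
  obtain c d where cd: "a < c" "d < b" "\<And>t. t \<notin> {c..d} \<Longrightarrow> \<phi> t = 0"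
    using \<phi> unfolding test_fun_def by blast
  \<comment> \<open>The support interval in \<open>test_fun\<close> may be empty; enlarging it to
    contain the midpoint of (a, b) gives an ordered pair that still lies inside (a, b).\<close>
  define c' d' where "c' = min c ((a + b) / 2)" and "d' = max d ((a + b) / 2)"
  have zero: "\<phi> t = 0" if "t \<notin> {c'..d'}" for t
  proof (rule cd(3))
    show "t \<notin> {c..d}" using that by (auto simp: c'_def d'_def)
  qed
  have deriv_zero: "deriv \<phi> t = 0" if t: "t \<notin> {c'..d'}" for t
  proof -
    have "open (- {c'..d'})" by (simp add: open_Compl)
    then have "\<forall>\<^sub>F s in nhds t. \<phi> s = 0"
      using t zero by (intro eventually_mono[OF eventually_nhds_in_open]) auto
    then have "(\<phi> has_real_derivative 0) (at t)"
      using DERIV_cong_ev[OF refl, of \<phi> "\<lambda>_. 0" t 0 0] by simp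
    then show ?thesis by (rule DERIV_imp_deriv)
  qed
  have "a < c'" "c' \<le> d'" "d' < b"
    using cd(1,2) ab by (auto simp: c'_def d'_def)
  from that[OF this zero deriv_zero] show thesis .
qed

lemma test_fun_deriv_integrable:
  assumes \<phi>: "test_fun a b \<phi>" and ab: "a < b"
  shows "deriv \<phi> \<in> borel_measurable borel" "integrable lborel (deriv \<phi>)"
proof -
  show [measurable]: "deriv \<phi> \<in> borel_measurable borel"
    by (intro borel_measurable_continuous_onI continuous_at_imp_continuous_on ballI test_fun_deriv[OF \<phi>])
  obtain c d where cd: "\<And>t. t \<notin> {c..d} \<Longrightarrow> deriv \<phi> t = 0"
    using test_fun_support[OF \<phi> ab] by metis
  have "set_integrable lborel {c..d} (deriv \<phi>)"
    by (intro borel_integrable_atLeastAtMost' continuous_at_imp_continuous_on ballI test_fun_deriv[OF \<phi>])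
  moreover have "indicator {c..d} t *\<^sub>R deriv \<phi> t = deriv \<phi> t" for t
    using cd[of t] by (auto simp: indicator_def)
  ultimately show "integrable lborel (deriv \<phi>)"
    by (simp only: set_integrable_def)
qed

lemma integral_test_fun_deriv_above:
  assumes \<phi>: "test_fun a b \<phi>" and ab: "a < b"
  shows "(\<integral>t. rl_kernel 1 (t - s) * deriv \<phi> t \<partial>lborel) = - \<phi> s"
proof -
  note [measurable] = test_fun_deriv_integrable(1)[OF \<phi> ab]
  obtain c d where cd: "\<And>t. t \<notin> {c..d} \<Longrightarrow> \<phi> t = 0" "\<And>t. t \<notin> {c..d} \<Longrightarrow> deriv \<phi> t = 0"
    using test_fun_support[OF \<phi> ab] by metis
  \<comment> \<open>A point above s and beyond the support: the integral over the half-line may stop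
    there, and \<phi> vanishes at it.\<close>
  define y where "y = max d s + 1"
  have y: "s \<le> y" "d < y" by (auto simp: y_def)
  have "(\<integral>t. rl_kernel 1 (t - s) * deriv \<phi> t \<partial>lborel) = (\<integral>t. indicator {s..y} t *\<^sub>R deriv \<phi> t \<partial>lborel)"
  proof (rule integral_cong_AE)
    show "AE t in lborel. rl_kernel 1 (t - s) * deriv \<phi> t = indicator {s..y} t *\<^sub>R deriv \<phi> t"
      using AE_lborel_singleton[of s]
    proof eventually_elim
      case (elim t)
      then show ?case
        using cd(2)[of t] y by (auto simp: rl_kernel_1 indicator_def)
    qed
  qed measurable
  also have "\<dots> = \<phi> y - \<phi> s"
  proof (rule integral_FTC_Icc[OF y(1)])
    show "(\<phi> has_vector_derivative deriv \<phi> t) (at t within {s..y})" for t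
      using test_fun_deriv(1)[OF \<phi>, of t]
      by (simp add: has_real_derivative_iff_has_vector_derivative has_vector_derivative_at_within)
  qed (intro continuous_at_imp_continuous_on ballI test_fun_deriv[OF \<phi>])
  also have "\<phi> y = 0" using cd(1)[of y] y by simp
  finally show ?thesis by simp
qed

text \<open>Integration by parts done by Fubini: after the swap the inner integral of \<phi>' over
  (s, \<infinity>) is -\<phi>(s). The majorant is the product of the L^1 norms of q and
  \<phi>'.\<close>

lemma integral_primitive_times_deriv:
  assumes \<phi>: "test_fun a b \<phi>" and ab: "a < b" and q: "integrable lborel q"
  shows "(\<integral>t. (\<integral>s. rl_kernel 1 (t - s) * q s \<partial>lborel) * deriv \<phi> t \<partial>lborel) = - (\<integral>s. q s * \<phi> s \<partial>lborel)"
proof -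
  note [measurable] = test_fun_deriv_integrable(1)[OF \<phi> ab]
  note i = test_fun_deriv_integrable(2)[OF \<phi> ab]
  have [measurable]: "q \<in> borel_measurable borel" using q by auto
  have "(\<integral>t. (\<integral>s. rl_kernel 1 (t - s) * q s \<partial>lborel) * deriv \<phi> t \<partial>lborel)
    = (\<integral>t. \<integral>s. rl_kernel 1 (t - s) * q s * deriv \<phi> t \<partial>lborel \<partial>lborel)"
    by simp
  also have "\<dots> = (\<integral>s. \<integral>t. rl_kernel 1 (t - s) * q s * deriv \<phi> t \<partial>lborel \<partial>lborel)"
  proof (rule lborel_pair.Fubini_integral)
    have "(\<integral>\<^sup>+s. \<integral>\<^sup>+t. ennreal (norm (rl_kernel 1 (t - s) * q s * deriv \<phi> t)) \<partial>lborel \<partial>lborel)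
      \<le> (\<integral>\<^sup>+s. \<integral>\<^sup>+t. ennreal \<bar>q s\<bar> * ennreal \<bar>deriv \<phi> t\<bar> \<partial>lborel \<partial>lborel)"
      by (intro nn_integral_mono) (auto simp: rl_kernel_1 abs_mult ennreal_mult[symmetric] indicator_def)
    also have "\<dots> = (\<integral>\<^sup>+s. ennreal \<bar>q s\<bar> \<partial>lborel) * (\<integral>\<^sup>+t. ennreal \<bar>deriv \<phi> t\<bar> \<partial>lborel)"
      by (simp add: nn_integral_cmult nn_integral_multc)
    also have "\<dots> < \<infinity>"
      using q i by (auto simp: integrable_iff_bounded ennreal_mult_less_top)
    finally show "integrable (lborel \<Otimes>\<^sub>M lborel) (\<lambda>(s, t). rl_kernel 1 (t - s) * q s * deriv \<phi> t)"
      by (subst integrable_iff_bounded, subst lborel.nn_integral_fst[symmetric]) (auto simp: split_beta')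
  qed
  also have "\<dots> = (\<integral>s. q s * (\<integral>t. rl_kernel 1 (t - s) * deriv \<phi> t \<partial>lborel) \<partial>lborel)"
    by (intro Bochner_Integration.integral_cong refl, subst integral_mult_right_zero[symmetric]) (simp add: mult_ac)
  also have "\<dots> = - (\<integral>s. q s * \<phi> s \<partial>lborel)"
    by (simp add: integral_test_fun_deriv_above[OF \<phi> ab])
  finally show ?thesis .
qed

section \<open>Reduction of the vector-valued problem to almost every point\<close>

context L2_pair
begin

text \<open>J^1 v satisfies the same tested identity as J^b u, so their difference is orthogonal to
  the derivatives of the test functions and du Bois-Reymond applies. The constant is kept as an
  explicit mean, which later makes it measurable in x.\<close>

lemma primitive_up_to_constant:
  assumes b: "0 < b"
    and eq: "\<And>p q n. 0 < p \<Longrightarrow> p < q \<Longrightarrow> q < 1 \<Longrightarrow> \<exists>\<phi>. test_fun 0 T \<phi> \<and>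
      deriv \<phi> = (\<lambda>t. unit_bump (T * of_rat p) (T * of_rat q) n t - unit_bump (T / 3) (2 * T / 3) n t) \<and>
      (\<integral>t. (\<integral>r. rl_kernel b (t - r) * u r \<partial>lborel) * deriv \<phi> t \<partial>lborel) = - (\<integral>t. v t * \<phi> t \<partial>lborel)"
  shows "AE t in lborel. t \<in> {0<..<T} \<longrightarrow>
    (\<integral>r. rl_kernel b (t - r) * u r \<partial>lborel) - (\<integral>r. rl_kernel 1 (t - r) * v r \<partial>lborel)
    = 3 / T * (\<integral>t. ((\<integral>r. rl_kernel b (t - r) * u r \<partial>lborel) - (\<integral>r. rl_kernel 1 (t - r) * v r \<partial>lborel))
        * indicator {T / 3<..<2 * T / 3} t \<partial>lborel)"
proof -
  define U V where "U t = (\<integral>r. rl_kernel b (t - r) * u r \<partial>lborel)"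
    and "V t = (\<integral>r. rl_kernel 1 (t - r) * v r \<partial>lborel)" for t
  \<comment> \<open>Both terms are cut off at T because J^b u is known to be integrable only up to
    T; the bumps live inside (0, T) and do not see the cut.\<close>
  define W where "W t = rl_kernel 1 (T - t) * U t - rl_kernel 1 (T - t) * V t" for t
  have iU: "integrable lborel (\<lambda>t. rl_kernel 1 (T - t) * U t)"
    unfolding U_def by (rule integrable_iterated_rl_kernel(1)[OF b])
  have iV: "integrable lborel (\<lambda>t. rl_kernel 1 (T - t) * V t)"
    unfolding V_def by (rule integrable_iterated_rl_kernel(2)) simp
  have W: "integrable lborel W"
    unfolding W_def using iU iV by simp
  have W_eq: "W t = U t - V t" if "t < T" for t
    using that by (simp add: W_def rl_kernel_1)
  have "AE t in lborel. t \<in> {0<..<T} \<longrightarrow> W t = 3 / T * (\<integral>t. W t * indicator {T / 3<..<2 * T / 3} t \<partial>lborel)"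
  proof (rule du_Bois_Reymond[OF W T])
    fix p q :: rat and n
    assume pq: "0 < p" "p < q" "q < 1"
    let ?\<psi> = "\<lambda>t. unit_bump (T * of_rat p) (T * of_rat q) n t - unit_bump (T / 3) (2 * T / 3) n t"
    obtain \<phi> where \<phi>: "test_fun 0 T \<phi>" "deriv \<phi> = ?\<psi>"
      "(\<integral>t. U t * deriv \<phi> t \<partial>lborel) = - (\<integral>t. v t * \<phi> t \<partial>lborel)"
      using eq[OF pq, of n] unfolding U_def by blast
    have zero: "rl_kernel 1 (T - t) * h * ?\<psi> t = h * ?\<psi> t" for t h
    proof (cases "t < T")
      case False
      have "T * of_rat q < T" using pq T by simp
      then have "t \<notin> {T * of_rat p<..<T * of_rat q}"
        using False by (metis greaterThanLessThan_iff less_trans)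
      moreover have "t \<notin> {T / 3<..<2 * T / 3}" using False T by auto
      ultimately show ?thesis by (simp add: unit_bump_support)
    qed (simp add: rl_kernel_1)
    have int: "integrable lborel (\<lambda>t. h t * ?\<psi> t)" if "integrable lborel h" for h
      unfolding right_diff_distrib using integrable_times_unit_bump[OF that] by simp
    have "(\<integral>t. W t * ?\<psi> t \<partial>lborel) = (\<integral>t. rl_kernel 1 (T - t) * U t * ?\<psi> t - rl_kernel 1 (T - t) * V t * ?\<psi> t \<partial>lborel)"
      by (simp add: W_def left_diff_distrib)
    also have "\<dots> = (\<integral>t. U t * ?\<psi> t \<partial>lborel) - (\<integral>t. V t * ?\<psi> t \<partial>lborel)"
      using int[OF iU] int[OF iV] by (simp only: zero Bochner_Integration.integral_diff)
    also have "\<dots> = 0"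
      using \<phi>(3) integral_primitive_times_deriv[OF \<phi>(1) T v_int] by (simp add: \<phi>(2) V_def)
    finally show "(\<integral>t. W t * ?\<psi> t \<partial>lborel) = 0" .
  qed
  moreover have "(\<integral>t. W t * indicator {T / 3<..<2 * T / 3} t \<partial>lborel)
    = (\<integral>t. (U t - V t) * indicator {T / 3<..<2 * T / 3} t \<partial>lborel)"
    using T by (intro Bochner_Integration.integral_cong) (auto simp: indicator_def W_eq)
  ultimately have "AE t in lborel. t \<in> {0<..<T} \<longrightarrow> U t - V t = 3 / T * (\<integral>t. (U t - V t) * indicator {T / 3<..<2 * T / 3} t \<partial>lborel)"
    by (auto elim!: eventually_mono simp: W_eq)
  then show ?thesis unfolding U_def V_def .
qed

end

text \<open>Cauchy-Schwarz with the kernel split into two square roots; its mass over (0, t) is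
  \<open>rl_kernel (b + 1) t\<close> by the semigroup law with J^1. If the convolution does not
  converge absolutely, its Bochner integral is 0 by convention and the bound is trivial.\<close>

lemma rl_kernel_conv_square_le:
  fixes w :: "real \<Rightarrow> real"
  assumes b: "0 < b" and [measurable]: "w \<in> borel_measurable borel" and w: "\<And>s. s \<le> 0 \<Longrightarrow> w s = 0"
  shows "ennreal ((\<integral>s. rl_kernel b (t - s) * w s \<partial>lborel)\<^sup>2)
    \<le> ennreal (rl_kernel (b + 1) t) * (\<integral>\<^sup>+s. ennreal (rl_kernel b (t - s) * (w s)\<^sup>2) \<partial>lborel)"
proof (cases "integrable lborel (\<lambda>s. rl_kernel b (t - s) * w s)")
  case False
  then show ?thesis by (simp add: not_integrable_integral_eq)
next
  case True
  note nn = rl_kernel_nonneg[OF b]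
  let ?p = "\<lambda>s. ennreal (sqrt (rl_kernel b (t - s)) * rl_kernel 1 s)"
  let ?q = "\<lambda>s. ennreal (sqrt (rl_kernel b (t - s)) * \<bar>w s\<bar>)"
  have "ennreal \<bar>\<integral>s. rl_kernel b (t - s) * w s \<partial>lborel\<bar> \<le> (\<integral>\<^sup>+s. ennreal \<bar>rl_kernel b (t - s) * w s\<bar> \<partial>lborel)"
    using integral_norm_bound_ennreal[OF True] by simp
  also have "\<dots> = (\<integral>\<^sup>+s. ?p s * ?q s \<partial>lborel)"
  proof (intro nn_integral_cong)
    fix s
    show "ennreal \<bar>rl_kernel b (t - s) * w s\<bar> = ?p s * ?q s"
    proof (cases "0 < s")
      case True
      have "sqrt (rl_kernel b (t - s)) * (sqrt (rl_kernel b (t - s)) * \<bar>w s\<bar>) = \<bar>rl_kernel b (t - s) * w s\<bar>"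
        using nn by (simp add: abs_mult mult.assoc[symmetric])
      with True nn show ?thesis by (simp add: rl_kernel_1 ennreal_mult[symmetric])
    qed (simp add: w)
  qed
  finally have "(ennreal \<bar>\<integral>s. rl_kernel b (t - s) * w s \<partial>lborel\<bar>)\<^sup>2 \<le> (\<integral>\<^sup>+s. ?p s * ?q s \<partial>lborel)\<^sup>2"
    by (rule power_mono) simp
  also have "\<dots> \<le> (\<integral>\<^sup>+s. (?p s)\<^sup>2 \<partial>lborel) * (\<integral>\<^sup>+s. (?q s)\<^sup>2 \<partial>lborel)"
    by (rule Cauchy_Schwarz_nn_integral) measurable
  also have "(\<integral>\<^sup>+s. (?p s)\<^sup>2 \<partial>lborel) = (\<integral>\<^sup>+s. ennreal (rl_kernel b (t - s) * rl_kernel 1 s) \<partial>lborel)"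
    using nn by (intro nn_integral_cong) (auto simp: ennreal_power power_mult_distrib rl_kernel_1 indicator_def)
  also have "\<dots> = ennreal (rl_kernel (b + 1) t)"
    by (rule rl_kernel_semigroup[OF b]) simp
  also have "(\<integral>\<^sup>+s. (?q s)\<^sup>2 \<partial>lborel) = (\<integral>\<^sup>+s. ennreal (rl_kernel b (t - s) * (w s)\<^sup>2) \<partial>lborel)"
    using nn by (intro nn_integral_cong) (auto simp: ennreal_power power_mult_distrib)
  finally show ?thesis by (simp add: ennreal_power)
qed

locale vector_fractional =
  fixes \<Omega> :: "'a::euclidean_space set" and T \<alpha> C :: real and f g :: "real \<Rightarrow> 'a \<Rightarrow> real"
  assumes \<Omega> [measurable]: "\<Omega> \<in> sets borel" and T: "0 < T" and \<alpha>: "0 < \<alpha>" "\<alpha> < 1" and C: "0 \<le> C"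
    and f_meas: "(\<lambda>p. f (fst p) (snd p)) \<in> borel_measurable borel"
    and f_Linf: "AE t in lborel. t \<in> {0<..<T} \<longrightarrow> (\<integral>\<^sup>+x\<in>\<Omega>. ennreal ((f t x)\<^sup>2) \<partial>lborel) \<le> ennreal C"
    and g_meas: "(\<lambda>p. g (fst p) (snd p)) \<in> borel_measurable borel"
    and g_L2: "(\<integral>\<^sup>+t\<in>{0<..<T}. (\<integral>\<^sup>+x\<in>\<Omega>. ennreal ((g t x)\<^sup>2) \<partial>lborel) \<partial>lborel) < \<infinity>"
    and g_deriv: "weak_deriv_L2 T \<Omega> (RL_int_vec \<alpha> f) g"
begin

text \<open>Zero extension in time and space turns all integrals into integrals over full spaces,
  where Tonelli and the convolution lemmas apply directly.\<close>

definition f0 :: "real \<Rightarrow> 'a \<Rightarrow> real" where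
  "f0 t x = indicator {0<..<T} t * indicator \<Omega> x * f t x"

definition g0 :: "real \<Rightarrow> 'a \<Rightarrow> real" where
  "g0 t x = indicator {0<..<T} t * indicator \<Omega> x * g t x"

lemma f0_measurable [measurable (raw)]:
  assumes [measurable]: "a \<in> M \<rightarrow>\<^sub>M borel" "b \<in> M \<rightarrow>\<^sub>M borel"
  shows "(\<lambda>w. f0 (a w) (b w)) \<in> borel_measurable M"
proof -
  have [measurable]: "(\<lambda>w. f (a w) (b w)) \<in> borel_measurable M"
    using measurable_compose[OF borel_measurable_Pair[OF assms] f_meas] by simp
  show ?thesis unfolding f0_def by measurable
qed

lemma g0_measurable [measurable (raw)]:
  assumes [measurable]: "a \<in> M \<rightarrow>\<^sub>M borel" "b \<in> M \<rightarrow>\<^sub>M borel"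
  shows "(\<lambda>w. g0 (a w) (b w)) \<in> borel_measurable M"
proof -
  have [measurable]: "(\<lambda>w. g (a w) (b w)) \<in> borel_measurable M"
    using measurable_compose[OF borel_measurable_Pair[OF assms] g_meas] by simp
  show ?thesis unfolding g0_def by measurable
qed

lemma f0_support: "t \<notin> {0<..<T} \<Longrightarrow> f0 t x = 0" and g0_support: "t \<notin> {0<..<T} \<Longrightarrow> g0 t x = 0"
  by (auto simp: f0_def g0_def)

lemma f0_square: "(\<integral>\<^sup>+x. ennreal ((f0 t x)\<^sup>2) \<partial>lborel) = indicator {0<..<T} t * (\<integral>\<^sup>+x\<in>\<Omega>. ennreal ((f t x)\<^sup>2) \<partial>lborel)"
  by (cases "t \<in> {0<..<T}") (auto simp: f0_def indicator_def intro!: nn_integral_cong)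

lemma g0_square: "(\<integral>\<^sup>+x. ennreal ((g0 t x)\<^sup>2) \<partial>lborel) = indicator {0<..<T} t * (\<integral>\<^sup>+x\<in>\<Omega>. ennreal ((g t x)\<^sup>2) \<partial>lborel)"
  by (cases "t \<in> {0<..<T}") (auto simp: g0_def indicator_def intro!: nn_integral_cong)

lemma f0_square_bound:
  "AE t in lborel. (\<integral>\<^sup>+x. ennreal ((f0 t x)\<^sup>2) \<partial>lborel) \<le> ennreal (C * indicator {0<..<T} t)"
  using f_Linf by eventually_elim (auto simp: f0_square indicator_def)

lemma f0_L2: "(\<integral>\<^sup>+x. \<integral>\<^sup>+t. ennreal ((f0 t x)\<^sup>2) \<partial>lborel \<partial>lborel) < \<infinity>"
proof -
  have "(\<integral>\<^sup>+x. \<integral>\<^sup>+t. ennreal ((f0 t x)\<^sup>2) \<partial>lborel \<partial>lborel) = (\<integral>\<^sup>+t. \<integral>\<^sup>+x. ennreal ((f0 t x)\<^sup>2) \<partial>lborel \<partial>lborel)"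
    by (rule lborel_pair.Fubini') measurable
  also have "\<dots> \<le> (\<integral>\<^sup>+t. ennreal (C * indicator {0<..<T} t) \<partial>lborel)"
    by (rule nn_integral_mono_AE[OF f0_square_bound])
  also have "\<dots> = ennreal C * (\<integral>\<^sup>+t. indicator {0<..<T} t \<partial>lborel)"
    using C by (subst nn_integral_cmult[symmetric]) (auto intro!: nn_integral_cong simp: ennreal_mult[symmetric] indicator_def)
  also have "\<dots> < \<infinity>" using T by (simp add: ennreal_mult_less_top)
  finally show ?thesis .
qed

lemma g0_L2: "(\<integral>\<^sup>+x. \<integral>\<^sup>+t. ennreal ((g0 t x)\<^sup>2) \<partial>lborel \<partial>lborel) < \<infinity>"
proof -
  have "(\<integral>\<^sup>+x. \<integral>\<^sup>+t. ennreal ((g0 t x)\<^sup>2) \<partial>lborel \<partial>lborel) = (\<integral>\<^sup>+t. \<integral>\<^sup>+x. ennreal ((g0 t x)\<^sup>2) \<partial>lborel \<partial>lborel)"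
    by (rule lborel_pair.Fubini') measurable
  also have "\<dots> < \<infinity>" using g_L2 by (simp add: g0_square mult.commute)
  finally show ?thesis .
qed

lemma AE_L2_pair: "AE x in lborel. L2_pair \<alpha> T (\<lambda>t. f0 t x) (\<lambda>t. g0 t x)"
proof -
  have "AE x in lborel. (\<integral>\<^sup>+t. ennreal ((f0 t x)\<^sup>2) \<partial>lborel) \<noteq> \<infinity>"
    using f0_L2 by (intro nn_integral_PInf_AE) auto
  moreover have "AE x in lborel. (\<integral>\<^sup>+t. ennreal ((g0 t x)\<^sup>2) \<partial>lborel) \<noteq> \<infinity>"
    using g0_L2 by (intro nn_integral_PInf_AE) auto
  ultimately show ?thesis
  proof eventually_elim
    case (elim x)
    show ?case
    proof
      show "integrable lborel (\<lambda>t. (f0 t x)\<^sup>2)" "integrable lborel (\<lambda>t. (g0 t x)\<^sup>2)"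
        using elim by (auto intro!: integrableI_nonneg simp: less_top)
    qed (use \<alpha> T f0_support g0_support in auto)
  qed
qed

section \<open>The constant of integration\<close>

definition frac_f :: "real \<Rightarrow> 'a \<Rightarrow> real" where
  "frac_f t x = (\<integral>s. rl_kernel (1 - \<alpha>) (t - s) * f0 s x \<partial>lborel)"

definition prim_g :: "real \<Rightarrow> 'a \<Rightarrow> real" where
  "prim_g t x = (\<integral>s. rl_kernel 1 (t - s) * g0 s x \<partial>lborel)"

lemma frac_f_measurable [measurable (raw)]:
  assumes [measurable]: "a \<in> M \<rightarrow>\<^sub>M borel" "b \<in> M \<rightarrow>\<^sub>M borel"
  shows "(\<lambda>w. frac_f (a w) (b w)) \<in> borel_measurable M"
  unfolding frac_f_def by measurable

lemma prim_g_measurable [measurable (raw)]: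
  assumes [measurable]: "a \<in> M \<rightarrow>\<^sub>M borel" "b \<in> M \<rightarrow>\<^sub>M borel"
  shows "(\<lambda>w. prim_g (a w) (b w)) \<in> borel_measurable M"
  unfolding prim_g_def by measurable

lemma RL_int_eq_rl_kernel:
  assumes "t < T" and h: "\<And>s. 0 < s \<Longrightarrow> s < T \<Longrightarrow> h0 s = h s" "\<And>s. s \<le> 0 \<Longrightarrow> h0 s = 0"
  shows "RL_int \<alpha> h t = (\<integral>s. rl_kernel (1 - \<alpha>) (t - s) * h0 s \<partial>lborel)"
proof -
  have "RL_int \<alpha> h t = (\<integral>s. 1 / Gamma (1 - \<alpha>) * (indicator {0<..<t} s *\<^sub>R ((t - s) powr (- \<alpha>) * h s)) \<partial>lborel)"
    unfolding RL_int_def set_lebesgue_integral_def by (rule integral_mult_right_zero[symmetric])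
  also have "\<dots> = (\<integral>s. rl_kernel (1 - \<alpha>) (t - s) * h0 s \<partial>lborel)"
  proof (intro Bochner_Integration.integral_cong refl)
    fix s
    show "1 / Gamma (1 - \<alpha>) * (indicator {0<..<t} s *\<^sub>R ((t - s) powr (- \<alpha>) * h s)) = rl_kernel (1 - \<alpha>) (t - s) * h0 s"
      using assms by (cases "0 < s \<and> s < t") (auto simp: rl_kernel_def)
  qed
  finally show ?thesis .
qed

text \<open>For the zero extensions the domain \<Omega> disappears from the statement, since outside
  it both sides are 0. The null set still depends on \<phi>, so a given x cannot yet be tested
  against all test functions.\<close>

lemma weak_deriv_pointwise:
  assumes \<phi>: "test_fun 0 T \<phi>"
  shows "AE x in lborel. (\<integral>t. frac_f t x * deriv \<phi> t \<partial>lborel) = - (\<integral>t. g0 t x * \<phi> t \<partial>lborel)"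
proof -
  have "AE x in lborel. x \<in> \<Omega> \<longrightarrow>
    (LINT t:{0<..<T}|lborel. RL_int_vec \<alpha> f t x * deriv \<phi> t) = - (LINT t:{0<..<T}|lborel. g t x * \<phi> t)"
    using g_deriv \<phi> unfolding weak_deriv_L2_def by blast
  then show ?thesis
  proof eventually_elim
    case (elim x)
    show ?case
    proof (cases "x \<in> \<Omega>")
      case False
      then show ?thesis by (simp add: frac_f_def f0_def g0_def)
    next
      case True
      have "deriv \<phi> t = 0" if "t \<notin> {0<..<T}" for t
      proof -
        obtain c d where "0 < c" "d < T" "\<And>t. t \<notin> {c..d} \<Longrightarrow> deriv \<phi> t = 0"
          using test_fun_support[OF \<phi> T] by metis
        with that show ?thesis by force
      qed
      moreover have "RL_int_vec \<alpha> f t x = frac_f t x" if "t \<in> {0<..<T}" for t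
        unfolding RL_int_vec_def frac_f_def using that True
        by (intro RL_int_eq_rl_kernel) (auto simp: f0_def)
      ultimately have "indicator {0<..<T} t *\<^sub>R (RL_int_vec \<alpha> f t x * deriv \<phi> t) = frac_f t x * deriv \<phi> t" for t
        by (cases "t \<in> {0<..<T}") auto
      moreover have "indicator {0<..<T} t *\<^sub>R (g t x * \<phi> t) = g0 t x * \<phi> t" for t
        using True by (simp add: g0_def)
      ultimately show ?thesis
        using elim True by (simp only: set_lebesgue_integral_def)
    qed
  qed
qed

text \<open>The constant by which J^(1-\<alpha>) f and J^1 g may differ at x, expressed as the mean
  of their difference over the middle third of (0, T).\<close>

definition defect :: "'a \<Rightarrow> real" where
  "defect x = 3 / T * (\<integral>t. (frac_f t x - prim_g t x) * indicator {T / 3<..<2 * T / 3} t \<partial>lborel)"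

lemma defect_measurable [measurable]: "defect \<in> borel_measurable borel"
  unfolding defect_def by measurable

text \<open>The test functions are indexed by two rationals and a natural number, so the union of
  their null sets is null. Outside it the scalar du Bois-Reymond argument applies at the fixed point
  x.\<close>

lemma frac_f_eq_prim_g_plus_defect:
  "AE x in lborel. AE t in lborel. t \<in> {0<..<T} \<longrightarrow> frac_f t x - prim_g t x = defect x"
proof -
  let ?\<psi> = "\<lambda>p q n t. unit_bump (T * of_rat p) (T * of_rat q) n t - unit_bump (T / 3) (2 * T / 3) n t"
  let ?pq = "\<lambda>p q :: rat. 0 < p \<and> p < q \<and> q < 1"
  \<comment> \<open>The condition on p and q stands inside the existential so that one choice
    function serves all indices.\<close>
  have "\<exists>\<phi>. ?pq p q \<longrightarrow> test_fun 0 T \<phi> \<and> deriv \<phi> = ?\<psi> p q n" for p q n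
  proof (cases "?pq p q")
    case True
    then have "0 < T * of_rat p" "T * of_rat p < T * (of_rat q :: real)" "T * of_rat q < T"
      using T by (simp_all add: of_rat_less)
    then show ?thesis using unit_bump_diff_test_fun[of "T * of_rat p" "T * of_rat q" T "T / 3" "2 * T / 3" n] T by auto
  next
    case False
    then show ?thesis by blast
  qed
  then obtain \<phi> where \<phi>: "\<And>p q n. ?pq p q \<Longrightarrow> test_fun 0 T (\<phi> p q n) \<and> deriv (\<phi> p q n) = ?\<psi> p q n"
    by metis
  have "AE x in lborel. \<forall>p q n. ?pq p q \<longrightarrow>
    (\<integral>t. frac_f t x * deriv (\<phi> p q n) t \<partial>lborel) = - (\<integral>t. g0 t x * \<phi> p q n t \<partial>lborel)"
    unfolding AE_all_countable
  proof (intro allI)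
    fix p q n
    show "AE x in lborel. ?pq p q \<longrightarrow>
      (\<integral>t. frac_f t x * deriv (\<phi> p q n) t \<partial>lborel) = - (\<integral>t. g0 t x * \<phi> p q n t \<partial>lborel)"
      using weak_deriv_pointwise[of "\<phi> p q n"] \<phi>[of p q n] by (cases "?pq p q") auto
  qed
  then show ?thesis using AE_L2_pair
  proof eventually_elim
    case (elim x)
    then interpret L2_pair \<alpha> T "\<lambda>t. f0 t x" "\<lambda>t. g0 t x" by simp
    show ?case
      unfolding frac_f_def prim_g_def defect_def
    proof (rule primitive_up_to_constant)
      show "0 < 1 - \<alpha>" using \<alpha> by simp
      fix p q :: rat and n
      assume "0 < p" "p < q" "q < 1"
      then show "\<exists>\<phi>. test_fun 0 T \<phi> \<and> deriv \<phi> = ?\<psi> p q n \<and>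
        (\<integral>t. (\<integral>r. rl_kernel (1 - \<alpha>) (t - r) * f0 r x \<partial>lborel) * deriv \<phi> t \<partial>lborel) = - (\<integral>t. g0 t x * \<phi> t \<partial>lborel)"
        using elim(1) \<phi>[of p q n] unfolding frac_f_def by blast
    qed
  qed
qed

text \<open>Weighted Cauchy-Schwarz, then Tonelli and the bound C on the squared norm of f at almost
  every time. The result is of order t^(2 - 2 \<alpha>) and vanishes as t tends to 0; here
  boundedness in time is used and not merely square integrability.\<close>

lemma frac_f_square_bound:
  "(\<integral>\<^sup>+x. ennreal ((frac_f t x)\<^sup>2) \<partial>lborel) \<le> ennreal ((rl_kernel (2 - \<alpha>) t)\<^sup>2 * C)"
proof -
  have k: "0 \<le> rl_kernel (1 - \<alpha>) s" "0 \<le> rl_kernel (2 - \<alpha>) s" for s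
    using \<alpha> by (auto intro: rl_kernel_nonneg)
  have first: "(\<integral>\<^sup>+x. ennreal ((frac_f t x)\<^sup>2) \<partial>lborel)
    \<le> (\<integral>\<^sup>+x. ennreal (rl_kernel (1 - \<alpha> + 1) t) * (\<integral>\<^sup>+s. ennreal (rl_kernel (1 - \<alpha>) (t - s) * (f0 s x)\<^sup>2) \<partial>lborel) \<partial>lborel)"
    unfolding frac_f_def using \<alpha> by (intro nn_integral_mono rl_kernel_conv_square_le) (auto simp: f0_support)
  have "(\<integral>\<^sup>+x. \<integral>\<^sup>+s. ennreal (rl_kernel (1 - \<alpha>) (t - s) * (f0 s x)\<^sup>2) \<partial>lborel \<partial>lborel)
    = (\<integral>\<^sup>+s. \<integral>\<^sup>+x. ennreal (rl_kernel (1 - \<alpha>) (t - s) * (f0 s x)\<^sup>2) \<partial>lborel \<partial>lborel)"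
    by (rule lborel_pair.Fubini') measurable
  also have "\<dots> = (\<integral>\<^sup>+s. ennreal (rl_kernel (1 - \<alpha>) (t - s)) * (\<integral>\<^sup>+x. ennreal ((f0 s x)\<^sup>2) \<partial>lborel) \<partial>lborel)"
    using k by (intro nn_integral_cong) (auto simp: ennreal_mult nn_integral_cmult)
  also have "\<dots> \<le> (\<integral>\<^sup>+s. ennreal C * ennreal (rl_kernel (1 - \<alpha>) (t - s) * rl_kernel 1 s) \<partial>lborel)"
  proof (rule nn_integral_mono_AE)
    show "AE s in lborel. ennreal (rl_kernel (1 - \<alpha>) (t - s)) * (\<integral>\<^sup>+x. ennreal ((f0 s x)\<^sup>2) \<partial>lborel)
      \<le> ennreal C * ennreal (rl_kernel (1 - \<alpha>) (t - s) * rl_kernel 1 s)"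
      using f0_square_bound
    proof eventually_elim
      case (elim s)
      have "ennreal (C * indicator {0<..<T} s) \<le> ennreal (C * rl_kernel 1 s)"
        using C by (intro ennreal_leI mult_left_mono) (auto simp: rl_kernel_1 indicator_def)
      with elim have "(\<integral>\<^sup>+x. ennreal ((f0 s x)\<^sup>2) \<partial>lborel) \<le> ennreal (C * rl_kernel 1 s)" by (rule order_trans)
      from mult_left_mono[OF this, of "ennreal (rl_kernel (1 - \<alpha>) (t - s))"] show ?case
        using k C rl_kernel_nonneg[of 1] by (simp add: ennreal_mult[symmetric] mult_ac)
    qed
  qed
  also have "\<dots> = ennreal C * ennreal (rl_kernel (2 - \<alpha>) t)"
    using rl_kernel_semigroup[of "1 - \<alpha>" 1 t] \<alpha> by (simp add: nn_integral_cmult algebra_simps)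
  finally have second: "(\<integral>\<^sup>+x. \<integral>\<^sup>+s. ennreal (rl_kernel (1 - \<alpha>) (t - s) * (f0 s x)\<^sup>2) \<partial>lborel \<partial>lborel)
    \<le> ennreal C * ennreal (rl_kernel (2 - \<alpha>) t)" .
  have "(\<integral>\<^sup>+x. ennreal ((frac_f t x)\<^sup>2) \<partial>lborel)
    \<le> (\<integral>\<^sup>+x. ennreal (rl_kernel (1 - \<alpha> + 1) t) * (\<integral>\<^sup>+s. ennreal (rl_kernel (1 - \<alpha>) (t - s) * (f0 s x)\<^sup>2) \<partial>lborel) \<partial>lborel)"
    by (rule first)
  also have "\<dots> = ennreal (rl_kernel (2 - \<alpha>) t) * (\<integral>\<^sup>+x. \<integral>\<^sup>+s. ennreal (rl_kernel (1 - \<alpha>) (t - s) * (f0 s x)\<^sup>2) \<partial>lborel \<partial>lborel)"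
    by (subst nn_integral_cmult) (auto simp: algebra_simps)
  also have "\<dots> \<le> ennreal (rl_kernel (2 - \<alpha>) t) * (ennreal C * ennreal (rl_kernel (2 - \<alpha>) t))"
    by (rule mult_left_mono[OF second]) simp
  also have "\<dots> = ennreal ((rl_kernel (2 - \<alpha>) t)\<^sup>2 * C)"
    using k C by (simp add: ennreal_mult[symmetric] power2_eq_square mult_ac)
  finally show ?thesis .
qed

lemma prim_g_square_bound:
  "(\<integral>\<^sup>+x. ennreal ((prim_g t x)\<^sup>2) \<partial>lborel) \<le> ennreal (rl_kernel 2 t) * (\<integral>\<^sup>+x. \<integral>\<^sup>+s. ennreal ((g0 s x)\<^sup>2) \<partial>lborel \<partial>lborel)"
proof -
  have "(\<integral>\<^sup>+x. ennreal ((prim_g t x)\<^sup>2) \<partial>lborel)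
    \<le> (\<integral>\<^sup>+x. ennreal (rl_kernel (1 + 1) t) * (\<integral>\<^sup>+s. ennreal (rl_kernel 1 (t - s) * (g0 s x)\<^sup>2) \<partial>lborel) \<partial>lborel)"
    unfolding prim_g_def by (intro nn_integral_mono rl_kernel_conv_square_le) (auto simp: g0_support)
  also have "\<dots> \<le> (\<integral>\<^sup>+x. ennreal (rl_kernel 2 t) * (\<integral>\<^sup>+s. ennreal ((g0 s x)\<^sup>2) \<partial>lborel) \<partial>lborel)"
    by (intro nn_integral_mono mult_mono ennreal_leI) (auto simp: rl_kernel_1 indicator_def)
  also have "\<dots> = ennreal (rl_kernel 2 t) * (\<integral>\<^sup>+x. \<integral>\<^sup>+s. ennreal ((g0 s x)\<^sup>2) \<partial>lborel \<partial>lborel)"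
    by (rule nn_integral_cmult) measurable
  finally show ?thesis .
qed

text \<open>The a priori bound makes both \<open>frac_f\<close> and \<open>prim_g\<close> vanish in \<open>L\<^sup>2\<close> as \<open>t\<close> tends to \<open>0\<close>,
  which excludes a contribution of the kernel \<open>t\<^sup>\<alpha>\<^sup>-\<^sup>1\<close> of the fractional derivative.\<close>

lemma defect_zero: "AE x in lborel. defect x = 0"
proof -
  define G where "G = enn2real (\<integral>\<^sup>+x. \<integral>\<^sup>+s. ennreal ((g0 s x)\<^sup>2) \<partial>lborel \<partial>lborel)"
  have G: "(\<integral>\<^sup>+x. \<integral>\<^sup>+s. ennreal ((g0 s x)\<^sup>2) \<partial>lborel \<partial>lborel) = ennreal G" "0 \<le> G"
    using g0_L2 by (auto simp: G_def)
  define D where "D = (\<integral>\<^sup>+x. ennreal ((defect x)\<^sup>2) \<partial>lborel)"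
  have mono: "rl_kernel b t \<le> rl_kernel b \<delta>" if "1 \<le> b" "0 < t" "t \<le> \<delta>" for b t \<delta>
    using that by (auto simp: rl_kernel_def Gamma_real_pos less_imp_le intro!: divide_right_mono powr_mono2)
  have k: "0 \<le> rl_kernel (2 - \<alpha>) s" "0 \<le> rl_kernel 2 s" for s
    using \<alpha> by (auto intro: rl_kernel_nonneg)
  have bound: "D \<le> ennreal (2 * ((rl_kernel (2 - \<alpha>) \<delta>)\<^sup>2 * C + rl_kernel 2 \<delta> * G))" if \<delta>: "0 < \<delta>" "\<delta> < T" for \<delta>
  proof -
    let ?B = "2 * ((rl_kernel (2 - \<alpha>) \<delta>)\<^sup>2 * C + rl_kernel 2 \<delta> * G)"
    have B: "0 \<le> ?B" using C G k by auto
    \<comment> \<open>The decomposition holds only for almost every t and cannot be evaluated at a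
      chosen time. As \<open>defect\<close> does not depend on t, integrating over (0, \<delta>)
      replaces evaluation.\<close>
    have "ennreal \<delta> * D = (\<integral>\<^sup>+x. ennreal ((defect x)\<^sup>2) * (\<integral>\<^sup>+t. indicator {0<..<\<delta>} t \<partial>lborel) \<partial>lborel)"
      using \<delta> by (simp add: D_def nn_integral_cmult mult.commute[of _ "ennreal \<delta>"])
    also have "\<dots> = (\<integral>\<^sup>+x. \<integral>\<^sup>+t. ennreal ((defect x)\<^sup>2) * indicator {0<..<\<delta>} t \<partial>lborel \<partial>lborel)"
      by (simp add: nn_integral_cmult)
    also have "\<dots> \<le> (\<integral>\<^sup>+x. \<integral>\<^sup>+t. (2 * ennreal ((frac_f t x)\<^sup>2) + 2 * ennreal ((prim_g t x)\<^sup>2)) * indicator {0<..<\<delta>} t \<partial>lborel \<partial>lborel)"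
    proof (rule nn_integral_mono_AE)
      show "AE x in lborel. (\<integral>\<^sup>+t. ennreal ((defect x)\<^sup>2) * indicator {0<..<\<delta>} t \<partial>lborel)
        \<le> (\<integral>\<^sup>+t. (2 * ennreal ((frac_f t x)\<^sup>2) + 2 * ennreal ((prim_g t x)\<^sup>2)) * indicator {0<..<\<delta>} t \<partial>lborel)"
        using frac_f_eq_prim_g_plus_defect
      proof eventually_elim
        case (elim x)
        show ?case
        proof (rule nn_integral_mono_AE)
          show "AE t in lborel. ennreal ((defect x)\<^sup>2) * indicator {0<..<\<delta>} t
            \<le> (2 * ennreal ((frac_f t x)\<^sup>2) + 2 * ennreal ((prim_g t x)\<^sup>2)) * indicator {0<..<\<delta>} t"
            using elim
          proof eventually_elim
            case (elim t)
            show ?case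
            proof (cases "t \<in> {0<..<\<delta>}")
              case True
              have sq: "(a - b)\<^sup>2 \<le> 2 * a\<^sup>2 + 2 * b\<^sup>2" for a b :: real
                using sum_squares_bound[of a "-b"] by (simp add: power2_diff)
              have "defect x = frac_f t x - prim_g t x" using elim True \<delta> by simp
              then have "ennreal ((defect x)\<^sup>2) \<le> ennreal (2 * (frac_f t x)\<^sup>2 + 2 * (prim_g t x)\<^sup>2)"
                using sq[of "frac_f t x" "prim_g t x"] by (simp only: ennreal_leI)
              also have "\<dots> = 2 * ennreal ((frac_f t x)\<^sup>2) + 2 * ennreal ((prim_g t x)\<^sup>2)"
                by (simp add: ennreal_mult)
              finally show ?thesis using True by simp
            qed simp
          qed
        qed
      qed
    qed
    also have "\<dots> = (\<integral>\<^sup>+t. \<integral>\<^sup>+x. (2 * ennreal ((frac_f t x)\<^sup>2) + 2 * ennreal ((prim_g t x)\<^sup>2)) * indicator {0<..<\<delta>} t \<partial>lborel \<partial>lborel)"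
      by (rule lborel_pair.Fubini') measurable
    also have "\<dots> \<le> (\<integral>\<^sup>+t. ennreal ?B * indicator {0<..<\<delta>} t \<partial>lborel)"
    proof (rule nn_integral_mono)
      fix t
      show "(\<integral>\<^sup>+x. (2 * ennreal ((frac_f t x)\<^sup>2) + 2 * ennreal ((prim_g t x)\<^sup>2)) * indicator {0<..<\<delta>} t \<partial>lborel)
        \<le> ennreal ?B * indicator {0<..<\<delta>} t"
      proof (cases "t \<in> {0<..<\<delta>}")
        case True
        have "(\<integral>\<^sup>+x. ennreal ((frac_f t x)\<^sup>2) \<partial>lborel) \<le> ennreal ((rl_kernel (2 - \<alpha>) \<delta>)\<^sup>2 * C)"
          using True k C \<alpha> by (intro order_trans[OF frac_f_square_bound] ennreal_leI mult_right_mono power_mono mono) auto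
        moreover have "(\<integral>\<^sup>+x. ennreal ((prim_g t x)\<^sup>2) \<partial>lborel) \<le> ennreal (rl_kernel 2 \<delta> * G)"
          using True k G mono[of 2 t \<delta>]
          by (intro order_trans[OF prim_g_square_bound]) (auto simp: ennreal_mult intro!: mult_right_mono ennreal_leI)
        ultimately have "2 * (\<integral>\<^sup>+x. ennreal ((frac_f t x)\<^sup>2) \<partial>lborel) + 2 * (\<integral>\<^sup>+x. ennreal ((prim_g t x)\<^sup>2) \<partial>lborel)
          \<le> 2 * ennreal ((rl_kernel (2 - \<alpha>) \<delta>)\<^sup>2 * C) + 2 * ennreal (rl_kernel 2 \<delta> * G)"
          by (intro add_mono mult_left_mono) auto
        also have "\<dots> = ennreal ?B"
          using k C G by (simp add: ennreal_mult ennreal_plus distrib_left)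
        finally show ?thesis
          using True by (simp add: nn_integral_add nn_integral_cmult)
      qed simp
    qed
    also have "\<dots> = ennreal \<delta> * ennreal ?B"
      by (subst nn_integral_cmult_indicator) (use \<delta> in \<open>auto simp: mult.commute\<close>)
    finally have le: "ennreal \<delta> * D \<le> ennreal \<delta> * ennreal ?B" .
    have "ennreal (inverse \<delta>) * ennreal \<delta> = 1"
      using \<delta> by (simp add: ennreal_mult[symmetric])
    with mult_left_mono[OF le, of "ennreal (inverse \<delta>)"] show ?thesis
      by (simp add: mult.assoc[symmetric])
  qed
  define \<delta> where "\<delta> n = T / 2 * inverse (real (Suc n))" for n
  have \<delta>: "0 < \<delta> n" "\<delta> n < T" for n
  proof -
    show "0 < \<delta> n" using T by (simp add: \<delta>_def)
    have "\<delta> n \<le> T / 2 * 1"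
      unfolding \<delta>_def using T by (intro mult_left_mono) (auto simp: inverse_le_1_iff)
    then show "\<delta> n < T" using T by simp
  qed
  have \<delta>0: "\<delta> \<longlonglongrightarrow> 0"
    unfolding \<delta>_def using tendsto_mult[OF tendsto_const LIMSEQ_inverse_real_of_nat, of "T / 2"] by simp
  have k0: "(\<lambda>n. rl_kernel b (\<delta> n)) \<longlonglongrightarrow> 0" if "1 < b" for b
  proof -
    have "(\<lambda>n. \<delta> n powr (b - 1) / Gamma b) \<longlonglongrightarrow> 0 powr (b - 1) / Gamma b"
      using that \<delta> by (intro tendsto_divide tendsto_powr' \<delta>0 tendsto_const) (auto intro!: always_eventually less_imp_le simp: Gamma_real_nonzero)
    then show ?thesis using \<delta> by (simp add: rl_kernel_def)
  qed
  have "(\<lambda>n. ennreal (2 * ((rl_kernel (2 - \<alpha>) (\<delta> n))\<^sup>2 * C + rl_kernel 2 (\<delta> n) * G))) \<longlonglongrightarrow> ennreal (2 * (0\<^sup>2 * C + 0 * G))"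
    using \<alpha> by (intro tendsto_ennrealI tendsto_intros k0) auto
  then have "D \<le> ennreal (2 * (0\<^sup>2 * C + 0 * G))"
    by (rule LIMSEQ_le_const) (use bound[OF \<delta>] in auto)
  then have "D = 0" by simp
  then show ?thesis
    unfolding D_def by (subst (asm) nn_integral_0_iff_AE) auto
qed

lemma AE_scalar_fractional: "AE x in lborel. scalar_fractional \<alpha> T (\<lambda>t. f0 t x) (\<lambda>t. g0 t x)"
  using AE_L2_pair frac_f_eq_prim_g_plus_defect defect_zero
proof eventually_elim
  case (elim x)
  from elim(2) have "AE t in lborel. t < T \<longrightarrow> frac_f t x = prim_g t x"
  proof eventually_elim
    case (elim t)
    show ?case
    proof (cases "0 < t")
      case True
      then show ?thesis using elim \<open>defect x = 0\<close> by auto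
    next
      case False
      \<comment> \<open>For t \<le> 0 one factor always vanishes: the kernel if s \<ge> t, the
        extended functions if s < t.\<close>
      have "rl_kernel b (t - s) * f0 s x = 0" "rl_kernel b (t - s) * g0 s x = 0" for b s
        using False f0_support[of s] g0_support[of s] by (auto simp: rl_kernel_def)
      then have "frac_f t x = 0" "prim_g t x = 0"
        unfolding frac_f_def prim_g_def by (simp_all only: Bochner_Integration.integral_zero)
      then show ?thesis by simp
    qed
  qed
  with elim(1) show ?case
    unfolding scalar_fractional_def scalar_fractional_axioms_def frac_f_def prim_g_def by simp
qed

end

section \<open>Integrating the energy identity\<close>

context vector_fractional
begin

lemma product_integrable:
  "integrable (lborel \<Otimes>\<^sub>M lborel) (\<lambda>(x, \<tau>). f0 \<tau> x * g0 \<tau> x)"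
proof -
  have "integrable (lborel \<Otimes>\<^sub>M lborel) (\<lambda>p. (f0 (snd p) (fst p))\<^sup>2)"
    using f0_L2 by (subst integrable_iff_bounded, subst lborel.nn_integral_fst[symmetric]) auto
  moreover have "integrable (lborel \<Otimes>\<^sub>M lborel) (\<lambda>p. (g0 (snd p) (fst p))\<^sup>2)"
    using g0_L2 by (subst integrable_iff_bounded, subst lborel.nn_integral_fst[symmetric]) auto
  ultimately have "integrable (lborel \<Otimes>\<^sub>M lborel) (\<lambda>p. f0 (snd p) (fst p) * g0 (snd p) (fst p))"
    by (intro Cauchy_Schwarz_integral) measurable
  then show ?thesis by (simp add: split_beta')
qed

definition inner_fg :: "real \<Rightarrow> real" where
  "inner_fg \<tau> = (\<integral>x. f0 \<tau> x * g0 \<tau> x \<partial>lborel)"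

definition energy_density :: "real \<Rightarrow> ennreal" where
  "energy_density \<tau> = (\<integral>\<^sup>+x. energy \<alpha> 0 (\<lambda>t. f0 t x) \<tau> \<partial>lborel)"

lemma energy_f0_measurable [measurable (raw)]:
  assumes [measurable]: "a \<in> M \<rightarrow>\<^sub>M borel" "b \<in> M \<rightarrow>\<^sub>M borel"
  shows "(\<lambda>w. energy \<alpha> 0 (\<lambda>t. f0 t (b w)) (a w)) \<in> borel_measurable M"
  unfolding energy_def by measurable

lemma inner_fg_measurable [measurable]: "inner_fg \<in> borel_measurable borel"
  unfolding inner_fg_def by measurable

lemma energy_density_measurable [measurable]: "energy_density \<in> borel_measurable borel"
  unfolding energy_density_def by measurable

lemma inner_fg_integrable: "integrable lborel inner_fg"
  unfolding inner_fg_def using lborel_pair.integrable_snd[OF product_integrable] by simp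

text \<open>The scalar identity is integrated over x. On the left Tonelli suffices, both terms being
  nonnegative; on the right Fubini uses that \<open>f0\<close> times \<open>g0\<close> is integrable
  on the product space. The second claim again guards against truncation by
  \<open>ennreal\<close>.\<close>

lemma vector_energy_identity:
  assumes t: "t \<le> T"
  shows "(\<integral>\<^sup>+s. ennreal (rl_kernel (1 - \<alpha>) (t - s)) * (\<integral>\<^sup>+x. ennreal ((f0 s x)\<^sup>2) \<partial>lborel) \<partial>lborel)
      + (\<integral>\<^sup>+\<tau>. indicator {..<t} \<tau> * energy_density \<tau> \<partial>lborel)
    = ennreal (2 * (\<integral>\<tau>. rl_kernel 1 (t - \<tau>) * inner_fg \<tau> \<partial>lborel))"
    and "0 \<le> (\<integral>\<tau>. rl_kernel 1 (t - \<tau>) * inner_fg \<tau> \<partial>lborel)"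
proof -
  define h where "h x = (\<integral>\<tau>. indicator {..<t} \<tau> * f0 \<tau> x * g0 \<tau> x \<partial>lborel)" for x
  have ind: "rl_kernel 1 (t - \<tau>) = indicator {..<t} \<tau>" for \<tau>
    by (auto simp: rl_kernel_1 indicator_def)
  have int: "integrable (lborel \<Otimes>\<^sub>M lborel) (\<lambda>(x, \<tau>). indicator {..<t} \<tau> * f0 \<tau> x * g0 \<tau> x)"
    by (rule Bochner_Integration.integrable_bound[OF product_integrable]) (auto simp: indicator_def)
  have ih: "integrable lborel h"
    unfolding h_def using lborel_pair.integrable_fst[OF int] by simp
  have h_int: "(\<integral>x. h x \<partial>lborel) = (\<integral>\<tau>. rl_kernel 1 (t - \<tau>) * inner_fg \<tau> \<partial>lborel)"
  proof -
    have "(\<integral>x. h x \<partial>lborel) = (\<integral>\<tau>. \<integral>x. indicator {..<t} \<tau> * f0 \<tau> x * g0 \<tau> x \<partial>lborel \<partial>lborel)"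
      unfolding h_def by (rule lborel_pair.Fubini_integral[OF int, symmetric])
    also have "\<dots> = (\<integral>\<tau>. rl_kernel 1 (t - \<tau>) * inner_fg \<tau> \<partial>lborel)"
      by (simp add: inner_fg_def ind mult.assoc)
    finally show ?thesis .
  qed
  \<comment> \<open>This is what lets the integral of \<open>ennreal (2 * h x)\<close> be read as a
    real integral.\<close>
  have h_nn: "AE x in lborel. 0 \<le> h x"
    using AE_scalar_fractional by eventually_elim (simp add: h_def scalar_fractional.integral_u_v_nonneg t)
  show "0 \<le> (\<integral>\<tau>. rl_kernel 1 (t - \<tau>) * inner_fg \<tau> \<partial>lborel)"
    unfolding h_int[symmetric] by (rule integral_nonneg_AE[OF h_nn])
  have k: "0 \<le> rl_kernel (1 - \<alpha>) s" for s using \<alpha> by (simp add: rl_kernel_nonneg)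
  have "(\<integral>\<^sup>+s. ennreal (rl_kernel (1 - \<alpha>) (t - s)) * (\<integral>\<^sup>+x. ennreal ((f0 s x)\<^sup>2) \<partial>lborel) \<partial>lborel)
    = (\<integral>\<^sup>+s. \<integral>\<^sup>+x. ennreal (rl_kernel (1 - \<alpha>) (t - s) * (f0 s x)\<^sup>2) \<partial>lborel \<partial>lborel)"
    using k by (intro nn_integral_cong) (simp add: nn_integral_cmult ennreal_mult)
  also have "\<dots> = (\<integral>\<^sup>+x. \<integral>\<^sup>+s. ennreal (rl_kernel (1 - \<alpha>) (t - s) * (f0 s x)\<^sup>2) \<partial>lborel \<partial>lborel)"
    by (rule lborel_pair.Fubini') measurable
  finally have 1: "(\<integral>\<^sup>+s. ennreal (rl_kernel (1 - \<alpha>) (t - s)) * (\<integral>\<^sup>+x. ennreal ((f0 s x)\<^sup>2) \<partial>lborel) \<partial>lborel)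
    = (\<integral>\<^sup>+x. \<integral>\<^sup>+s. ennreal (rl_kernel (1 - \<alpha>) (t - s) * (f0 s x)\<^sup>2) \<partial>lborel \<partial>lborel)" .
  have "(\<integral>\<^sup>+\<tau>. indicator {..<t} \<tau> * energy_density \<tau> \<partial>lborel)
    = (\<integral>\<^sup>+\<tau>. \<integral>\<^sup>+x. indicator {..<t} \<tau> * energy \<alpha> 0 (\<lambda>t. f0 t x) \<tau> \<partial>lborel \<partial>lborel)"
    unfolding energy_density_def by (intro nn_integral_cong nn_integral_cmult[symmetric]) measurable
  also have "\<dots> = (\<integral>\<^sup>+x. \<integral>\<^sup>+\<tau>. indicator {..<t} \<tau> * energy \<alpha> 0 (\<lambda>t. f0 t x) \<tau> \<partial>lborel \<partial>lborel)"
    by (rule lborel_pair.Fubini') measurable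
  finally have "(\<integral>\<^sup>+s. ennreal (rl_kernel (1 - \<alpha>) (t - s)) * (\<integral>\<^sup>+x. ennreal ((f0 s x)\<^sup>2) \<partial>lborel) \<partial>lborel)
      + (\<integral>\<^sup>+\<tau>. indicator {..<t} \<tau> * energy_density \<tau> \<partial>lborel)
    = (\<integral>\<^sup>+x. (\<integral>\<^sup>+s. ennreal (rl_kernel (1 - \<alpha>) (t - s) * (f0 s x)\<^sup>2) \<partial>lborel)
      + (\<integral>\<^sup>+\<tau>. indicator {..<t} \<tau> * energy \<alpha> 0 (\<lambda>t. f0 t x) \<tau> \<partial>lborel) \<partial>lborel)"
    unfolding 1 by (subst nn_integral_add) simp_all
  also have "\<dots> = (\<integral>\<^sup>+x. ennreal (2 * h x) \<partial>lborel)"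
  proof (rule nn_integral_cong_AE)
    show "AE x in lborel. (\<integral>\<^sup>+s. ennreal (rl_kernel (1 - \<alpha>) (t - s) * (f0 s x)\<^sup>2) \<partial>lborel)
      + (\<integral>\<^sup>+\<tau>. indicator {..<t} \<tau> * energy \<alpha> 0 (\<lambda>t. f0 t x) \<tau> \<partial>lborel) = ennreal (2 * h x)"
      using AE_scalar_fractional
      by eventually_elim (simp add: h_def scalar_fractional.energy_identity t)
  qed
  also have "\<dots> = ennreal (\<integral>x. 2 * h x \<partial>lborel)"
    using ih h_nn by (intro nn_integral_eq_integral) auto
  finally show "(\<integral>\<^sup>+s. ennreal (rl_kernel (1 - \<alpha>) (t - s)) * (\<integral>\<^sup>+x. ennreal ((f0 s x)\<^sup>2) \<partial>lborel) \<partial>lborel)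
      + (\<integral>\<^sup>+\<tau>. indicator {..<t} \<tau> * energy_density \<tau> \<partial>lborel)
    = ennreal (2 * (\<integral>\<tau>. rl_kernel 1 (t - \<tau>) * inner_fg \<tau> \<partial>lborel))"
    by (simp add: h_int)
qed

text \<open>A real-valued representative of \<open>energy_density\<close>. Where the latter is
  infinite \<open>enn2real\<close> returns 0; by the energy identity at T this concerns only a null
  set of times below T.\<close>

definition dissipation :: "real \<Rightarrow> real" where
  "dissipation \<tau> = indicator {0<..<T} \<tau> * enn2real (energy_density \<tau>)"

lemma dissipation_measurable [measurable]: "dissipation \<in> borel_measurable borel"
  unfolding dissipation_def by measurable

lemma energy_density_finite: "(\<integral>\<^sup>+\<tau>. indicator {..<T} \<tau> * energy_density \<tau> \<partial>lborel) < \<infinity>"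
proof -
  have "(\<integral>\<^sup>+\<tau>. indicator {..<T} \<tau> * energy_density \<tau> \<partial>lborel)
    \<le> ennreal (2 * (\<integral>\<tau>. rl_kernel 1 (T - \<tau>) * inner_fg \<tau> \<partial>lborel))"
    unfolding vector_energy_identity(1)[OF order_refl, symmetric] by simp
  also have "\<dots> < \<infinity>" by simp
  finally show ?thesis .
qed

lemma energy_density_eq_dissipation:
  "AE \<tau> in lborel. \<tau> < T \<longrightarrow> energy_density \<tau> = ennreal (dissipation \<tau>)"
proof -
  have "AE \<tau> in lborel. indicator {..<T} \<tau> * energy_density \<tau> \<noteq> \<infinity>"
    using energy_density_finite by (intro nn_integral_PInf_AE) auto
  then show ?thesis
  proof eventually_elim
    case (elim \<tau>)
    show ?case
    proof (cases "0 < \<tau>")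
      case True
      then show ?thesis using elim by (auto simp: dissipation_def less_top)
    next
      case False
      \<comment> \<open>For \<tau> \<le> 0 causality leaves only s < \<tau>, where \<open>f0\<close>
        vanishes as it does at \<tau>.\<close>
      then have "shifted_kernel_deriv \<alpha> 0 (\<tau> - s) * (f0 \<tau> x - f0 s x)\<^sup>2 = 0" for s x
        using f0_support[of \<tau> x] f0_support[of s x] by (auto simp: shifted_kernel_deriv_def)
      then have "energy_density \<tau> = 0"
        unfolding energy_density_def energy_def by (simp only: ennreal_0 nn_integral_const mult_zero_left)
      with False show ?thesis by (simp add: dissipation_def)
    qed
  qed
qed

lemma dissipation_nonneg: "0 \<le> dissipation \<tau>"
  by (simp add: dissipation_def)

lemma nn_integral_energy_density:
  assumes "t \<le> T"
  shows "(\<integral>\<^sup>+\<tau>. indicator {..<t} \<tau> * energy_density \<tau> \<partial>lborel)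
    = (\<integral>\<^sup>+\<tau>. ennreal (rl_kernel 1 (t - \<tau>) * dissipation \<tau>) \<partial>lborel)"
proof (rule nn_integral_cong_AE)
  show "AE \<tau> in lborel. indicator {..<t} \<tau> * energy_density \<tau> = ennreal (rl_kernel 1 (t - \<tau>) * dissipation \<tau>)"
    using energy_density_eq_dissipation
    by eventually_elim (use assms in \<open>auto simp: rl_kernel_1 indicator_def\<close>)
qed

lemma dissipation_integrable: "integrable lborel dissipation"
proof -
  have "rl_kernel 1 (T - \<tau>) * dissipation \<tau> = dissipation \<tau>" for \<tau>
    by (auto simp: dissipation_def rl_kernel_1 indicator_def)
  then have "(\<integral>\<^sup>+\<tau>. ennreal (dissipation \<tau>) \<partial>lborel) < \<infinity>"
    using energy_density_finite nn_integral_energy_density[OF order_refl] by (simp only:)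
  then show ?thesis
    using dissipation_nonneg by (intro integrableI_nonneg) auto
qed

section \<open>The squared norm and its weak derivative\<close>

definition norm_sq :: "real \<Rightarrow> real" where
  "norm_sq t = (LINT x:\<Omega>|lborel. (f t x)\<^sup>2)"

text \<open>The energy identity solved for the derivative of the squared norm. It is integrable
  because the dissipation is, and the claimed inequality amounts to dropping the
  dissipation.\<close>

definition norm_sq_deriv :: "real \<Rightarrow> real" where
  "norm_sq_deriv t = 2 * inner_fg t - dissipation t"

lemma norm_sq_deriv_integrable: "integrable lborel norm_sq_deriv"
  unfolding norm_sq_deriv_def using inner_fg_integrable dissipation_integrable by simp

lemma norm_sq_deriv_le:
  assumes "t \<in> {0<..<T}"
  shows "norm_sq_deriv t \<le> 2 * (LINT x:\<Omega>|lborel. g t x * f t x)"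
proof -
  have "f0 t x * g0 t x = indicator \<Omega> x *\<^sub>R (g t x * f t x)" for x
    using assms by (auto simp: f0_def g0_def indicator_def)
  then have "inner_fg t = (LINT x:\<Omega>|lborel. g t x * f t x)"
    unfolding inner_fg_def set_lebesgue_integral_def by (simp only:)
  then show ?thesis
    using dissipation_nonneg[of t] by (simp add: norm_sq_deriv_def)
qed

text \<open>The \<open>ennreal\<close> identity is brought back to the reals, which is possible
  because its right-hand side is finite and bounds both terms on the left. It holds at every t in
  (0, T), so the fractional integral of the squared norm agrees there with an indefinite integral,
  with no exceptional set.\<close>

lemma RL_int_norm_sq:
  assumes t: "t \<in> {0<..<T}"
  shows "RL_int \<alpha> norm_sq t = (\<integral>\<tau>. rl_kernel 1 (t - \<tau>) * norm_sq_deriv \<tau> \<partial>lborel)"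
proof -
  have tT: "t \<le> T" "t < T" using t by auto
  have k: "0 \<le> rl_kernel (1 - \<alpha>) s" for s using \<alpha> by (simp add: rl_kernel_nonneg)
  define F0 where "F0 s = (\<integral>x. (f0 s x)\<^sup>2 \<partial>lborel)" for s
  have [measurable]: "F0 \<in> borel_measurable borel" unfolding F0_def by measurable
  have F0_nn: "0 \<le> F0 s" for s by (simp add: F0_def)
  let ?a = "\<integral>s. rl_kernel (1 - \<alpha>) (t - s) * F0 s \<partial>lborel"
  let ?b = "\<integral>\<tau>. rl_kernel 1 (t - \<tau>) * dissipation \<tau> \<partial>lborel"
  let ?c = "\<integral>\<tau>. rl_kernel 1 (t - \<tau>) * inner_fg \<tau> \<partial>lborel"
  have cut: "integrable lborel (\<lambda>\<tau>. rl_kernel 1 (t - \<tau>) * w \<tau>)" if "integrable lborel w" for w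
    by (rule Bochner_Integration.integrable_bound[OF that]) (use that in \<open>auto simp: rl_kernel_1 indicator_def\<close>)
  have "(\<integral>\<^sup>+s. ennreal (rl_kernel (1 - \<alpha>) (t - s)) * (\<integral>\<^sup>+x. ennreal ((f0 s x)\<^sup>2) \<partial>lborel) \<partial>lborel)
    = (\<integral>\<^sup>+s. ennreal (rl_kernel (1 - \<alpha>) (t - s) * F0 s) \<partial>lborel)"
  proof (rule nn_integral_cong_AE)
    show "AE s in lborel. ennreal (rl_kernel (1 - \<alpha>) (t - s)) * (\<integral>\<^sup>+x. ennreal ((f0 s x)\<^sup>2) \<partial>lborel)
      = ennreal (rl_kernel (1 - \<alpha>) (t - s) * F0 s)"
      using f0_square_bound
    proof eventually_elim
      case (elim s)
      then have fin: "(\<integral>\<^sup>+x. ennreal ((f0 s x)\<^sup>2) \<partial>lborel) < \<infinity>"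
        by (rule le_less_trans) simp
      have "integrable lborel (\<lambda>x. (f0 s x)\<^sup>2)"
        using fin by (intro integrableI_nonneg) auto
      then have "(\<integral>\<^sup>+x. ennreal ((f0 s x)\<^sup>2) \<partial>lborel) = ennreal (F0 s)"
        unfolding F0_def by (intro nn_integral_eq_integral) auto
      then show ?case using k F0_nn by (simp add: ennreal_mult)
    qed
  qed
  then have eq: "(\<integral>\<^sup>+s. ennreal (rl_kernel (1 - \<alpha>) (t - s) * F0 s) \<partial>lborel)
      + (\<integral>\<^sup>+\<tau>. ennreal (rl_kernel 1 (t - \<tau>) * dissipation \<tau>) \<partial>lborel) = ennreal (2 * ?c)"
    using vector_energy_identity(1)[OF tT(1)] nn_integral_energy_density[OF tT(1)] by simp
  have "(\<integral>\<^sup>+s. ennreal (rl_kernel (1 - \<alpha>) (t - s) * F0 s) \<partial>lborel) \<le> ennreal (2 * ?c)"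
    unfolding eq[symmetric] by simp
  then have "(\<integral>\<^sup>+s. ennreal (rl_kernel (1 - \<alpha>) (t - s) * F0 s) \<partial>lborel) < \<infinity>"
    by (rule le_less_trans) simp
  then have "integrable lborel (\<lambda>s. rl_kernel (1 - \<alpha>) (t - s) * F0 s)"
    using k F0_nn by (intro integrableI_nonneg) auto
  then have a: "(\<integral>\<^sup>+s. ennreal (rl_kernel (1 - \<alpha>) (t - s) * F0 s) \<partial>lborel) = ennreal ?a"
    using k F0_nn by (intro nn_integral_eq_integral) auto
  have b: "(\<integral>\<^sup>+\<tau>. ennreal (rl_kernel 1 (t - \<tau>) * dissipation \<tau>) \<partial>lborel) = ennreal ?b"
    using cut[OF dissipation_integrable] dissipation_nonneg by (intro nn_integral_eq_integral) (auto simp: rl_kernel_nonneg)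
  have nn: "0 \<le> ?a" "0 \<le> ?b"
    using k F0_nn dissipation_nonneg by (auto intro!: integral_nonneg_AE simp: rl_kernel_nonneg)
  have "ennreal (?a + ?b) = ennreal (2 * ?c)"
    using eq nn by (simp add: a b ennreal_plus)
  \<comment> \<open>Injectivity of \<open>ennreal\<close> holds only on nonnegative reals, hence the
    appeal to nonnegativity of \<open>?c\<close>.\<close>
  then have "?a + ?b = 2 * ?c"
    using nn vector_energy_identity(2)[OF tT(1)] by (subst (asm) ennreal_inj) auto
  moreover have "(\<integral>\<tau>. rl_kernel 1 (t - \<tau>) * norm_sq_deriv \<tau> \<partial>lborel) = 2 * ?c - ?b"
  proof -
    have "(\<integral>\<tau>. rl_kernel 1 (t - \<tau>) * norm_sq_deriv \<tau> \<partial>lborel)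
      = (\<integral>\<tau>. 2 * (rl_kernel 1 (t - \<tau>) * inner_fg \<tau>) - rl_kernel 1 (t - \<tau>) * dissipation \<tau> \<partial>lborel)"
      by (intro Bochner_Integration.integral_cong refl) (simp add: norm_sq_deriv_def algebra_simps)
    also have "\<dots> = 2 * ?c - ?b"
      using cut[OF inner_fg_integrable] cut[OF dissipation_integrable] by simp
    finally show ?thesis .
  qed
  moreover have "RL_int \<alpha> norm_sq t = ?a"
  proof (rule RL_int_eq_rl_kernel[OF tT(2)])
    show "F0 s = norm_sq s" if "0 < s" "s < T" for s
    proof -
      have "(f0 s x)\<^sup>2 = indicator \<Omega> x *\<^sub>R (f s x)\<^sup>2" for x
        using that by (auto simp: f0_def indicator_def)
      then show ?thesis unfolding F0_def norm_sq_def set_lebesgue_integral_def by (simp only:)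
    qed
    show "F0 s = 0" if "s \<le> 0" for s
      using that by (simp add: F0_def f0_support)
  qed
  ultimately show ?thesis by simp
qed

text \<open>An indefinite integral of an L^1 function is bounded by the L^1 norm, hence integrable
  on (0, T), and tested against \<phi>' it gives back the integrand by the Fubini form of
  integration by parts.\<close>

lemma weak_deriv_norm_sq: "weak_deriv_on 0 T (RL_int \<alpha> norm_sq) norm_sq_deriv"
proof -
  let ?V = "\<lambda>t. \<integral>\<tau>. rl_kernel 1 (t - \<tau>) * norm_sq_deriv \<tau> \<partial>lborel"
  have [measurable]: "norm_sq_deriv \<in> borel_measurable borel"
    using norm_sq_deriv_integrable by auto
  have cut: "integrable lborel (\<lambda>\<tau>. rl_kernel 1 (t - \<tau>) * norm_sq_deriv \<tau>)" for t
    by (rule Bochner_Integration.integrable_bound[OF norm_sq_deriv_integrable]) (auto simp: rl_kernel_1 indicator_def)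
  have V_bound: "\<bar>?V t\<bar> \<le> (\<integral>\<tau>. \<bar>norm_sq_deriv \<tau>\<bar> \<partial>lborel)" for t
  proof -
    have "\<bar>?V t\<bar> \<le> (\<integral>\<tau>. \<bar>rl_kernel 1 (t - \<tau>) * norm_sq_deriv \<tau>\<bar> \<partial>lborel)"
      by (rule integral_abs_bound)
    also have "\<dots> \<le> (\<integral>\<tau>. \<bar>norm_sq_deriv \<tau>\<bar> \<partial>lborel)"
      using cut[of t] norm_sq_deriv_integrable by (intro integral_mono) (auto simp: rl_kernel_1 indicator_def)
    finally show ?thesis .
  qed
  have "set_integrable lborel {0<..<T} ?V"
    unfolding set_integrable_def
  proof (rule Bochner_Integration.integrable_bound)
    show "integrable lborel (\<lambda>t. (\<integral>\<tau>. \<bar>norm_sq_deriv \<tau>\<bar> \<partial>lborel) * indicator {0<..<T} t)"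
      by (intro integrable_mult_right indicator_Ioo_integrable)
    show "AE t in lborel. norm (indicator {0<..<T} t *\<^sub>R ?V t) \<le> norm ((\<integral>\<tau>. \<bar>norm_sq_deriv \<tau>\<bar> \<partial>lborel) * indicator {0<..<T} t)"
      using V_bound by (auto simp: indicator_def)
  qed measurable
  then have RL_int: "set_integrable lborel {0<..<T} (RL_int \<alpha> norm_sq)"
    by (rule set_integrable_cong[THEN iffD1, rotated -1]) (auto simp: RL_int_norm_sq)
  have deriv_int: "set_integrable lborel {0<..<T} norm_sq_deriv"
    unfolding set_integrable_def using norm_sq_deriv_integrable by (intro integrable_mult_indicator) auto
  have loc: "loc_integrable_on 0 T h" if "set_integrable lborel {0<..<T} h" for h
    unfolding loc_integrable_on_def
  proof (intro allI impI)
    fix K :: "real set" assume K: "compact K \<and> K \<subseteq> {0<..<T}"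
    then show "set_integrable lborel K h"
      by (intro set_integrable_subset[OF that]) (auto simp: borel_compact)
  qed
  have "(LINT t:{0<..<T}|lborel. RL_int \<alpha> norm_sq t * deriv \<phi> t) = - (LINT t:{0<..<T}|lborel. norm_sq_deriv t * \<phi> t)"
    if \<phi>: "test_fun 0 T \<phi>" for \<phi>
  proof -
    obtain c d where cd: "0 < c" "d < T" "\<And>t. t \<notin> {c..d} \<Longrightarrow> \<phi> t = 0" "\<And>t. t \<notin> {c..d} \<Longrightarrow> deriv \<phi> t = 0"
      using test_fun_support[OF \<phi> T] by metis
    \<comment> \<open>Supports inside (0, T) allow both integrals over (0, T) to be taken over the
      whole line, where integration by parts is available.\<close>
    have zero: "\<phi> t = 0" "deriv \<phi> t = 0" if "t \<notin> {0<..<T}" for t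
      using that cd(1,2) by (intro cd(3,4); auto)+
    have "indicator {0<..<T} t *\<^sub>R (RL_int \<alpha> norm_sq t * deriv \<phi> t) = ?V t * deriv \<phi> t" for t
      using zero[of t] by (cases "t \<in> {0<..<T}") (auto simp: RL_int_norm_sq)
    moreover have "indicator {0<..<T} t *\<^sub>R (norm_sq_deriv t * \<phi> t) = norm_sq_deriv t * \<phi> t" for t
      using zero[of t] by (cases "t \<in> {0<..<T}") auto
    ultimately show ?thesis
      using integral_primitive_times_deriv[OF \<phi> T norm_sq_deriv_integrable]
      by (simp only: set_lebesgue_integral_def)
  qed
  then show ?thesis
    unfolding weak_deriv_on_def using loc[OF RL_int] loc[OF deriv_int] by blast
qed

end

theorem theorem3p10:
  fixes \<Omega> :: "'a::euclidean_space set" and T \<alpha> :: real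
    and f g :: "real \<Rightarrow> 'a \<Rightarrow> real"
  assumes "open \<Omega>" and "T > 0" and "0 < \<alpha>" and "\<alpha> < 1"
    and f_meas: "(\<lambda>p. f (fst p) (snd p)) \<in> borel_measurable borel"
    and f_Linf: "\<exists>C. AE t in lborel. t \<in> {0<..<T} \<longrightarrow>
                     (\<integral>\<^sup>+x\<in>\<Omega>. ennreal ((f t x)\<^sup>2) \<partial>lborel) \<le> ennreal C"
    and g_meas: "(\<lambda>p. g (fst p) (snd p)) \<in> borel_measurable borel"
    and g_L2: "(\<integral>\<^sup>+t\<in>{0<..<T}. (\<integral>\<^sup>+x\<in>\<Omega>. ennreal ((g t x)\<^sup>2) \<partial>lborel) \<partial>lborel) < \<infinity>"
    and g_deriv: "weak_deriv_L2 T \<Omega> (RL_int_vec \<alpha> f) g"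
  shows "\<exists>k. set_integrable lborel {0<..<T} k \<and>
             weak_deriv_on 0 T (RL_int \<alpha> (\<lambda>t. LINT x:\<Omega>|lborel. (f t x)\<^sup>2)) k \<and>
             (AE t in lborel. t \<in> {0<..<T} \<longrightarrow>
                k t \<le> 2 * (LINT x:\<Omega>|lborel. g t x * f t x))"
proof -
  obtain C where C: "AE t in lborel. t \<in> {0<..<T} \<longrightarrow>
      (\<integral>\<^sup>+x\<in>\<Omega>. ennreal ((f t x)\<^sup>2) \<partial>lborel) \<le> ennreal C"
    using f_Linf by blast
  \<comment> \<open>The locale asks for a nonnegative bound; passing from C to
    \<open>max 0 C\<close> can only enlarge the right-hand side.\<close>
  interpret vector_fractional \<Omega> T \<alpha> "max 0 C" f g
  proof
    show "AE t in lborel. t \<in> {0<..<T} \<longrightarrow>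
      (\<integral>\<^sup>+x\<in>\<Omega>. ennreal ((f t x)\<^sup>2) \<partial>lborel) \<le> ennreal (max 0 C)"
      using C by eventually_elim (auto intro: order_trans ennreal_leI)
  qed (use assms in auto)
  have "set_integrable lborel {0<..<T} norm_sq_deriv"
    unfolding set_integrable_def using norm_sq_deriv_integrable by (intro integrable_mult_indicator) auto
  moreover have "weak_deriv_on 0 T (RL_int \<alpha> (\<lambda>t. LINT x:\<Omega>|lborel. (f t x)\<^sup>2)) norm_sq_deriv"
    using weak_deriv_norm_sq by (simp only: norm_sq_def[abs_def])
  ultimately show ?thesis
    using norm_sq_deriv_le by (intro exI[of _ norm_sq_deriv]) auto
qed

end
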